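(* Let $(\mathcal{A},\phi)$ be a $W^*$-probability space with a non-degenerated normal state such that $\mathcal{A}$ is generated by a bilateral sequence $(x_i)_{i\in\mathbb{Z}}$ of selfadjoint random variables, the unit of $\mathcal{A}$ being contained in the WOT-closure of the non-unital algebra generated by $(x_i)_{i\in\mathbb{Z}}$, and such that $(x_i)_{i\in\mathbb{Z}}$ is boolean spreadable. Then the positive tail algebra $\mathcal{A}^+_{tail}$ and the negative tail algebra $\mathcal{A}^-_{tail}$ of $(x_i)_{i\in\mathbb{Z}}$ are the same.
   Context: **Non-degenerated normal state.** $\mathcal{A}$ is a von Neumann algebra and $\phi$ a normal state such that $x=0$ whenever $\phi(axb)=0$ for all $a,b\in\mathcal{A}$ ($\phi$ is not assumed faithful). The GNS representation of $\phi$ is then faithful; $\mathcal{A}$ is identified with its image, and WOT refers to it. **Boolean spreadability.** $\mathbb{C}\langle X_1,\dots,X_n\rangle$ is the algebra of noncommutative polynomials. The joint distribution of $x_1,\dots,x_n\in\mathcal{A}$ is $\mu_{x_1,\dots,x_n}(p)=\phi(p(x_1,\dots,x_n))$. For $k\le n$ in $\mathbb{N}$, $B_i(n,k)$ is the universal unital $C^*$-algebra generated by elements $u_{i,j}$ ($1\le i\le n$, $1\le j\le k$) and a projection $\mathbf{P}$ such that: (1) each $u_{i,j}$ is an orthogonal projection; (2) $\sum_{i=1}^nu_{i,j}\mathbf{P}=\mathbf{P}$ for $1\le j\le k$; (3) $u_{i,j}u_{i',j'}=0$ if $j<j'$ and $i\ge i'$. Let $\alpha^{(b)}_{n,k}:\mathbb{C}\langle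 X_1,\dots,X_k\rangle\to\mathbb{C}\langle X_1,\dots,X_n\rangle\otimes B_i(n,k)$ be the unital homomorphism with $X_j\mapsto\sum_{i=1}^nX_i\otimes u_{i,j}$. The sequence $(x_1,\dots,x_n)$ is boolean spreadable if for all $k=1,\dots,n-1$ and all $p\in\mathbb{C}\langle X_1,\dots,X_k\rangle$, $\mu_{x_1,\dots,x_n}(p)\mathbf{P}=\mathbf{P}\,\big[(\mu_{x_1,\dots,x_n}\otimes id)(\alpha^{(b)}_{n,k}(p))\big]\,\mathbf{P}$. A sequence indexed by an ordered infinite set is boolean spreadable if all its finite subsequences $(x_{i_1},\dots,x_{i_l})$, $i_1<\dots<i_l$, are. **Tail algebras.** Let $\mathcal{A}^+_k$ (resp. $\mathcal{A}^-_k$) be the WOT-closure of the non-unital algebra generated by $\{x_i:i\ge k\}$ (resp. $\{x_i:i\le k\}$). The positive tail algebra is $\mathcal{A}^+_{tail}=\bigcap_{k>0}\mathcal{A}^+_k$ and the negative tail algebra is $\mathcal{A}^-_{tail}=\bigcap_{k<0}\mathcal{A}^-_k$. *)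

theory Defs
  imports
    "HOL-Analysis.Analysis"
    "HOL-Library.Poly_Mapping"
    "HOL-Library.Function_Algebras"
begin

section \<open>Complex algebras and Hilbert spaces\<close>

class complex_vector = ab_group_add +
  fixes scaleC :: "complex \<Rightarrow> 'a \<Rightarrow> 'a" (infixr \<open>*\<^sub>C\<close> 75)
  assumes scaleC_add_right: "c *\<^sub>C (x + y) = c *\<^sub>C x + c *\<^sub>C y"
    and scaleC_add_left: "(c + d) *\<^sub>C x = c *\<^sub>C x + d *\<^sub>C x"
    and scaleC_scaleC: "c *\<^sub>C d *\<^sub>C x = (c * d) *\<^sub>C x"
    and scaleC_one: "1 *\<^sub>C x = x"

lemma scaleC_zero_right [simp]: "c *\<^sub>C (0 :: 'a :: complex_vector) = 0"
  using scaleC_add_right[of c 0 0] by simp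

lemma scaleC_zero_left [simp]: "0 *\<^sub>C (x :: 'a :: complex_vector) = 0"
  using scaleC_add_left[of 0 0 x] by simp

lemma scaleC_minus_right: "c *\<^sub>C (- (x :: 'a :: complex_vector)) = - (c *\<^sub>C x)"
  using scaleC_add_right[of c x "- x"] by (simp add: eq_neg_iff_add_eq_0 add.commute)

lemma scaleC_diff_right: "c *\<^sub>C ((x :: 'a :: complex_vector) - y) = c *\<^sub>C x - c *\<^sub>C y"
  using scaleC_add_right[of c x "- y"] by (simp add: scaleC_minus_right)

class complex_algebra_1 = complex_vector + ring_1 +
  assumes scaleC_mult_left: "(c *\<^sub>C a) * b = c *\<^sub>C (a * b)"
    and scaleC_mult_right: "a * (c *\<^sub>C b) = c *\<^sub>C (a * b)"

text \<open>The zero space is excluded so that the bounded operators form a \<^class>\<open>ring_1\<close>; an algebra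
  that carries a state never acts on the zero space.  The inner product is linear in its first
  argument.\<close>

class chilbert_space = complex_vector + banach +
  fixes cinner :: "'a \<Rightarrow> 'a \<Rightarrow> complex"
  assumes scaleR_eq_scaleC: "r *\<^sub>R x = complex_of_real r *\<^sub>C x"
    and cinner_commute: "cinner x y = cnj (cinner y x)"
    and cinner_add_left: "cinner (x + y) z = cinner x z + cinner y z"
    and cinner_scaleC_left: "cinner (c *\<^sub>C x) y = c * cinner x y"
    and cinner_self: "cinner x x = complex_of_real ((norm x)\<^sup>2)"
    and nontrivial: "\<exists>x. x \<noteq> 0"

lemma norm_scaleC: "norm (c *\<^sub>C (x :: 'a :: chilbert_space)) = cmod c * norm x"
proof -
  have "cinner (c *\<^sub>C x) (c *\<^sub>C x) = c * cnj c * cinner x x"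
    by (subst cinner_scaleC_left, subst cinner_commute)
      (simp add: cinner_scaleC_left cinner_self)
  also have "\<dots> = complex_of_real ((cmod c * norm x)\<^sup>2)"
    by (simp add: cinner_self power_mult_distrib complex_norm_square[symmetric])
  finally have "(norm (c *\<^sub>C x))\<^sup>2 = (cmod c * norm x)\<^sup>2"
    unfolding cinner_self using of_real_eq_iff by blast
  then show ?thesis by (simp add: power2_eq_iff_nonneg)
qed

section \<open>Bounded operators\<close>

definition bounded_clinear :: "('h :: chilbert_space \<Rightarrow> 'h) \<Rightarrow> bool" where
  "bounded_clinear f \<longleftrightarrow>
     (\<forall>x y. f (x + y) = f x + f y) \<and> (\<forall>c x. f (c *\<^sub>C x) = c *\<^sub>C f x) \<and>
     (\<exists>K. \<forall>x. norm (f x) \<le> K * norm x)"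

typedef (overloaded) 'h bop = "{f :: 'h :: chilbert_space \<Rightarrow> 'h. bounded_clinear f}"
  morphisms app Bop
proof
  show "(\<lambda>x. 0) \<in> {f :: 'h \<Rightarrow> 'h. bounded_clinear f}"
    by (auto simp: bounded_clinear_def intro!: exI[of _ 0])
qed

setup_lifting type_definition_bop

lemma bop_eqI: "(\<And>x. app a x = app b x) \<Longrightarrow> a = b"
  using app_inject by blast

instantiation bop :: (chilbert_space) complex_algebra_1
begin

lift_definition zero_bop :: "'a bop" is "\<lambda>x. 0"
  by (auto simp: bounded_clinear_def intro!: exI[of _ 0])

lift_definition one_bop :: "'a bop" is "\<lambda>x. x"
  by (auto simp: bounded_clinear_def intro!: exI[of _ 1])

lift_definition plus_bop :: "'a bop \<Rightarrow> 'a bop \<Rightarrow> 'a bop" is "\<lambda>f g x. f x + g x"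
proof -
  fix f g :: "'a \<Rightarrow> 'a"
  assume f: "bounded_clinear f" and g: "bounded_clinear g"
  from f g obtain K L where "\<And>x. norm (f x) \<le> K * norm x" "\<And>x. norm (g x) \<le> L * norm x"
    by (auto simp: bounded_clinear_def)
  then have "norm (f x + g x) \<le> (K + L) * norm x" for x
    by (metis add_mono distrib_right norm_triangle_mono)
  with f g show "bounded_clinear (\<lambda>x. f x + g x)"
    by (auto simp: bounded_clinear_def scaleC_add_right)
qed

lift_definition uminus_bop :: "'a bop \<Rightarrow> 'a bop" is "\<lambda>f x. - f x"
  by (auto simp: bounded_clinear_def scaleC_minus_right)

definition minus_bop :: "'a bop \<Rightarrow> 'a bop \<Rightarrow> 'a bop" where
  "minus_bop a b = a + - b"

lift_definition scaleC_bop :: "complex \<Rightarrow> 'a bop \<Rightarrow> 'a bop" is "\<lambda>c f x. c *\<^sub>C f x"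
proof -
  fix c and f :: "'a \<Rightarrow> 'a"
  assume f: "bounded_clinear f"
  then obtain K where "\<And>x. norm (f x) \<le> K * norm x" by (auto simp: bounded_clinear_def)
  then have "norm (c *\<^sub>C f x) \<le> (cmod c * K) * norm x" for x
    by (simp add: norm_scaleC mult.assoc mult_left_mono)
  then have "\<exists>K. \<forall>x. norm (c *\<^sub>C f x) \<le> K * norm x" by blast
  with f show "bounded_clinear (\<lambda>x. c *\<^sub>C f x)"
    unfolding bounded_clinear_def by (simp add: scaleC_add_right scaleC_scaleC) (simp add: mult.commute)
qed

lift_definition times_bop :: "'a bop \<Rightarrow> 'a bop \<Rightarrow> 'a bop" is "\<lambda>f g x. f (g x)"
proof -
  fix f g :: "'a \<Rightarrow> 'a"
  assume f: "bounded_clinear f" and g: "bounded_clinear g"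
  from f g obtain K L where K: "\<And>x. norm (f x) \<le> K * norm x" and L: "\<And>x. norm (g x) \<le> L * norm x"
    by (auto simp: bounded_clinear_def)
  have "norm (f (g x)) \<le> (\<bar>K\<bar> * L) * norm x" for x
  proof -
    have "norm (f (g x)) \<le> \<bar>K\<bar> * norm (g x)"
      by (rule order_trans[OF K]) (simp add: mult_right_mono)
    also have "\<dots> \<le> \<bar>K\<bar> * (L * norm x)"
      by (rule mult_left_mono[OF L]) simp
    finally show ?thesis by (simp add: mult.assoc)
  qed
  with f g show "bounded_clinear (\<lambda>x. f (g x))"
    by (auto simp: bounded_clinear_def)
qed

instance
proof
  fix a b c :: "'a bop" and z w :: complex
  show "a + b + c = a + (b + c)" by transfer (auto simp: add.assoc)
  show "a + b = b + a" by transfer (auto simp: add.commute)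
  show "0 + a = a" by transfer auto
  show "- a + a = 0" by transfer auto
  show "a - b = a + - b" by (rule minus_bop_def)
  show "z *\<^sub>C (a + b) = z *\<^sub>C a + z *\<^sub>C b" by transfer (auto simp: scaleC_add_right)
  show "(z + w) *\<^sub>C a = z *\<^sub>C a + w *\<^sub>C a" by transfer (auto simp: scaleC_add_left)
  show "z *\<^sub>C w *\<^sub>C a = (z * w) *\<^sub>C a" by transfer (auto simp: scaleC_scaleC)
  show "1 *\<^sub>C a = a" by transfer (auto simp: scaleC_one)
  show "a * b * c = a * (b * c)" by transfer auto
  show "(a + b) * c = a * c + b * c" by transfer auto
  show "a * (b + c) = a * b + a * c" by transfer (auto simp: bounded_clinear_def)
  show "1 * a = a" by transfer auto
  show "a * 1 = a" by transfer auto
  show "(0 :: 'a bop) \<noteq> 1" by transfer (metis nontrivial)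
  show "(z *\<^sub>C a) * b = z *\<^sub>C (a * b)" by transfer auto
  show "a * (z *\<^sub>C b) = z *\<^sub>C (a * b)" by transfer (auto simp: bounded_clinear_def)
qed

end

definition is_adjoint :: "'h :: chilbert_space bop \<Rightarrow> 'h bop \<Rightarrow> bool" where
  "is_adjoint a b \<longleftrightarrow> (\<forall>\<xi> \<eta>. cinner (app a \<xi>) \<eta> = cinner \<xi> (app b \<eta>))"

definition selfadjoint :: "'h :: chilbert_space bop \<Rightarrow> bool" where
  "selfadjoint a \<longleftrightarrow> is_adjoint a a"

definition projection :: "'h :: chilbert_space bop \<Rightarrow> bool" where
  "projection a \<longleftrightarrow> selfadjoint a \<and> a * a = a"

definition op_le :: "'h :: chilbert_space bop \<Rightarrow> 'h bop \<Rightarrow> bool" where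
  "op_le a b \<longleftrightarrow> selfadjoint (b - a) \<and> (\<forall>\<xi>. 0 \<le> Re (cinner (app (b - a) \<xi>) \<xi>))"

definition wot :: "'h :: chilbert_space bop topology" where
  "wot = topology_generated_by
     {{a. cinner (app a \<xi>) \<eta> \<in> U} | \<xi> \<eta> U. open U}"

section \<open>The separable Hilbert space\<close>

typedef ell2 = "{f :: nat \<Rightarrow> complex. summable (\<lambda>n. (cmod (f n))\<^sup>2)}"
  morphisms coord Ell2
  by (rule exI[of _ "\<lambda>_. 0"]) simp

setup_lifting type_definition_ell2

lemma ell2_eqI: "(\<And>n. coord f n = coord g n) \<Longrightarrow> f = g"
  using coord_inject by blast

lemma summable_coord: "summable (\<lambda>n. (cmod (coord f n))\<^sup>2)"
  using coord[of f] by simp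

lemma square_summable_add:
  assumes "summable (\<lambda>n. (cmod (f n))\<^sup>2)" "summable (\<lambda>n. (cmod (g n))\<^sup>2)"
  shows "summable (\<lambda>n. (cmod (f n + g n))\<^sup>2)"
proof (rule summable_comparison_test)
  show "summable (\<lambda>n. 2 * (cmod (f n))\<^sup>2 + 2 * (cmod (g n))\<^sup>2)"
    using assms by (intro summable_add summable_mult)
  have "(cmod (f n + g n))\<^sup>2 \<le> 2 * (cmod (f n))\<^sup>2 + 2 * (cmod (g n))\<^sup>2" for n
  proof -
    have "(cmod (f n + g n))\<^sup>2 \<le> (cmod (f n) + cmod (g n))\<^sup>2"
      by (intro power_mono norm_triangle_ineq) simp
    also have "\<dots> \<le> 2 * (cmod (f n))\<^sup>2 + 2 * (cmod (g n))\<^sup>2"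
      using sum_squares_bound[of "cmod (f n)" "cmod (g n)"] by (simp add: power2_sum)
    finally show ?thesis .
  qed
  then show "\<exists>N. \<forall>n\<ge>N. norm ((cmod (f n + g n))\<^sup>2) \<le> 2 * (cmod (f n))\<^sup>2 + 2 * (cmod (g n))\<^sup>2"
    by simp
qed

lemma square_summable_scale:
  "summable (\<lambda>n. (cmod (f n))\<^sup>2) \<Longrightarrow> summable (\<lambda>n. (cmod (c * f n))\<^sup>2)"
  by (simp add: norm_mult power_mult_distrib summable_mult)

lemma summable_coord_mult: "summable (\<lambda>n. coord f n * cnj (coord g n))"
proof (rule summable_comparison_test)
  show "summable (\<lambda>n. (cmod (coord f n))\<^sup>2 + (cmod (coord g n))\<^sup>2)"
    by (intro summable_add summable_coord)
  have "cmod (coord f n * cnj (coord g n)) \<le> (cmod (coord f n))\<^sup>2 + (cmod (coord g n))\<^sup>2" for n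
    using sum_squares_bound[of "cmod (coord f n)" "cmod (coord g n)"]
      mult_nonneg_nonneg[OF norm_ge_zero[of "coord f n"] norm_ge_zero[of "coord g n"]]
    unfolding norm_mult complex_mod_cnj by linarith
  then show "\<exists>N. \<forall>n\<ge>N. norm (coord f n * cnj (coord g n)) \<le> (cmod (coord f n))\<^sup>2 + (cmod (coord g n))\<^sup>2"
    by blast
qed

instantiation ell2 :: complex_vector
begin

lift_definition zero_ell2 :: ell2 is "\<lambda>_. 0" by simp

lift_definition plus_ell2 :: "ell2 \<Rightarrow> ell2 \<Rightarrow> ell2" is "\<lambda>f g n. f n + g n"
  by (rule square_summable_add)

lift_definition uminus_ell2 :: "ell2 \<Rightarrow> ell2" is "\<lambda>f n. - f n" by simp

definition minus_ell2 :: "ell2 \<Rightarrow> ell2 \<Rightarrow> ell2" where "minus_ell2 f g = f + - g"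

lift_definition scaleC_ell2 :: "complex \<Rightarrow> ell2 \<Rightarrow> ell2" is "\<lambda>c f n. c * f n"
  by (rule square_summable_scale)

instance
proof
  fix f g h :: ell2 and c d :: complex
  show "f + g + h = f + (g + h)" by transfer (simp add: add.assoc)
  show "f + g = g + f" by transfer (simp add: add.commute)
  show "0 + f = f" by transfer simp
  show "- f + f = 0" by transfer simp
  show "f - g = f + - g" by (rule minus_ell2_def)
  show "c *\<^sub>C (f + g) = c *\<^sub>C f + c *\<^sub>C g" by transfer (simp add: distrib_left)
  show "(c + d) *\<^sub>C f = c *\<^sub>C f + d *\<^sub>C f" by transfer (simp add: distrib_right)
  show "c *\<^sub>C d *\<^sub>C f = (c * d) *\<^sub>C f" by transfer (simp add: mult.assoc)
  show "1 *\<^sub>C f = f" by transfer simp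
qed

end

lemma coord_simps [simp]:
  "coord 0 n = 0" "coord (f + g) n = coord f n + coord g n" "coord (- f) n = - coord f n"
  "coord (f - g) n = coord f n - coord g n" "coord (c *\<^sub>C f) n = c * coord f n"
  unfolding minus_ell2_def
  by (simp_all only: zero_ell2.rep_eq plus_ell2.rep_eq uminus_ell2.rep_eq scaleC_ell2.rep_eq
      diff_conv_add_uminus)

instantiation ell2 :: real_normed_vector
begin

definition norm_ell2 :: "ell2 \<Rightarrow> real" where
  "norm_ell2 f = sqrt (suminf (\<lambda>n. (cmod (coord f n))\<^sup>2))"

definition scaleR_ell2 :: "real \<Rightarrow> ell2 \<Rightarrow> ell2" where
  "scaleR_ell2 r f = complex_of_real r *\<^sub>C f"

definition dist_ell2 :: "ell2 \<Rightarrow> ell2 \<Rightarrow> real" where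
  "dist_ell2 f g = norm (f - g)"

definition sgn_ell2 :: "ell2 \<Rightarrow> ell2" where
  "sgn_ell2 f = inverse (norm f) *\<^sub>R f"

definition uniformity_ell2 :: "(ell2 \<times> ell2) filter" where
  "uniformity_ell2 = (INF e\<in>{0 <..}. principal {(x, y). dist x y < e})"

definition open_ell2 :: "ell2 set \<Rightarrow> bool" where
  "open_ell2 U \<longleftrightarrow> (\<forall>x\<in>U. \<forall>\<^sub>F (x', y) in uniformity. x' = x \<longrightarrow> y \<in> U)"

lemma ell2_norm_le_iff:
  assumes "0 \<le> C"
  shows "norm f \<le> C \<longleftrightarrow> (\<forall>N. L2_set (\<lambda>n. cmod (coord f n)) {..<N} \<le> C)"
proof
  assume f: "norm f \<le> C"
  show "\<forall>N. L2_set (\<lambda>n. cmod (coord f n)) {..<N} \<le> C"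
  proof
    fix N
    have "L2_set (\<lambda>n. cmod (coord f n)) {..<N} \<le> norm f"
      unfolding L2_set_def norm_ell2_def
      by (intro real_sqrt_le_mono sum_le_suminf summable_coord) auto
    with f show "L2_set (\<lambda>n. cmod (coord f n)) {..<N} \<le> C" by simp
  qed
next
  assume L: "\<forall>N. L2_set (\<lambda>n. cmod (coord f n)) {..<N} \<le> C"
  have "(\<Sum>n<N. (cmod (coord f n))\<^sup>2) \<le> C\<^sup>2" for N
    by (rule sqrt_le_D) (use L in \<open>simp add: L2_set_def\<close>)
  then have "suminf (\<lambda>n. (cmod (coord f n))\<^sup>2) \<le> C\<^sup>2"
    by (intro suminf_le_const summable_coord)
  then show "norm f \<le> C"
    unfolding norm_ell2_def by (intro real_le_lsqrt assms)
qed

lemma coord_le_norm: "cmod (coord f n) \<le> norm f"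
proof -
  have "cmod (coord f n) \<le> L2_set (\<lambda>n. cmod (coord f n)) {..<Suc n}"
    using member_le_L2_set[of "{..<Suc n}" n "\<lambda>n. cmod (coord f n)"] by simp
  also have "\<dots> \<le> norm f"
    unfolding L2_set_def norm_ell2_def
    by (intro real_sqrt_le_mono sum_le_suminf summable_coord) auto
  finally show ?thesis .
qed

instance
proof
  fix f g :: ell2 and r s :: real
  have n0: "0 \<le> norm f" for f :: ell2
    unfolding norm_ell2_def by (simp add: suminf_nonneg summable_coord)
  show "r *\<^sub>R (f + g) = r *\<^sub>R f + r *\<^sub>R g" by (simp add: scaleR_ell2_def scaleC_add_right)
  show "(r + s) *\<^sub>R f = r *\<^sub>R f + s *\<^sub>R f" by (simp add: scaleR_ell2_def scaleC_add_left)
  show "r *\<^sub>R s *\<^sub>R f = (r * s) *\<^sub>R f" by (simp add: scaleR_ell2_def scaleC_scaleC)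
  show "1 *\<^sub>R f = f" by (simp add: scaleR_ell2_def scaleC_one)
  show "sgn f = inverse (norm f) *\<^sub>R f" by (rule sgn_ell2_def)
  show "dist f g = norm (f - g)" by (rule dist_ell2_def)
  show "uniformity = (INF e\<in>{0 <..}. principal {(x :: ell2, y). dist x y < e})"
    by (rule uniformity_ell2_def)
  show "open U \<longleftrightarrow> (\<forall>x\<in>U. \<forall>\<^sub>F (x', y) in uniformity. x' = x \<longrightarrow> y \<in> U)" for U :: "ell2 set"
    by (rule open_ell2_def)
  show "norm f = 0 \<longleftrightarrow> f = 0"
  proof
    assume "norm f = 0"
    then have "coord f n = 0" for n using coord_le_norm[of f n] by simp
    then show "f = 0" by (intro ell2_eqI) simp
  qed (simp add: norm_ell2_def)
  show "norm (r *\<^sub>R f) = \<bar>r\<bar> * norm f"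
    unfolding norm_ell2_def scaleR_ell2_def coord_simps norm_mult power_mult_distrib
      suminf_mult[OF summable_coord] real_sqrt_mult by simp
  show "norm (f + g) \<le> norm f + norm g"
  proof (subst ell2_norm_le_iff)
    show "0 \<le> norm f + norm g" using n0[of f] n0[of g] by simp
    show "\<forall>N. L2_set (\<lambda>n. cmod (coord (f + g) n)) {..<N} \<le> norm f + norm g"
    proof
      fix N
      have "L2_set (\<lambda>n. cmod (coord (f + g) n)) {..<N}
          \<le> L2_set (\<lambda>n. cmod (coord f n) + cmod (coord g n)) {..<N}"
        by (rule L2_set_mono) (auto simp: norm_triangle_ineq)
      also have "\<dots> \<le> L2_set (\<lambda>n. cmod (coord f n)) {..<N} + L2_set (\<lambda>n. cmod (coord g n)) {..<N}"
        by (rule L2_set_triangle_ineq)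
      also have "\<dots> \<le> norm f + norm g"
        using ell2_norm_le_iff[OF n0[of f], of f] ell2_norm_le_iff[OF n0[of g], of g]
        by (intro add_mono) auto
      finally show "L2_set (\<lambda>n. cmod (coord (f + g) n)) {..<N} \<le> norm f + norm g" .
    qed
  qed
qed

end

instance ell2 :: banach
proof
  fix X :: "nat \<Rightarrow> ell2"
  assume X: "Cauchy X"
  have cX: "Cauchy (\<lambda>m. coord (X m) n)" for n
  proof (rule metric_CauchyI)
    fix e :: real assume "0 < e"
    with X obtain M where "\<And>m m'. m \<ge> M \<Longrightarrow> m' \<ge> M \<Longrightarrow> norm (X m - X m') < e"
      unfolding Cauchy_def dist_norm by blast
    then have "\<forall>m\<ge>M. \<forall>m'\<ge>M. dist (coord (X m) n) (coord (X m') n) < e"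
      unfolding dist_norm using coord_le_norm[of "X _ - X _" n]
      by (metis coord_simps(4) order_le_less_trans)
    then show "\<exists>M. \<forall>m\<ge>M. \<forall>m'\<ge>M. dist (coord (X m) n) (coord (X m') n) < e" by blast
  qed
  define L where "L n = lim (\<lambda>m. coord (X m) n)" for n
  have L: "(\<lambda>m. coord (X m) n) \<longlonglongrightarrow> L n" for n
    unfolding L_def using cX[of n] by (simp add: Cauchy_convergent convergent_LIMSEQ_iff[symmetric])
  have est: "\<exists>M. \<forall>m\<ge>M. \<forall>N. L2_set (\<lambda>n. cmod (coord (X m) n - L n)) {..<N} \<le> e" if "0 < e" for e
  proof -
    from X that obtain M where M: "\<And>m m'. m \<ge> M \<Longrightarrow> m' \<ge> M \<Longrightarrow> norm (X m - X m') < e"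
      unfolding Cauchy_def dist_norm by blast
    have "L2_set (\<lambda>n. cmod (coord (X m) n - L n)) {..<N} \<le> e" if "m \<ge> M" for m N
    proof (rule tendsto_upperbound)
      show "(\<lambda>m'. L2_set (\<lambda>n. cmod (coord (X m) n - coord (X m') n)) {..<N})
          \<longlonglongrightarrow> L2_set (\<lambda>n. cmod (coord (X m) n - L n)) {..<N}"
        unfolding L2_set_def by (intro tendsto_intros L)
      show "\<forall>\<^sub>F m' in sequentially. L2_set (\<lambda>n. cmod (coord (X m) n - coord (X m') n)) {..<N} \<le> e"
        unfolding eventually_sequentially
      proof (intro exI allI impI)
        fix m' assume "M \<le> m'"
        with M[OF \<open>m \<ge> M\<close>] have "norm (X m - X m') \<le> e" by (simp add: less_imp_le)
        then show "L2_set (\<lambda>n. cmod (coord (X m) n - coord (X m') n)) {..<N} \<le> e"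
          using ell2_norm_le_iff[of e "X m - X m'"] \<open>0 < e\<close> by simp
      qed
    qed simp
    then show ?thesis by blast
  qed
  have sL: "summable (\<lambda>n. (cmod (L n))\<^sup>2)"
  proof -
    obtain M where M: "\<And>N. L2_set (\<lambda>n. cmod (coord (X M) n - L n)) {..<N} \<le> 1"
      using est[of 1] by auto
    have "(\<Sum>n<N. (cmod (L n - coord (X M) n))\<^sup>2) \<le> 1" for N
      using sqrt_le_D[OF M[of N, unfolded L2_set_def]] by (simp add: norm_minus_commute)
    then have "summable (\<lambda>n. (cmod (L n - coord (X M) n))\<^sup>2)"
      by (intro summableI_nonneg_bounded[where x = 1]) auto
    from square_summable_add[OF this summable_coord[of "X M"]] show ?thesis by simp
  qed
  have cL: "coord (Ell2 L) = L" using sL by (simp add: Ell2_inverse)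
  have "X \<longlonglongrightarrow> Ell2 L"
  proof (rule metric_LIMSEQ_I)
    fix e :: real assume "0 < e"
    then obtain M where "\<forall>m\<ge>M. \<forall>N. L2_set (\<lambda>n. cmod (coord (X m) n - L n)) {..<N} \<le> e / 2"
      using est[of "e / 2"] by auto
    moreover have "norm (X m - Ell2 L) \<le> e / 2 \<longleftrightarrow>
        (\<forall>N. L2_set (\<lambda>n. cmod (coord (X m) n - L n)) {..<N} \<le> e / 2)" for m
      using ell2_norm_le_iff[of "e / 2" "X m - Ell2 L"] \<open>0 < e\<close> by (simp only: cL coord_simps)
    ultimately have "\<forall>m\<ge>M. norm (X m - Ell2 L) \<le> e / 2" by blast
    then show "\<exists>M. \<forall>m\<ge>M. dist (X m) (Ell2 L) < e"
      using \<open>0 < e\<close> unfolding dist_norm by (intro exI[of _ M]) force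
  qed
  then show "convergent X" by (auto simp: convergent_def)
qed

instantiation ell2 :: chilbert_space
begin

definition cinner_ell2 :: "ell2 \<Rightarrow> ell2 \<Rightarrow> complex" where
  "cinner_ell2 f g = suminf (\<lambda>n. coord f n * cnj (coord g n))"

instance
proof
  fix f g h :: ell2 and c :: complex and r :: real
  show "r *\<^sub>R f = complex_of_real r *\<^sub>C f" by (rule scaleR_ell2_def)
  show "cinner f g = cnj (cinner g f)"
    unfolding cinner_ell2_def
    using sums_unique[OF sums_cnj[THEN iffD2, OF summable_sums[OF summable_coord_mult[of g f]]]]
    by (simp add: mult.commute)
  show "cinner (f + g) h = cinner f h + cinner g h"
    unfolding cinner_ell2_def
    by (simp add: distrib_right suminf_add[symmetric] summable_coord_mult)
  show "cinner (c *\<^sub>C f) g = c * cinner f g"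
    unfolding cinner_ell2_def by (simp add: mult.assoc suminf_mult summable_coord_mult)
  have "coord f n * cnj (coord f n) = complex_of_real ((cmod (coord f n))\<^sup>2)" for n
    by (rule complex_norm_square[symmetric])
  then have "cinner f f = complex_of_real (suminf (\<lambda>n. (cmod (coord f n))\<^sup>2))"
    unfolding cinner_ell2_def by (simp only: suminf_of_real[OF summable_coord])
  also have "suminf (\<lambda>n. (cmod (coord f n))\<^sup>2) = (norm f)\<^sup>2"
    unfolding norm_ell2_def by (simp add: suminf_nonneg summable_coord)
  finally show "cinner f f = complex_of_real ((norm f)\<^sup>2)" .
  show "\<exists>x :: ell2. x \<noteq> 0"
  proof -
    have "summable (\<lambda>n. (cmod (if n = 0 then 1 else 0 :: complex))\<^sup>2)"
      by (rule summable_finite[of "{0 :: nat}"]) auto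
    then have "coord (Ell2 (\<lambda>n. if n = 0 then 1 else 0)) 0 = 1"
      by (subst Ell2_inverse) auto
    then show ?thesis by (metis coord_simps(1) zero_neq_one)
  qed
qed

end

section \<open>Von Neumann algebras and normal states\<close>

definition von_neumann_algebra :: "'h :: chilbert_space bop set \<Rightarrow> bool" where
  "von_neumann_algebra A \<longleftrightarrow>
     1 \<in> A \<and>
     (\<forall>a\<in>A. \<forall>b\<in>A. a + b \<in> A) \<and>
     (\<forall>c. \<forall>a\<in>A. c *\<^sub>C a \<in> A) \<and>
     (\<forall>a\<in>A. \<forall>b\<in>A. a * b \<in> A) \<and>
     (\<forall>a\<in>A. \<exists>b\<in>A. is_adjoint a b) \<and>
     closedin wot A"

definition vn_generated :: "'h :: chilbert_space bop set \<Rightarrow> 'h bop set" where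
  "vn_generated S = \<Inter>{M. von_neumann_algebra M \<and> S \<subseteq> M}"

inductive_set nonunital_alg :: "'a :: complex_algebra_1 set \<Rightarrow> 'a set" for S where
  zero: "0 \<in> nonunital_alg S"
| gen: "a \<in> S \<Longrightarrow> a \<in> nonunital_alg S"
| add: "a \<in> nonunital_alg S \<Longrightarrow> b \<in> nonunital_alg S \<Longrightarrow> a + b \<in> nonunital_alg S"
| scale: "a \<in> nonunital_alg S \<Longrightarrow> c *\<^sub>C a \<in> nonunital_alg S"
| mult: "a \<in> nonunital_alg S \<Longrightarrow> b \<in> nonunital_alg S \<Longrightarrow> a * b \<in> nonunital_alg S"

text \<open>A functional on an algebra \<open>A\<close> is a function on all operators of which only the values on
  \<open>A\<close> matter.\<close>

definition state_on :: "'h :: chilbert_space bop set \<Rightarrow> ('h bop \<Rightarrow> complex) \<Rightarrow> bool" where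
  "state_on A \<phi> \<longleftrightarrow>
     (\<forall>a\<in>A. \<forall>b\<in>A. \<phi> (a + b) = \<phi> a + \<phi> b) \<and>
     (\<forall>c. \<forall>a\<in>A. \<phi> (c *\<^sub>C a) = c * \<phi> a) \<and>
     (\<forall>a\<in>A. \<forall>b\<in>A. is_adjoint a b \<longrightarrow> \<phi> (b * a) \<in> \<real> \<and> 0 \<le> Re (\<phi> (b * a))) \<and>
     \<phi> 1 = 1"

definition is_lub_in :: "'h :: chilbert_space bop set \<Rightarrow> 'h bop set \<Rightarrow> 'h bop \<Rightarrow> bool" where
  "is_lub_in A D s \<longleftrightarrow>
     s \<in> A \<and> selfadjoint s \<and> (\<forall>a\<in>D. op_le a s) \<and>
     (\<forall>t\<in>A. selfadjoint t \<and> (\<forall>a\<in>D. op_le a t) \<longrightarrow> op_le s t)"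

definition normal_on :: "'h :: chilbert_space bop set \<Rightarrow> ('h bop \<Rightarrow> complex) \<Rightarrow> bool" where
  "normal_on A \<phi> \<longleftrightarrow>
     (\<forall>D s. D \<subseteq> A \<and> D \<noteq> {} \<and> (\<forall>a\<in>D. op_le 0 a) \<and>
        (\<forall>a\<in>D. \<forall>b\<in>D. \<exists>c\<in>D. op_le a c \<and> op_le b c) \<and> is_lub_in A D s \<longrightarrow>
        Re (\<phi> s) = (SUP a\<in>D. Re (\<phi> a)))"

definition nondegenerate_on :: "'h :: chilbert_space bop set \<Rightarrow> ('h bop \<Rightarrow> complex) \<Rightarrow> bool" where
  "nondegenerate_on A \<phi> \<longleftrightarrow> (\<forall>x\<in>A. (\<forall>a\<in>A. \<forall>b\<in>A. \<phi> (a * x * b) = 0) \<longrightarrow> x = 0)"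

text \<open>\<open>(\<pi>, \<Omega>)\<close> on the Hilbert space \<open>'h\<close> is the GNS representation of \<open>(A, \<phi>)\<close>, which is
  determined by these conditions up to unitary equivalence.\<close>

definition gns_representation ::
  "'k :: chilbert_space bop set \<Rightarrow> ('k bop \<Rightarrow> complex) \<Rightarrow> ('k bop \<Rightarrow> 'h :: chilbert_space bop) \<Rightarrow> 'h \<Rightarrow> bool"
where
  "gns_representation A \<phi> \<pi> \<Omega> \<longleftrightarrow>
     \<pi> 1 = 1 \<and>
     (\<forall>a\<in>A. \<forall>b\<in>A. \<pi> (a + b) = \<pi> a + \<pi> b) \<and>
     (\<forall>c. \<forall>a\<in>A. \<pi> (c *\<^sub>C a) = c *\<^sub>C \<pi> a) \<and>
     (\<forall>a\<in>A. \<forall>b\<in>A. \<pi> (a * b) = \<pi> a * \<pi> b) \<and>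
     (\<forall>a\<in>A. \<forall>b\<in>A. is_adjoint a b \<longrightarrow> is_adjoint (\<pi> a) (\<pi> b)) \<and>
     (\<forall>a\<in>A. \<phi> a = cinner (app (\<pi> a) \<Omega>) \<Omega>) \<and>
     closure ((\<lambda>a. app (\<pi> a) \<Omega>) ` A) = UNIV"

definition gns_wot_closure ::
  "'k :: chilbert_space bop set \<Rightarrow> ('k bop \<Rightarrow> 'h :: chilbert_space bop) \<Rightarrow> 'k bop set \<Rightarrow> 'k bop set"
where
  "gns_wot_closure A \<pi> S = {a \<in> A. \<pi> a \<in> wot closure_of (\<pi> ` S)}"

section \<open>Noncommutative polynomials\<close>

datatype nc_word = Word (letters: "nat list")

instantiation nc_word :: monoid_add
begin

definition zero_nc_word :: nc_word where "0 = Word []"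

definition plus_nc_word :: "nc_word \<Rightarrow> nc_word \<Rightarrow> nc_word" where
  "v + w = Word (letters v @ letters w)"

instance
  by standard (simp_all add: zero_nc_word_def plus_nc_word_def)

end

text \<open>\<open>nc_word \<Rightarrow>\<^sub>0 'b\<close> with its convolution product is the algebraic tensor product of the
  noncommutative polynomials with \<open>'b\<close>; \<open>X\<^sub>i \<otimes> b\<close> is \<open>Poly_Mapping.single (Word [i]) b\<close>.\<close>

type_synonym nc_poly = "nc_word \<Rightarrow>\<^sub>0 complex"

definition nc_polys :: "nat \<Rightarrow> nc_poly set" where
  "nc_polys k = {p. \<forall>w\<in>Poly_Mapping.keys p. set (letters w) \<subseteq> {1..k}}"

definition nc_eval :: "(nat \<Rightarrow> 'b :: complex_algebra_1) \<Rightarrow> nc_poly \<Rightarrow> 'b" where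
  "nc_eval x p =
     (\<Sum>w\<in>Poly_Mapping.keys p. Poly_Mapping.lookup p w *\<^sub>C prod_list (map x (letters w)))"

instantiation "fun" :: (type, complex_algebra_1) complex_algebra_1
begin

definition scaleC_fun :: "complex \<Rightarrow> ('a \<Rightarrow> 'b) \<Rightarrow> 'a \<Rightarrow> 'b" where
  "scaleC_fun c f = (\<lambda>x. c *\<^sub>C f x)"

instance
  by standard
    (auto simp: scaleC_fun_def plus_fun_def times_fun_def scaleC_add_right scaleC_add_left
      scaleC_scaleC scaleC_one scaleC_mult_left scaleC_mult_right)

end

instantiation poly_mapping :: (monoid_add, complex_algebra_1) complex_algebra_1
begin

lift_definition scaleC_poly_mapping :: "complex \<Rightarrow> ('a \<Rightarrow>\<^sub>0 'b) \<Rightarrow> 'a \<Rightarrow>\<^sub>0 'b"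
  is "\<lambda>c f k. c *\<^sub>C f k"
  by (erule rev_finite_subset) auto

instance
proof
  fix c d :: complex and p q :: "'a \<Rightarrow>\<^sub>0 'b"
  have lk: "Poly_Mapping.lookup (c *\<^sub>C p) k = c *\<^sub>C Poly_Mapping.lookup p k" for c k and p :: "'a \<Rightarrow>\<^sub>0 'b"
    by (simp add: scaleC_poly_mapping.rep_eq)
  show "c *\<^sub>C (p + q) = c *\<^sub>C p + c *\<^sub>C q"
    by (rule poly_mapping_eqI) (simp add: lk lookup_add scaleC_add_right)
  show "(c + d) *\<^sub>C p = c *\<^sub>C p + d *\<^sub>C p"
    by (rule poly_mapping_eqI) (simp add: lk lookup_add scaleC_add_left)
  show "c *\<^sub>C d *\<^sub>C p = (c * d) *\<^sub>C p"
    by (rule poly_mapping_eqI) (simp add: lk scaleC_scaleC)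
  show "1 *\<^sub>C p = p"
    by (rule poly_mapping_eqI) (simp add: lk scaleC_one)
  have sm: "c *\<^sub>C p = Poly_Mapping.single 0 (c *\<^sub>C 1) * p" for c and p :: "'a \<Rightarrow>\<^sub>0 'b"
    unfolding mult_map_scale_conv_mult[symmetric]
    by (rule poly_mapping_eqI) (auto simp: lk Poly_Mapping.map.rep_eq when_def scaleC_mult_left)
  have ms: "p * Poly_Mapping.single 0 (c *\<^sub>C 1) = c *\<^sub>C p" for c and p :: "'a \<Rightarrow>\<^sub>0 'b"
  proof (rule poly_mapping_eqI)
    fix k
    let ?s = "c *\<^sub>C (1 :: 'b)"
    have inner: "Sum_any (\<lambda>q. (?s when (0 :: 'a) = q) when k = l + q) = (?s when k = l)" for l
    proof -
      have "(\<lambda>q. (?s when (0 :: 'a) = q) when k = l + q) = (\<lambda>q. (?s when k = l) when q = 0)"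
        by (rule ext) (auto simp: when_def)
      then show ?thesis by (simp only: Sum_any_when_equal)
    qed
    have "Poly_Mapping.lookup (p * Poly_Mapping.single 0 ?s) k
        = Sum_any (\<lambda>l. Poly_Mapping.lookup p l * (?s when k = l))"
      by (simp only: lookup_mult lookup_single inner)
    also have "(\<lambda>l. Poly_Mapping.lookup p l * (?s when k = l))
        = (\<lambda>l. c *\<^sub>C Poly_Mapping.lookup p l when l = k)"
      by (rule ext) (auto simp: when_def scaleC_mult_right)
    finally show "Poly_Mapping.lookup (p * Poly_Mapping.single 0 ?s) k = Poly_Mapping.lookup (c *\<^sub>C p) k"
      by (simp only: Sum_any_when_equal lk)
  qed
  show "(c *\<^sub>C p) * q = c *\<^sub>C (p * q)"
    by (metis mult.assoc sm)
  show "p * (c *\<^sub>C q) = c *\<^sub>C (p * q)"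
    by (metis mult.assoc ms sm)
qed

end

section \<open>The algebras \<open>B\<^sub>i(n,k)\<close>\<close>

definition bi_relations :: "nat \<Rightarrow> nat \<Rightarrow> (nat \<Rightarrow> nat \<Rightarrow> 'h :: chilbert_space bop) \<Rightarrow> 'h bop \<Rightarrow> bool" where
  "bi_relations n k u P \<longleftrightarrow>
     projection P \<and>
     (\<forall>i\<in>{1..n}. \<forall>j\<in>{1..k}. projection (u i j)) \<and>
     (\<forall>j\<in>{1..k}. (\<Sum>i=1..n. u i j * P) = P) \<and>
     (\<forall>i\<in>{1..n}. \<forall>i'\<in>{1..n}. \<forall>j\<in>{1..k}. \<forall>j'\<in>{1..k}. j < j' \<and> i \<ge> i' \<longrightarrow> u i j * u i' j' = 0)"

text \<open>A universal C*-algebra is the C*-algebra generated inside the direct sum of all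
  representations of its relations.  As \<open>B\<^sub>i(n,k)\<close> is unital and separable, it has a faithful unital
  representation on \<^typ>\<open>ell2\<close>, so the representations on this space suffice.  An element of the
  direct sum is a function on the families \<open>(u, P)\<close> of operators, with pointwise operations; a
  family that violates the relations is replaced by the zero family, which satisfies them.\<close>

type_synonym bi_family = "(nat \<Rightarrow> nat \<Rightarrow> ell2 bop) \<times> ell2 bop"
type_synonym bi_elem = "bi_family \<Rightarrow> ell2 bop"

definition bi_u :: "nat \<Rightarrow> nat \<Rightarrow> nat \<Rightarrow> nat \<Rightarrow> bi_elem" where
  "bi_u n k i j = (\<lambda>(u, P). if bi_relations n k u P then u i j else 0)"

definition bi_P :: "nat \<Rightarrow> nat \<Rightarrow> bi_elem" where
  "bi_P n k = (\<lambda>(u, P). if bi_relations n k u P then P else 0)"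

text \<open>The generators are selfadjoint, so the algebra they generate is closed under adjoints; the
  norm of the direct sum is the supremum of the operator norms.\<close>

definition Bi :: "nat \<Rightarrow> nat \<Rightarrow> bi_elem set" where
  "Bi n k = {b. \<forall>\<epsilon>>0.
     \<exists>a \<in> nonunital_alg ({1, bi_P n k} \<union> {bi_u n k i j | i j. i \<in> {1..n} \<and> j \<in> {1..k}}).
       \<forall>r. onorm (app (b r - a r)) \<le> \<epsilon>}"

lemma bi_relations_zero: "bi_relations n k (\<lambda>i j. 0) 0"
proof -
  have "app 0 \<xi> = 0" for \<xi> :: 'a by transfer simp
  moreover have "cinner 0 \<eta> = 0" for \<eta> :: 'a using cinner_add_left[of 0 0 \<eta>] by simp
  moreover from this have "cinner \<eta> 0 = 0" for \<eta> :: 'a by (subst cinner_commute) simp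
  ultimately show ?thesis by (simp add: bi_relations_def projection_def selfadjoint_def is_adjoint_def)
qed

lemma bi_relations_generators: "bi_relations n k (\<lambda>i j. bi_u n k i j r) (bi_P n k r)"
proof (cases "bi_relations n k (fst r) (snd r)")
  case True
  then show ?thesis by (simp add: bi_u_def bi_P_def case_prod_beta)
next
  case False
  then show ?thesis by (simp add: bi_u_def bi_P_def case_prod_beta bi_relations_zero)
qed

lemma bi_universal:
  assumes "bi_relations n k u P"
  shows "bi_u n k i j (u, P) = u i j" "bi_P n k (u, P) = P"
  using assms by (simp_all add: bi_u_def bi_P_def)

lemma nonunital_alg_subset_Bi:
  "nonunital_alg ({1, bi_P n k} \<union> {bi_u n k i j | i j. i \<in> {1..n} \<and> j \<in> {1..k}}) \<subseteq> Bi n k"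
proof
  fix b
  assume "b \<in> nonunital_alg ({1, bi_P n k} \<union> {bi_u n k i j | i j. i \<in> {1..n} \<and> j \<in> {1..k}})"
  moreover have "onorm (app (b r - b r)) = 0" for r
    by (simp add: zero_bop.rep_eq onorm_zero)
  ultimately show "b \<in> Bi n k" unfolding Bi_def by (auto intro!: bexI[of _ b])
qed

section \<open>Boolean spreadability and tail algebras\<close>

definition joint_distribution ::
  "('k :: chilbert_space bop \<Rightarrow> complex) \<Rightarrow> (nat \<Rightarrow> 'k bop) \<Rightarrow> nc_poly \<Rightarrow> complex" where
  "joint_distribution \<phi> x p = \<phi> (nc_eval x p)"

definition alpha_b :: "nat \<Rightarrow> nat \<Rightarrow> nc_poly \<Rightarrow> nc_word \<Rightarrow>\<^sub>0 bi_elem" where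
  "alpha_b n k = nc_eval (\<lambda>j. \<Sum>i=1..n. Poly_Mapping.single (Word [i]) (bi_u n k i j))"

definition tensor_id :: "(nc_poly \<Rightarrow> complex) \<Rightarrow> (nc_word \<Rightarrow>\<^sub>0 'b :: complex_algebra_1) \<Rightarrow> 'b" where
  "tensor_id \<mu> q =
     (\<Sum>w\<in>Poly_Mapping.keys q. \<mu> (Poly_Mapping.single w 1) *\<^sub>C Poly_Mapping.lookup q w)"

text \<open>\<open>x 1, \<dots>, x n\<close> is the finite sequence; other values of \<open>x\<close> are irrelevant.\<close>

definition boolean_spreadable ::
  "('k :: chilbert_space bop \<Rightarrow> complex) \<Rightarrow> nat \<Rightarrow> (nat \<Rightarrow> 'k bop) \<Rightarrow> bool" where
  "boolean_spreadable \<phi> n x \<longleftrightarrow>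
     (\<forall>k\<in>{1..<n}. \<forall>p\<in>nc_polys k.
        joint_distribution \<phi> x p *\<^sub>C bi_P n k =
        bi_P n k * tensor_id (joint_distribution \<phi> x) (alpha_b n k p) * bi_P n k)"

definition boolean_spreadable_seq ::
  "('k :: chilbert_space bop \<Rightarrow> complex) \<Rightarrow> ('i :: linorder \<Rightarrow> 'k bop) \<Rightarrow> bool" where
  "boolean_spreadable_seq \<phi> x \<longleftrightarrow>
     (\<forall>l (i :: nat \<Rightarrow> 'i). strict_mono_on {1..l} i \<longrightarrow> boolean_spreadable \<phi> l (\<lambda>m. x (i m)))"

definition tail_plus ::
  "'k :: chilbert_space bop set \<Rightarrow> ('k bop \<Rightarrow> 'h :: chilbert_space bop) \<Rightarrow> (int \<Rightarrow> 'k bop) \<Rightarrow> 'k bop set"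
where
  "tail_plus A \<pi> x = (\<Inter>k\<in>{0<..}. gns_wot_closure A \<pi> (nonunital_alg (x ` {k..})))"

definition tail_minus ::
  "'k :: chilbert_space bop set \<Rightarrow> ('k bop \<Rightarrow> 'h :: chilbert_space bop) \<Rightarrow> (int \<Rightarrow> 'k bop) \<Rightarrow> 'k bop set"
where
  "tail_minus A \<pi> x = (\<Inter>k\<in>{..<0}. gns_wot_closure A \<pi> (nonunital_alg (x ` {..k})))"

end

theory Submission
  imports Defs
begin

text \<open>
  Write \<open>X\<^sub>w\<close> for the product of the \<open>x\<^sub>i\<close> along a word \<open>w\<close>, \<open>Y\<^sub>w = \<pi> X\<^sub>w\<close>, and \<open>w + n\<close> for the translated
  word.  Spreadability makes the moment \<open>\<phi> X\<^sub>w\<close> depend only on the relative order of the letters.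
  Hence \<open>Y\<^bsub>w+n\<^esub> \<Omega>\<close> converges weakly as \<open>n \<rightarrow> \<plusminus>\<infinity>\<close>, and since the differences of the vectors
  at \<open>+\<infinity>\<close> and at \<open>-\<infinity>\<close> are mutually orthogonal, both limits agree; call the limit \<open>F (Y\<^sub>w \<Omega>)\<close>.

  If the letters of \<open>J\<close> lie beyond those of \<open>I\<close> and \<open>I'\<close>, a representation of \<open>B\<^sub>i(n,k)\<close> by three
  rank one projections shows that \<open>\<phi> (X\<^sub>I X\<^sub>J X\<^bsub>I'\<^esub>)\<close> is the mean of the two moments in which \<open>I\<close> and
  \<open>I'\<close> are pulled apart.  Both of these are iterated limits equal to the matrix coefficient of
  \<open>Y\<^sub>J\<close> between limit vectors, so far away from given vectors \<open>Y\<^sub>J\<close> acts as \<open>F Y\<^sub>J F\<close>, on either side.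
  Consequently a tail element satisfies \<open>\<pi> a = F (\<pi> a) F\<close>, which is a limit of operators \<open>F (\<pi> b) F\<close>
  with \<open>b\<close> in the algebra, and each of these is a limit of translates of \<open>b\<close> to \<open>+\<infinity>\<close> as well as to
  \<open>-\<infinity>\<close>.

  The vectors \<open>Y\<^sub>w \<Omega>\<close> must be total in the GNS space; this is where normality of \<open>\<phi>\<close> enters.
\<close>

section \<open>Hilbert spaces and the weak operator topology\<close>

text \<open>\<open>vn_generated\<close> closes up in the weak operator topology of the space on
  which \<open>A\<close> is given, totality is a statement about the GNS space, and normality speaks
  only of suprema of positive elements. So nothing says directly that \<open>\<pi>\<close> respects
  the closure. The bridge is a commutant argument: an operator that commutes, together with its
  adjoint, with the generators on the given space commutes with all of \<open>A\<close>, and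
  intertwiners between the two representations carry this over to the GNS space. Producing enough
  intertwiners is the analytic core. On the combinatorial side, a word is split into two
  order-preserving copies governed by orthogonal projections, and \<open>P\<close> forgets which
  copy was chosen. A block of letters sent to \<open>P\<close> therefore decouples its two
  neighbours, each of which uses either copy with weight 1/2. Of the four outcomes two are the
  original moment again; cancelling them leaves the mean of the other two.\<close>

lemma cinner_add_right: "cinner x (y + z) = cinner x y + cinner x (z :: 'a :: chilbert_space)"
  by (metis cinner_add_left cinner_commute complex_cnj_add)

lemma cinner_scaleC_right: "cinner x (c *\<^sub>C y) = cnj c * cinner x (y :: 'a :: chilbert_space)"
  by (metis cinner_commute cinner_scaleC_left complex_cnj_mult)

lemma cinner_zero_left [simp]: "cinner 0 (y :: 'a :: chilbert_space) = 0"
  using cinner_add_left[of 0 0 y] by simp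

lemma cinner_zero_right [simp]: "cinner (y :: 'a :: chilbert_space) 0 = 0"
  using cinner_add_right[of y 0 0] by simp

lemma cinner_minus_left: "cinner (- x) (y :: 'a :: chilbert_space) = - cinner x y"
  using cinner_add_left[of x "- x" y] by (simp add: eq_neg_iff_add_eq_0 add.commute)

lemma cinner_minus_right: "cinner x (- y :: 'a :: chilbert_space) = - cinner x y"
  using cinner_add_right[of x y "- y"] by (simp add: eq_neg_iff_add_eq_0 add.commute)

lemma cinner_diff_left: "cinner (x - y) (z :: 'a :: chilbert_space) = cinner x z - cinner y z"
  using cinner_add_left[of x "- y" z] by (simp add: cinner_minus_left)

lemma cinner_diff_right: "cinner x (y - z :: 'a :: chilbert_space) = cinner x y - cinner x z"
  using cinner_add_right[of x y "- z"] by (simp add: cinner_minus_right)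

lemma cinner_sum_left: "cinner (\<Sum>i\<in>I. f i) (y :: 'a :: chilbert_space) = (\<Sum>i\<in>I. cinner (f i) y)"
  by (induction I rule: infinite_finite_induct) (simp_all add: cinner_add_left)

lemma cinner_sum_right: "cinner y (\<Sum>i\<in>I. f i :: 'a :: chilbert_space) = (\<Sum>i\<in>I. cinner y (f i))"
  by (induction I rule: infinite_finite_induct) (simp_all add: cinner_add_right)

lemma cinner_self_eq_0_iff [simp]: "cinner x x = 0 \<longleftrightarrow> (x :: 'a :: chilbert_space) = 0"
  by (simp add: cinner_self)

lemma Re_cinner_self: "Re (cinner x (x :: 'a :: chilbert_space)) = (norm x)\<^sup>2"
  by (simp add: cinner_self)

lemma Re_cinner_commute: "Re (cinner x y) = Re (cinner y (x :: 'a :: chilbert_space))"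
  by (subst cinner_commute) simp

lemma norm_add_sq:
  "(norm (x + y :: 'a :: chilbert_space))\<^sup>2 = (norm x)\<^sup>2 + (norm y)\<^sup>2 + 2 * Re (cinner x y)"
  unfolding Re_cinner_self[symmetric]
  using Re_cinner_commute[of x y] by (simp add: cinner_add_left cinner_add_right)

lemma norm_diff_sq:
  "(norm (x - y :: 'a :: chilbert_space))\<^sup>2 = (norm x)\<^sup>2 + (norm y)\<^sup>2 - 2 * Re (cinner x y)"
  using norm_add_sq[of x "- y"] by (simp add: cinner_minus_right)

lemma cinner_eqI: "(\<And>z. cinner x z = cinner y z) \<Longrightarrow> x = (y :: 'a :: chilbert_space)"
  using cinner_self_eq_0_iff[of "x - y"] by (simp add: cinner_diff_left del: cinner_self_eq_0_iff)

lemma cinner_eqI_right: "(\<And>z. cinner z x = cinner z y) \<Longrightarrow> x = (y :: 'a :: chilbert_space)"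
  using cinner_self_eq_0_iff[of "x - y"] by (simp add: cinner_diff_right del: cinner_self_eq_0_iff)

lemma complex_Cauchy_Schwarz: "cmod (cinner x y) \<le> norm x * norm (y :: 'a :: chilbert_space)"
proof (cases "y = 0")
  case False
  define c where "c = cinner x y / complex_of_real ((norm y)\<^sup>2)"
  have ny: "(norm y)\<^sup>2 > 0" using False by simp
  have "0 \<le> (norm (x - c *\<^sub>C y))\<^sup>2" by simp
  also have "\<dots> = (norm x)\<^sup>2 + (cmod c * norm y)\<^sup>2 - 2 * Re (cnj c * cinner x y)"
    by (simp add: norm_diff_sq norm_scaleC cinner_scaleC_right)
  also have "cnj c * cinner x y = complex_of_real ((cmod (cinner x y))\<^sup>2 / (norm y)\<^sup>2)"
    using complex_norm_square[of "cinner x y"] by (simp add: c_def mult.commute)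
  also have "(cmod c * norm y)\<^sup>2 = (cmod (cinner x y))\<^sup>2 / (norm y)\<^sup>2"
    using False by (simp add: c_def norm_divide power_mult_distrib power_divide norm_power field_simps)
  finally have "(cmod (cinner x y))\<^sup>2 / (norm y)\<^sup>2 \<le> (norm x)\<^sup>2" by simp
  then have "(cmod (cinner x y))\<^sup>2 \<le> (norm x * norm y)\<^sup>2"
    using ny by (simp add: pos_divide_le_eq power_mult_distrib)
  then show ?thesis by (rule power2_le_imp_le) simp
qed simp

lemma bounded_bilinear_cinner: "bounded_bilinear (cinner :: 'a :: chilbert_space \<Rightarrow> _)"
proof
  show "\<exists>K. \<forall>a b :: 'a. norm (cinner a b) \<le> norm a * norm b * K"
    using complex_Cauchy_Schwarz by (intro exI[of _ 1]) auto
qed (simp_all add: cinner_add_left cinner_add_right scaleR_eq_scaleC cinner_scaleC_left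
      cinner_scaleC_right scaleR_conv_of_real)

lemmas tendsto_cinner [tendsto_intros] = bounded_bilinear.tendsto[OF bounded_bilinear_cinner]
lemmas continuous_on_cinner [continuous_intros] =
  bounded_bilinear.continuous_on[OF bounded_bilinear_cinner]

lemma app_zero [simp]: "app 0 x = 0" by transfer simp
lemma app_one [simp]: "app 1 x = x" by transfer simp
lemma app_plus: "app (a + b) x = app a x + app b x" by transfer simp
lemma app_uminus: "app (- a) x = - app a x" by transfer simp
lemma app_minus: "app (a - b) x = app a x - app b x"
  unfolding minus_bop_def app_plus app_uminus by simp
lemma app_scaleC: "app (c *\<^sub>C a) x = c *\<^sub>C app a x" by transfer simp
lemma app_times: "app (a * b) x = app a (app b x)" by transfer simp

lemma app_add: "app a (x + y) = app a x + app a y"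
  using app[of a] by (simp add: bounded_clinear_def)

lemma app_scale: "app a (c *\<^sub>C x) = c *\<^sub>C app a x"
  using app[of a] by (simp add: bounded_clinear_def)

lemma app_bounded: obtains K where "K > 0" "\<And>x. norm (app a x) \<le> K * norm x"
proof -
  obtain K where K: "\<And>x. norm (app a x) \<le> K * norm x"
    using app[of a] by (auto simp: bounded_clinear_def)
  have "norm (app a x) \<le> (\<bar>K\<bar> + 1) * norm x" for x
    by (rule order_trans[OF K]) (simp add: mult_right_mono)
  then show ?thesis using that[of "\<bar>K\<bar> + 1"] by simp
qed

lemma bounded_linear_app: "bounded_linear (app a)"
proof -
  obtain K where "\<And>x. norm (app a x) \<le> K * norm x" using app_bounded by blast
  then show ?thesis
    by (intro bounded_linear_intro[of _ K]) (auto simp: app_add scaleR_eq_scaleC app_scale mult.commute)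
qed

lemmas app_diff = linear_diff[OF bounded_linear.linear[OF bounded_linear_app]]
lemmas app_neg = linear_neg[OF bounded_linear.linear[OF bounded_linear_app]]
lemmas app_0 [simp] = linear_0[OF bounded_linear.linear[OF bounded_linear_app]]
lemmas tendsto_app [tendsto_intros] = bounded_linear.tendsto[OF bounded_linear_app]
lemmas continuous_on_app [continuous_intros] = bounded_linear.continuous_on[OF bounded_linear_app]

lemmas app_simps = app_plus app_minus app_uminus app_scaleC app_times app_add app_diff app_neg app_scale

lemma app_Bop:
  assumes "\<And>x y. f (x + y) = f x + f y" "\<And>c x. f (c *\<^sub>C x) = c *\<^sub>C f x"
    and "\<And>x. norm (f x) \<le> K * norm x"
  shows "app (Bop f) = f"
  using assms by (intro Bop_inverse) (auto simp: bounded_clinear_def)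

section \<open>Subspaces, Riesz representation and orthogonal projection\<close>

definition csubspace :: "'a :: complex_vector set \<Rightarrow> bool" where
  "csubspace V \<longleftrightarrow> 0 \<in> V \<and> (\<forall>x\<in>V. \<forall>y\<in>V. x + y \<in> V) \<and> (\<forall>c. \<forall>x\<in>V. c *\<^sub>C x \<in> V)"

lemma csubspaceD:
  assumes "csubspace V"
  shows "0 \<in> V" "x \<in> V \<Longrightarrow> y \<in> V \<Longrightarrow> x + y \<in> V" "x \<in> V \<Longrightarrow> c *\<^sub>C x \<in> V"
  using assms by (auto simp: csubspace_def)

lemma csubspace_diff:
  assumes "csubspace V" "x \<in> V" "y \<in> V" shows "x - y \<in> V"
proof -
  have "(- 1) *\<^sub>C y = - y"
    by (metis add.right_inverse add_eq_0_iff scaleC_add_left scaleC_one scaleC_zero_left)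
  then show ?thesis using csubspaceD(2,3)[OF assms(1)] assms(2,3)
    by (metis diff_conv_add_uminus)
qed

lemma bounded_linear_scaleC: "bounded_linear (\<lambda>x :: 'a :: chilbert_space. c *\<^sub>C x)"
  by (rule bounded_linear_intro[of _ "cmod c"])
    (auto simp: scaleC_add_right scaleR_eq_scaleC scaleC_scaleC norm_scaleC mult.commute)

lemmas tendsto_scaleC [tendsto_intros] = bounded_linear.tendsto[OF bounded_linear_scaleC]

lemma csubspace_closure:
  fixes V :: "'a :: chilbert_space set"
  assumes "csubspace V" shows "csubspace (closure V)"
  unfolding csubspace_def
proof (intro conjI ballI allI)
  show "0 \<in> closure V" using csubspaceD(1)[OF assms] closure_subset by blast
next
  fix x y assume "x \<in> closure V" "y \<in> closure V"
  then obtain f g where "\<And>n. f n \<in> V" "f \<longlonglongrightarrow> x" "\<And>n. g n \<in> V" "g \<longlonglongrightarrow> y"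
    by (auto simp: closure_sequential)
  then show "x + y \<in> closure V" unfolding closure_sequential
    by (intro exI[of _ "\<lambda>n. f n + g n"]) (auto intro!: tendsto_intros csubspaceD[OF assms])
next
  fix c x assume "x \<in> closure V"
  then obtain f where "\<And>n. f n \<in> V" "f \<longlonglongrightarrow> x"
    by (auto simp: closure_sequential)
  then show "c *\<^sub>C x \<in> closure V" unfolding closure_sequential
    by (intro exI[of _ "\<lambda>n. c *\<^sub>C f n"]) (auto intro!: tendsto_intros csubspaceD[OF assms])
qed

text \<open>The functional is given by its graph \<open>G\<close>, so that it need not be everywhere defined; the
  representing vector minimises \<open>\<parallel>v\<parallel>\<^sup>2 - 2 Re z\<close> over \<open>(v, z) \<in> G\<close>.\<close>

lemma Riesz_graph:
  fixes G :: "('a :: chilbert_space \<times> complex) set"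
  assumes ne: "(0, 0) \<in> G"
    and add: "\<And>v z v' z'. (v, z) \<in> G \<Longrightarrow> (v', z') \<in> G \<Longrightarrow> (v + v', z + z') \<in> G"
    and scale: "\<And>c v z. (v, z) \<in> G \<Longrightarrow> (c *\<^sub>C v, c * z) \<in> G"
    and bound: "\<And>v z. (v, z) \<in> G \<Longrightarrow> cmod z \<le> C * norm v"
  obtains w where "w \<in> closure (fst ` G)" "\<And>v z. (v, z) \<in> G \<Longrightarrow> z = cinner v w"
proof -
  define J where "J p = (norm (fst p))\<^sup>2 - 2 * Re (snd p)" for p :: "'a \<times> complex"
  have lower: "- C\<^sup>2 \<le> J p" if "p \<in> G" for p
  proof -
    obtain v z where p: "p = (v, z)" by (cases p)
    have "Re z \<le> C * norm v"
      using bound that p complex_Re_le_cmod[of z] by (meson order_trans)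
    moreover have "0 \<le> (norm v - C)\<^sup>2" by simp
    then have "0 \<le> (norm v)\<^sup>2 + C\<^sup>2 - 2 * (C * norm v)"
      by (simp add: power2_diff algebra_simps)
    ultimately show ?thesis by (simp add: J_def p)
  qed
  define m where "m = (INF p\<in>G. J p)"
  have bdd: "bdd_below (J ` G)" using lower by (auto intro!: bdd_belowI2)
  have m_le: "m \<le> J p" if "p \<in> G" for p
    unfolding m_def using bdd that by (rule cINF_lower)
  have "\<exists>p\<in>G. J p < m + 1 / Suc n" for n
  proof -
    have "(INF p\<in>G. J p) < m + 1 / Suc n" by (simp add: m_def)
    then show ?thesis using cINF_less_iff[OF _ bdd] ne by blast
  qed
  then obtain p where pG: "\<And>n. p n \<in> G" and pJ: "\<And>n. J (p n) < m + 1 / Suc n" by metis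
  define v where "v n = fst (p n)" for n
  \<comment> \<open>Parallelogram identity: the midpoint of two members lies in \<open>G\<close>, so
    \<open>J\<close> is at least \<open>m\<close> there. This makes the minimising sequence
    Cauchy.\<close>
  have mid: "(norm (v n - v k))\<^sup>2 \<le> 2 * J (p n) + 2 * J (p k) - 4 * m" for n k
  proof -
    obtain a z b y where e: "p n = (a, z)" "p k = (b, y)" by (meson surj_pair)
    have "((1/2) *\<^sub>C (a + b), (1/2) * (z + y)) \<in> G"
      using pG[of n] pG[of k] e by (intro scale add) auto
    from m_le[OF this] have "4 * m \<le> (norm (a + b))\<^sup>2 - 4 * Re z - 4 * Re y"
      by (simp add: J_def norm_scaleC power_mult_distrib power_divide field_simps)
    moreover have "(norm (a - b))\<^sup>2 = 2 * (norm a)\<^sup>2 + 2 * (norm b)\<^sup>2 - (norm (a + b))\<^sup>2"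
      by (simp add: norm_add_sq norm_diff_sq)
    ultimately show ?thesis by (simp add: J_def e v_def)
  qed
  have "Cauchy v"
  proof (rule metric_CauchyI)
    fix e :: real assume "0 < e"
    then obtain N :: nat where N: "1 / Suc N < e\<^sup>2 / 4"
      using nat_approx_posE[of "e\<^sup>2 / 4"] by auto
    have "dist (v n) (v k) < e" if "n \<ge> N" "k \<ge> N" for n k
    proof -
      have "1 / real (Suc i) \<le> 1 / Suc N" if "i \<ge> N" for i
        using that by (simp add: frac_le)
      from this[OF \<open>n \<ge> N\<close>] this[OF \<open>k \<ge> N\<close>] have "(norm (v n - v k))\<^sup>2 < e\<^sup>2"
        using mid[of n k] pJ[of n] pJ[of k] N by linarith
      then show ?thesis unfolding dist_norm using \<open>0 < e\<close> by (simp add: power2_less_imp_less)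
    qed
    then show "\<exists>M. \<forall>m\<ge>M. \<forall>n\<ge>M. dist (v m) (v n) < e" by blast
  qed
  then obtain w where w: "v \<longlonglongrightarrow> w" by (auto simp: Cauchy_convergent_iff convergent_def)
  have Jlim: "(\<lambda>n. J (p n)) \<longlonglongrightarrow> m"
  proof (rule tendsto_sandwich[of "\<lambda>_. m" _ _ "\<lambda>n. m + 1 / Suc n"])
    show "(\<lambda>n. m + 1 / Suc n) \<longlonglongrightarrow> m"
      using tendsto_add[OF tendsto_const LIMSEQ_inverse_real_of_nat, of m] by (simp add: inverse_eq_divide)
  qed (use m_le[OF pG] pJ in \<open>auto intro!: always_eventually less_imp_le\<close>)
  have Re_eq: "Re z = Re (cinner a w)" if "(a, z) \<in> G" for a z
  proof -
    have "0 \<le> 2 * t * (Re (cinner w a) - Re z) + t\<^sup>2 * (norm a)\<^sup>2" for t :: real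
    proof -
      have "m \<le> J (p n) + 2 * t * (Re (cinner (v n) a) - Re z) + t\<^sup>2 * (norm a)\<^sup>2" for n
      proof -
        obtain b y where e: "p n = (b, y)" by (meson surj_pair)
        have "(b + complex_of_real t *\<^sub>C a, y + complex_of_real t * z) \<in> G"
          using pG[of n] e that by (intro add scale) auto
        from m_le[OF this] show ?thesis
          by (simp add: J_def e v_def norm_add_sq norm_scaleC cinner_scaleC_right power_mult_distrib
              algebra_simps)
      qed
      moreover have "(\<lambda>n. J (p n) + 2 * t * (Re (cinner (v n) a) - Re z) + t\<^sup>2 * (norm a)\<^sup>2)
          \<longlonglongrightarrow> m + 2 * t * (Re (cinner w a) - Re z) + t\<^sup>2 * (norm a)\<^sup>2"
        by (intro tendsto_intros Jlim w)
      ultimately have "m \<le> m + 2 * t * (Re (cinner w a) - Re z) + t\<^sup>2 * (norm a)\<^sup>2"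
        by (intro LIMSEQ_le_const) auto
      then show ?thesis by simp
    qed
    note var = this
    define d where "d = Re (cinner w a) - Re z"
    \<comment> \<open>Nearly the minimiser of the quadratic in \<open>t\<close>; the summand 1 keeps
      the denominator positive when \<open>a = 0\<close>.\<close>
    define t where "t = - d / (1 + (norm a)\<^sup>2)"
    have pos: "0 < 1 + (norm a)\<^sup>2" by (simp add: add_pos_nonneg)
    have "t * (1 + (norm a)\<^sup>2) = - d" using pos by (simp add: t_def)
    then have dt: "d = - t * (1 + (norm a)\<^sup>2)" by simp
    have "0 \<le> 2 * t * d + t\<^sup>2 * (norm a)\<^sup>2" using var[of t] by (simp add: d_def)
    also have "\<dots> = - (t\<^sup>2 * (2 + (norm a)\<^sup>2))"
      unfolding dt by (simp add: power2_eq_square algebra_simps)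
    finally have "t\<^sup>2 * (2 + (norm a)\<^sup>2) \<le> 0" by simp
    moreover have "0 < 2 + (norm a)\<^sup>2" by (simp add: add_pos_nonneg)
    ultimately have "t = 0" by (simp add: mult_le_0_iff)
    then have "d = 0" using dt by simp
    then show ?thesis using Re_cinner_commute[of w a] by (simp add: d_def)
  qed
  show ?thesis
  proof (rule that[of w])
    show "w \<in> closure (fst ` G)" using w pG unfolding closure_sequential
      by (intro exI[of _ v]) (auto simp: v_def)
    fix a z assume az: "(a, z) \<in> G"
    \<comment> \<open>The identity of real parts, applied to the multiple by \<open>\<i>\<close>, is
      the identity of imaginary parts.\<close>
    have "Im z = Im (cinner a w)"
      using Re_eq[OF scale[OF az, of \<i>]] by (simp add: cinner_scaleC_left)
    with Re_eq[OF az] show "z = cinner a w" by (simp add: complex_eq_iff)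
  qed
qed

text \<open>The Riesz vector of \<open>\<lambda>v. cinner v h\<close> on \<open>V\<close> is the
  projection of \<open>h\<close>: it lies in the closure of the domain, which is \<open>V\<close>
  itself.\<close>

lemma orthogonal_projection_exists:
  fixes V :: "'a :: chilbert_space set"
  assumes "csubspace V" "closed V"
  obtains w where "w \<in> V" "\<And>v. v \<in> V \<Longrightarrow> cinner v (h - w) = 0"
proof -
  have "fst ` (\<lambda>v. (v, cinner v h)) ` V = V" by (auto simp: image_image)
  moreover obtain w where "w \<in> closure (fst ` (\<lambda>v. (v, cinner v h)) ` V)"
    "\<And>v z. (v, z) \<in> (\<lambda>v. (v, cinner v h)) ` V \<Longrightarrow> z = cinner v w"
  proof (rule Riesz_graph[of "(\<lambda>v. (v, cinner v h)) ` V" "norm h"])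
    show "cmod z \<le> norm h * norm v" if "(v, z) \<in> (\<lambda>v. (v, cinner v h)) ` V" for v z
      using that complex_Cauchy_Schwarz[of v h] by (auto simp: mult.commute)
  qed (use csubspaceD[OF assms(1)] in \<open>auto simp: image_iff cinner_add_left cinner_scaleC_left\<close>)
  ultimately have "w \<in> V" "\<And>v. v \<in> V \<Longrightarrow> cinner v (h - w) = 0"
    using assms(2) by (auto simp: cinner_diff_right image_iff)
  then show ?thesis using that by blast
qed

section \<open>The weak operator topology through matrix coefficients\<close>

lemma topspace_wot [simp]: "topspace (wot :: 'h :: chilbert_space bop topology) = UNIV"
proof -
  have "(UNIV :: 'h bop set) \<in> {{a. cinner (app a \<xi>) \<eta> \<in> U} | \<xi> \<eta> U. open U}"
    by (rule CollectI, rule exI[of _ 0], rule exI[of _ 0], rule exI[of _ UNIV]) simp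
  then show ?thesis unfolding wot_def topology_generated_by_topspace by (rule Sup_upper[THEN top_le])
qed

lemma continuous_map_wot_cinner:
  "continuous_map wot euclidean (\<lambda>a. cinner (app a \<xi>) \<eta>)"
  unfolding continuous_map_def
proof (intro conjI allI impI)
  fix U :: "complex set" assume "openin euclidean U"
  then show "openin wot {x \<in> topspace wot. cinner (app x \<xi>) \<eta> \<in> U}"
    unfolding topspace_wot unfolding wot_def by (intro topology_generated_by_Basis) auto
qed auto

lemma continuous_map_into_wot:
  fixes f :: "'x \<Rightarrow> 'h :: chilbert_space bop"
  assumes "\<And>\<xi> \<eta>. continuous_map X euclidean (\<lambda>x. cinner (app (f x) \<xi>) \<eta>)"
  shows "continuous_map X wot f"
  unfolding wot_def
proof (rule continuous_on_generated_topo)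
  fix U :: "'h bop set" assume "U \<in> {{a. cinner (app a \<xi>) \<eta> \<in> U} | \<xi> \<eta> U. open U}"
  then obtain \<xi> \<eta> V where U: "U = {a. cinner (app a \<xi>) \<eta> \<in> V}" "open V" by blast
  have "openin X {x \<in> topspace X. cinner (app (f x) \<xi>) \<eta> \<in> V}"
    using assms[of \<xi> \<eta>] U(2) by (simp add: continuous_map_def)
  moreover have "f -` U \<inter> topspace X = {x \<in> topspace X. cinner (app (f x) \<xi>) \<eta> \<in> V}"
    using U(1) by auto
  ultimately show "openin X (f -` U \<inter> topspace X)" by simp
next
  show "f ` topspace X \<subseteq> \<Union>{{a. cinner (app a \<xi>) \<eta> \<in> U} | \<xi> \<eta> U. open U}"
    using topspace_wot[where 'h = 'h, unfolded wot_def topology_generated_by_topspace]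
    by (simp only: subset_UNIV)
qed

lemma limitin_wot:
  fixes f :: "'x \<Rightarrow> 'h :: chilbert_space bop"
  assumes "\<And>\<xi> \<eta>. ((\<lambda>n. cinner (app (f n) \<xi>) \<eta>) \<longlongrightarrow> cinner (app l \<xi>) \<eta>) F"
  shows "limitin wot f l F"
  unfolding limitin_def
proof (intro conjI allI impI)
  fix U :: "'h bop set" assume "openin wot U \<and> l \<in> U"
  then have "generate_topology_on {{a. cinner (app a \<xi>) \<eta> \<in> U} | \<xi> \<eta> U. open U} U" "l \<in> U"
    by (auto simp: wot_def openin_topology_generated_by_iff)
  then show "\<forall>\<^sub>F n in F. f n \<in> U"
  proof (induction)
    case (Int a b)
    then show ?case by (auto intro: eventually_conj)
  next
    case (UN K)
    then obtain k where "k \<in> K" "l \<in> k" by blast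
    with UN.IH[of k] show ?case by (auto elim: eventually_mono)
  next
    case (Basis s)
    then obtain \<xi> \<eta> V where "s = {a. cinner (app a \<xi>) \<eta> \<in> V}" "open V" by blast
    with Basis assms[of \<xi> \<eta>] show ?case by (auto simp: tendsto_def)
  qed simp
qed simp

text \<open>Carries an identity between two matrix coefficients from a set to its WOT closure;
  commutation relations and compressions are both expressed this way.\<close>

lemma closedin_wot_eq:
  "closedin wot {a. cinner (app a \<xi>) \<eta> = cinner (app a \<xi>') \<eta>'}"
proof -
  have "continuous_map wot euclidean (\<lambda>a. cinner (app a \<xi>) \<eta> - cinner (app a \<xi>') \<eta>')"
    by (intro continuous_map_diff continuous_map_wot_cinner)
  from closedin_continuous_map_preimage[OF this, of "{0}"] show ?thesis by simp
qed

lemma wot_limit_in_closed: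
  assumes "closedin wot A" "F \<noteq> bot" "\<forall>\<^sub>F n in F. f n \<in> A"
    and "\<And>\<xi> \<eta>. ((\<lambda>n. cinner (app (f n) \<xi>) \<eta>) \<longlongrightarrow> cinner (app l \<xi>) \<eta>) F"
  shows "l \<in> A"
  using limitin_closedin[OF limitin_wot[OF assms(4)] assms(1,3)] assms(2)
  by (simp add: trivial_limit_def)

section \<open>The operator order\<close>

definition quad :: "'h :: chilbert_space bop \<Rightarrow> 'h \<Rightarrow> real" where
  "quad a \<xi> = Re (cinner (app a \<xi>) \<xi>)"

lemma quad_simps:
  "quad 0 \<xi> = 0" "quad 1 \<xi> = (norm \<xi>)\<^sup>2" "quad (a + b) \<xi> = quad a \<xi> + quad b \<xi>"
  "quad (a - b) \<xi> = quad a \<xi> - quad b \<xi>" "quad (complex_of_real r *\<^sub>C a) \<xi> = r * quad a \<xi>"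
  by (simp_all add: quad_def app_simps cinner_add_left cinner_diff_left cinner_scaleC_left
      Re_cinner_self)

lemma selfadjointI:
  "(\<And>\<xi> \<eta>. cinner (app a \<xi>) \<eta> = cinner \<xi> (app a \<eta>)) \<Longrightarrow> selfadjoint a"
  by (simp add: selfadjoint_def is_adjoint_def)

lemma selfadjointD: "selfadjoint a \<Longrightarrow> cinner (app a \<xi>) \<eta> = cinner \<xi> (app a \<eta>)"
  by (simp add: selfadjoint_def is_adjoint_def)

lemma is_adjointD: "is_adjoint a b \<Longrightarrow> cinner (app a \<xi>) \<eta> = cinner \<xi> (app b \<eta>)"
  by (simp add: is_adjoint_def)

lemma is_adjointD': "is_adjoint a b \<Longrightarrow> cinner (app b \<xi>) \<eta> = cinner \<xi> (app a \<eta>)"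
  by (metis is_adjointD cinner_commute)

lemma selfadjoint_intros [intro]:
  "selfadjoint 0" "selfadjoint 1"
  "selfadjoint a \<Longrightarrow> selfadjoint b \<Longrightarrow> selfadjoint (a + b)"
  "selfadjoint a \<Longrightarrow> selfadjoint b \<Longrightarrow> selfadjoint (a - b)"
  "selfadjoint a \<Longrightarrow> selfadjoint (complex_of_real r *\<^sub>C a)"
  "selfadjoint a \<Longrightarrow> selfadjoint (a ^ n)"
proof -
  show "selfadjoint (a ^ n)" if "selfadjoint a"
  proof (induction n)
    case (Suc n)
    have "app a (app (a ^ n) \<eta>) = app (a ^ n) (app a \<eta>)" for \<eta>
      by (metis app_times power_commutes)
    with Suc that show ?case by (auto intro!: selfadjointI simp: app_times selfadjointD)
  qed (auto intro!: selfadjointI)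
qed (auto intro!: selfadjointI simp: app_simps cinner_add_left cinner_add_right cinner_diff_left
    cinner_diff_right cinner_scaleC_left cinner_scaleC_right selfadjointD)

lemma op_le_iff: "op_le a b \<longleftrightarrow> selfadjoint (b - a) \<and> (\<forall>\<xi>. quad a \<xi> \<le> quad b \<xi>)"
  using quad_simps(4) by (simp add: op_le_def quad_def[symmetric] del: quad_simps) (simp add: quad_simps)

lemma op_le_quad: "op_le a b \<Longrightarrow> quad a \<xi> \<le> quad b \<xi>"
  by (simp add: op_le_iff)

lemma op_leI:
  "selfadjoint a \<Longrightarrow> selfadjoint b \<Longrightarrow> (\<And>\<xi>. quad a \<xi> \<le> quad b \<xi>) \<Longrightarrow> op_le a b"
  by (auto simp: op_le_iff)

lemma op_le_refl: "op_le a a"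
  by (auto simp: op_le_iff)

lemma op_le_trans: "op_le a b \<Longrightarrow> op_le b c \<Longrightarrow> op_le a c"
proof -
  assume *: "op_le a b" "op_le b c"
  have "c - a = (c - b) + (b - a)" by simp
  then have "selfadjoint (c - a)" using * unfolding op_le_iff by (metis selfadjoint_intros(3))
  with * show ?thesis unfolding op_le_iff by (meson order_trans)
qed

text \<open>A selfadjoint \<open>y\<close> with vanishing quadratic form is 0: the expansion of the
  form at \<open>\<xi> + app y \<xi>\<close> leaves only twice the squared norm of
  \<open>app y \<xi>\<close>.\<close>

lemma op_le_antisym: "op_le a b \<Longrightarrow> op_le b a \<Longrightarrow> a = b"
proof (rule bop_eqI)
  fix \<xi>
  assume *: "op_le a b" "op_le b a"
  define y where "y = b - a"
  have sa: "selfadjoint y" and q: "quad y \<zeta> = 0" for \<zeta>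
    using * by (auto simp: op_le_iff y_def quad_simps intro: antisym)
  have "quad y (\<xi> + app y \<xi>) = quad y \<xi> + quad y (app y \<xi>) + 2 * (norm (app y \<xi>))\<^sup>2"
    by (simp add: quad_def app_simps cinner_add_left cinner_add_right selfadjointD[OF sa, of "app y \<xi>" \<xi>]
        Re_cinner_self)
  then have "app y \<xi> = 0" by (simp add: q)
  then show "app a \<xi> = app b \<xi>" by (simp add: y_def app_simps)
qed

section \<open>Effects, and limits of increasing chains of effects\<close>

definition effect :: "'h :: chilbert_space bop \<Rightarrow> bool" where
  "effect a \<longleftrightarrow> op_le 0 a \<and> op_le a 1"

lemma effect_selfadjoint: "effect a \<Longrightarrow> selfadjoint a"
  by (simp add: effect_def op_le_def)

lemma effectI:
  "selfadjoint a \<Longrightarrow> (\<And>\<xi>. 0 \<le> quad a \<xi>) \<Longrightarrow> (\<And>\<xi>. quad a \<xi> \<le> (norm \<xi>)\<^sup>2) \<Longrightarrow> effect a"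
  unfolding effect_def by (auto intro!: op_leI simp: quad_simps)

lemma effect_quad:
  assumes "effect a" shows "0 \<le> quad a \<xi>" "quad a \<xi> \<le> (norm \<xi>)\<^sup>2"
  using assms by (auto simp: effect_def op_le_iff quad_simps)

lemma effect_diff:
  assumes "effect a" "effect b" "op_le a b" shows "effect (b - a)"
proof (rule effectI)
  show "quad (b - a) \<xi> \<le> (norm \<xi>)\<^sup>2" for \<xi>
    using effect_quad(1)[OF assms(1), of \<xi>] effect_quad(2)[OF assms(2), of \<xi>] by (simp add: quad_simps)
qed (use assms op_le_quad[OF assms(3)] in \<open>auto simp: quad_simps op_le_iff\<close>)

text \<open>This is \<open>y\<^sup>2 \<le> y\<close>, read off from \<open>y - y\<^sup>2 = y (1 - y) y + (1 - y) y (1 - y)\<close>.\<close>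

lemma effect_norm_sq_le:
  assumes "effect y" shows "(norm (app y \<xi>))\<^sup>2 \<le> quad y \<xi>"
proof -
  define u where "u = app y \<xi>"
  have "quad y (\<xi> - u) = Re (cinner u \<xi>) - 2 * (norm u)\<^sup>2 + quad y u"
    using selfadjointD[OF effect_selfadjoint[OF assms], of u \<xi>]
    by (simp add: quad_def app_simps u_def[symmetric] cinner_diff_left cinner_diff_right Re_cinner_self)
  with effect_quad[OF assms] have "0 \<le> Re (cinner u \<xi>) - 2 * (norm u)\<^sup>2 + (norm u)\<^sup>2"
    by (smt (verit))
  then show ?thesis by (simp add: quad_def u_def)
qed

lemma effect_norm_le:
  assumes "effect y" shows "norm (app y \<xi>) \<le> norm \<xi>"
  using order_trans[OF effect_norm_sq_le[OF assms] effect_quad(2)[OF assms]]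
  by (rule power2_le_imp_le) simp

definition up_filter :: "'h :: chilbert_space bop set \<Rightarrow> 'h bop filter" where
  "up_filter D = (INF d\<in>D. principal {e \<in> D. op_le d e})"

lemma eventually_up_filter:
  assumes "D \<noteq> {}" "\<And>a b. a \<in> D \<Longrightarrow> b \<in> D \<Longrightarrow> op_le a b \<or> op_le b a"
  shows "eventually P (up_filter D) \<longleftrightarrow> (\<exists>d\<in>D. \<forall>e\<in>D. op_le d e \<longrightarrow> P e)"
proof -
  have "eventually P (up_filter D) \<longleftrightarrow> (\<exists>d\<in>D. eventually P (principal {e \<in> D. op_le d e}))"
    unfolding up_filter_def
  proof (rule eventually_INF_base[OF assms(1)])
    fix a b assume ab: "a \<in> D" "b \<in> D"
    then consider "op_le a b" | "op_le b a" using assms(2) by blast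
    then show "\<exists>x\<in>D. principal {e \<in> D. op_le x e} \<le>
        inf (principal {e \<in> D. op_le a e}) (principal {e \<in> D. op_le b e})"
    proof cases
      case 1 then show ?thesis using ab by (intro bexI[of _ b]) (auto intro: op_le_trans)
    next
      case 2 then show ?thesis using ab by (intro bexI[of _ a]) (auto intro: op_le_trans)
    qed
  qed
  then show ?thesis by (auto simp: eventually_principal)
qed

text \<open>Monotone convergence in the strong topology. For \<open>d\<close> above
  \<open>d0\<close> the difference \<open>d - d0\<close> is an effect, so
  \<open>effect_norm_sq_le\<close> bounds the squared norm of its value at \<open>\<xi>\<close> by
  the increment of the quadratic form, which is monotone and bounded.\<close>

lemma monotone_limit:
  fixes D :: "'h :: chilbert_space bop set"
  assumes ne: "D \<noteq> {}" and eff: "\<And>a. a \<in> D \<Longrightarrow> effect a"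
    and chain: "\<And>a b. a \<in> D \<Longrightarrow> b \<in> D \<Longrightarrow> op_le a b \<or> op_le b a"
  obtains s where "\<And>\<xi>. ((\<lambda>d. app d \<xi>) \<longlongrightarrow> app s \<xi>) (up_filter D)" "effect s"
    "\<And>d. d \<in> D \<Longrightarrow> op_le d s"
    "\<And>t. selfadjoint t \<Longrightarrow> (\<And>d. d \<in> D \<Longrightarrow> op_le d t) \<Longrightarrow> op_le s t"
    "up_filter D \<noteq> bot"
proof -
  have ev: "eventually P (up_filter D) \<longleftrightarrow> (\<exists>d\<in>D. \<forall>e\<in>D. op_le d e \<longrightarrow> P e)" for P
    by (rule eventually_up_filter) (use ne chain in auto)
  have nb: "up_filter D \<noteq> bot"
    unfolding trivial_limit_def ev using op_le_refl by blast
  have evD: "\<forall>\<^sub>F d in up_filter D. d \<in> D \<and> op_le a d" if "a \<in> D" for a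
    unfolding ev using that by auto
  have "\<exists>l. ((\<lambda>d. app d \<xi>) \<longlongrightarrow> l) (up_filter D)" for \<xi>
  proof -
    define q where "q = (SUP d\<in>D. quad d \<xi>)"
    have bdd: "bdd_above ((\<lambda>d. quad d \<xi>) ` D)"
      using effect_quad(2)[OF eff] by (auto intro!: bdd_aboveI2)
    have "cauchy_filter (filtermap (\<lambda>d. app d \<xi>) (up_filter D))"
      unfolding cauchy_filter_metric_filtermap
    proof (intro allI impI)
      fix e :: real assume "0 < e"
      then have "(e / 2)\<^sup>2 > 0" by simp
      then have "q - (e / 2)\<^sup>2 < (SUP d\<in>D. quad d \<xi>)" unfolding q_def by linarith
      then obtain d0 where d0: "d0 \<in> D" "q - (e / 2)\<^sup>2 < quad d0 \<xi>"
        using less_cSUP_iff[OF ne bdd] by blast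
      have close: "norm (app d \<xi> - app d0 \<xi>) < e / 2" if "d \<in> D" "op_le d0 d" for d
      proof -
        have "(norm (app d \<xi> - app d0 \<xi>))\<^sup>2 \<le> quad (d - d0) \<xi>"
          using effect_norm_sq_le[OF effect_diff[OF eff[OF d0(1)] eff[OF that(1)] that(2)], of \<xi>]
          by (simp add: app_simps)
        also have "\<dots> \<le> q - quad d0 \<xi>"
          using cSUP_upper[OF that(1) bdd] by (simp add: quad_simps q_def)
        also have "\<dots> < (e / 2)\<^sup>2" using d0 by simp
        finally show ?thesis by (rule power2_less_imp_less) (use \<open>0 < e\<close> in simp)
      qed
      have "dist (app d \<xi>) (app d' \<xi>) < e" if "d \<in> D \<and> op_le d0 d" "d' \<in> D \<and> op_le d0 d'" for d d'
        using close[of d] close[of d'] that dist_triangle_half_l[of "app d \<xi>" "app d0 \<xi>" e "app d' \<xi>"]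
        by (auto simp: dist_norm)
      then show "\<exists>P. eventually P (up_filter D) \<and> (\<forall>d d'. P d \<and> P d' \<longrightarrow> dist (app d \<xi>) (app d' \<xi>) < e)"
        using evD[OF d0(1)] by (intro exI[of _ "\<lambda>d. d \<in> D \<and> op_le d0 d"]) blast
    qed
    then show ?thesis unfolding filterlim_def
      by (rule cauchy_filter_complete_converges[OF _ complete_UNIV]) (simp_all add: nb filtermap_bot_iff)
  qed
  then obtain l where l: "\<And>\<xi>. ((\<lambda>d. app d \<xi>) \<longlongrightarrow> l \<xi>) (up_filter D)" by metis
  have "app (Bop l) = l"
  proof (rule app_Bop)
    fix \<xi> \<eta> c
    have "((\<lambda>d. app d (\<xi> + \<eta>)) \<longlongrightarrow> l \<xi> + l \<eta>) (up_filter D)"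
      unfolding app_add by (intro tendsto_intros l)
    then show "l (\<xi> + \<eta>) = l \<xi> + l \<eta>" using l nb tendsto_unique by blast
    have "((\<lambda>d. app d (c *\<^sub>C \<xi>)) \<longlongrightarrow> c *\<^sub>C l \<xi>) (up_filter D)"
      unfolding app_scale by (intro tendsto_intros l)
    then show "l (c *\<^sub>C \<xi>) = c *\<^sub>C l \<xi>" using l nb tendsto_unique by blast
    obtain d0 where "d0 \<in> D" using ne by blast
    then show "norm (l \<xi>) \<le> 1 * norm \<xi>"
      by (intro tendsto_upperbound[OF tendsto_norm[OF l] _ nb] eventually_mono[OF evD])
        (auto intro: effect_norm_le eff)
  qed
  then have lim: "((\<lambda>d. app d \<xi>) \<longlongrightarrow> app (Bop l) \<xi>) (up_filter D)" for \<xi> using l by simp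
  have lq: "((\<lambda>d. quad d \<xi>) \<longlongrightarrow> quad (Bop l) \<xi>) (up_filter D)" for \<xi>
    unfolding quad_def by (intro tendsto_intros lim)
  have sa: "selfadjoint (Bop l)"
  proof (rule selfadjointI)
    fix \<xi> \<eta>
    have l: "((\<lambda>d. cinner (app d \<xi>) \<eta>) \<longlongrightarrow> cinner (app (Bop l) \<xi>) \<eta>) (up_filter D)"
      and r: "((\<lambda>d. cinner \<xi> (app d \<eta>)) \<longlongrightarrow> cinner \<xi> (app (Bop l) \<eta>)) (up_filter D)"
      by (intro tendsto_intros lim)+
    obtain d0 where "d0 \<in> D" using ne by blast
    then have "\<forall>\<^sub>F d in up_filter D. cinner (app d \<xi>) \<eta> = cinner \<xi> (app d \<eta>)"
      by (intro eventually_mono[OF evD]) (auto intro: selfadjointD effect_selfadjoint eff)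
    from tendsto_unique[OF nb Lim_transform_eventually[OF l this] r]
    show "cinner (app (Bop l) \<xi>) \<eta> = cinner \<xi> (app (Bop l) \<eta>)" .
  qed
  have up: "op_le d (Bop l)" if "d \<in> D" for d
  proof (rule op_leI[OF effect_selfadjoint[OF eff[OF that]] sa])
    show "quad d \<xi> \<le> quad (Bop l) \<xi>" for \<xi>
      by (rule tendsto_lowerbound[OF lq eventually_mono[OF evD[OF that]] nb]) (simp add: op_le_quad)
  qed
  have le: "op_le (Bop l) t" if t: "selfadjoint t" "\<And>d. d \<in> D \<Longrightarrow> op_le d t" for t
  proof (rule op_leI[OF sa t(1)])
    obtain d0 where "d0 \<in> D" using ne by blast
    then show "quad (Bop l) \<xi> \<le> quad t \<xi>" for \<xi>
      by (rule tendsto_upperbound[OF lq eventually_mono[OF evD] nb]) (simp add: op_le_quad t)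
  qed
  obtain d0 where d0: "d0 \<in> D" using ne by blast
  have "effect (Bop l)"
    unfolding effect_def using op_le_trans[OF _ up[OF d0]] eff d0 le[of 1]
    by (auto simp: effect_def)
  then show ?thesis using that lim up le nb by blast
qed

section \<open>Square roots\<close>

text \<open>Polynomials in \<open>x\<close> with nonnegative coefficients. The iterates of
  \<open>square_root_exists\<close> and their increments stay in this set, which yields commutation
  and positivity at once.\<close>

inductive_set pos_poly :: "'h :: chilbert_space bop \<Rightarrow> 'h bop set" for x where
  power: "x ^ n \<in> pos_poly x"
| add: "a \<in> pos_poly x \<Longrightarrow> b \<in> pos_poly x \<Longrightarrow> a + b \<in> pos_poly x"
| scale: "a \<in> pos_poly x \<Longrightarrow> 0 \<le> r \<Longrightarrow> complex_of_real r *\<^sub>C a \<in> pos_poly x"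

lemma pos_poly_mult:
  assumes "a \<in> pos_poly x" "b \<in> pos_poly x" shows "a * b \<in> pos_poly x"
  using assms(1)
proof induction
  case (power n)
  from assms(2) show ?case
    by induction (auto simp: power_add[symmetric] distrib_left scaleC_mult_right intro: pos_poly.intros)
qed (auto simp: distrib_right scaleC_mult_left intro: pos_poly.intros)

lemma pos_poly_commute_gen:
  assumes "a \<in> pos_poly x" shows "a * x = x * a"
  using assms
  by induction (auto simp: power_commutes distrib_left distrib_right scaleC_mult_left scaleC_mult_right)

lemma pos_poly_commute:
  assumes "a \<in> pos_poly x" "b \<in> pos_poly x" shows "a * b = b * a"
  using assms(2)
proof induction
  case (power n)
  have "a * x ^ n = x ^ n * a"
    by (induction n) (simp_all add: mult.assoc[symmetric] pos_poly_commute_gen[OF assms(1)],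
      simp add: mult.assoc)
  then show ?case .
qed (auto simp: distrib_left distrib_right scaleC_mult_left scaleC_mult_right)

lemma pos_poly_nonneg:
  assumes "a \<in> pos_poly x" "op_le 0 x" shows "op_le 0 a"
  using assms(1)
proof induction
  case (power n)
  have sa: "selfadjoint x" using assms(2) by (simp add: op_le_def)
  have "0 \<le> quad (x ^ n) \<xi>" for \<xi>
  proof (cases "even n")
    case True
    then obtain m where "n = m + m" by (metis evenE mult_2)
    then have "quad (x ^ n) \<xi> = (norm (app (x ^ m) \<xi>))\<^sup>2"
      by (simp add: quad_def power_add app_times selfadjointD[OF selfadjoint_intros(6)[OF sa]]
          flip: Re_cinner_self)
    then show ?thesis by simp
  next
    case False
    then obtain m where "n = m + (1 + m)" by (metis oddE mult_2 add.commute add.assoc)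
    then have "x ^ n = x ^ m * (x * x ^ m)" by (simp only: power_add power_one_right)
    then have "quad (x ^ n) \<xi> = quad x (app (x ^ m) \<xi>)"
      by (simp add: quad_def app_times selfadjointD[OF selfadjoint_intros(6)[OF sa]])
    then show ?thesis using op_le_quad[OF assms(2)] by (simp add: quad_simps)
  qed
  then show ?case using sa by (auto intro!: op_leI simp: quad_simps)
next
  case (add a b)
  then show ?case by (auto simp: op_le_iff quad_simps)
next
  case (scale a r)
  then show ?case by (auto simp: op_le_iff quad_simps)
qed

lemma von_neumann_algebraD:
  assumes "von_neumann_algebra A"
  shows "1 \<in> A" "a \<in> A \<Longrightarrow> b \<in> A \<Longrightarrow> a + b \<in> A" "a \<in> A \<Longrightarrow> c *\<^sub>C a \<in> A"
    "a \<in> A \<Longrightarrow> b \<in> A \<Longrightarrow> a * b \<in> A" "a \<in> A \<Longrightarrow> \<exists>b\<in>A. is_adjoint a b" "closedin wot A" "0 \<in> A"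
    "a \<in> A \<Longrightarrow> b \<in> A \<Longrightarrow> a - b \<in> A"
proof -
  show "1 \<in> A" "a \<in> A \<Longrightarrow> b \<in> A \<Longrightarrow> a + b \<in> A" and s: "\<And>a c. a \<in> A \<Longrightarrow> c *\<^sub>C a \<in> A"
    and "a \<in> A \<Longrightarrow> b \<in> A \<Longrightarrow> a * b \<in> A" "a \<in> A \<Longrightarrow> \<exists>b\<in>A. is_adjoint a b" "closedin wot A"
    using assms by (auto simp: von_neumann_algebra_def)
  then show "0 \<in> A" using s[of 1 0] by simp
  have "csubspace A" using \<open>0 \<in> A\<close> assms by (auto simp: von_neumann_algebra_def csubspace_def)
  then show "a \<in> A \<Longrightarrow> b \<in> A \<Longrightarrow> a - b \<in> A" by (rule csubspace_diff)
qed

text \<open>The increasing iteration \<open>c \<mapsto> (x + c\<^sup>2) / 2\<close> converges to \<open>1 - sqrt (1 - x)\<close>.\<close>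

lemma square_root_exists:
  assumes A: "von_neumann_algebra A" and x: "x \<in> A" "effect x"
  obtains c where "c \<in> A" "selfadjoint c" "c * c = 1 - x"
proof -
  define h where "h = complex_of_real (1/2)"
  have hs: "h *\<^sub>C a \<in> pos_poly x" if "a \<in> pos_poly x" for a
    unfolding h_def by (rule pos_poly.scale[OF that]) simp
  define c where "c = rec_nat 0 (\<lambda>_ c. h *\<^sub>C (x + c * c))"
  have c0: "c 0 = 0" and cS: "c (Suc n) = h *\<^sub>C (x + c n * c n)" for n by (simp_all add: c_def)
  have z: "0 \<in> pos_poly x" using pos_poly.scale[OF pos_poly.power[of x 0], of 0] by simp
  have px: "x \<in> pos_poly x" using pos_poly.power[of x 1] by simp
  have cp: "c n \<in> pos_poly x" for n
    by (induction n) (auto simp: c0 cS z px intro!: pos_poly.add hs pos_poly_mult)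
  have dp: "c (Suc n) - c n \<in> pos_poly x" for n
  proof (induction n)
    case 0
    then show ?case by (auto simp: c0 cS px intro!: hs)
  next
    case (Suc n)
    have "c (Suc (Suc n)) - c (Suc n) = h *\<^sub>C (c (Suc n) * c (Suc n) - c n * c n)"
      by (simp only: cS[of "Suc n"] cS[of n] scaleC_diff_right[symmetric]) simp
    \<comment> \<open>The iterates commute, so the difference of squares factors and the increments
      keep nonnegative coefficients.\<close>
    also have "c (Suc n) * c (Suc n) - c n * c n = (c (Suc n) - c n) * (c (Suc n) + c n)"
      using pos_poly_commute[OF cp cp, of "Suc n" n] by (simp add: algebra_simps)
    finally show ?case
      by (auto intro!: hs pos_poly_mult pos_poly.add cp Suc.IH)
  qed
  have nn: "op_le 0 a" if "a \<in> pos_poly x" for a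
    using pos_poly_nonneg[OF that] x by (simp add: effect_def)
  have eff: "effect (c n)" for n
  proof (induction n)
    case 0
    then show ?case by (auto intro!: effectI simp: c0 quad_simps)
  next
    case (Suc n)
    have sa: "selfadjoint (c (Suc n))" using nn[OF cp, of "Suc n"] by (simp add: op_le_def)
    show ?case
    proof (rule effectI[OF sa])
      fix \<xi>
      show "0 \<le> quad (c (Suc n)) \<xi>" using op_le_quad[OF nn[OF cp]] by (metis quad_simps(1))
      have "quad (c n * c n) \<xi> = (norm (app (c n) \<xi>))\<^sup>2"
        using selfadjointD[OF effect_selfadjoint[OF Suc.IH]] by (simp add: quad_def app_times flip: Re_cinner_self)
      then have "quad (c n * c n) \<xi> \<le> (norm \<xi>)\<^sup>2"
        using effect_norm_sq_le[OF Suc.IH, of \<xi>] effect_quad(2)[OF Suc.IH, of \<xi>] by linarith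
      moreover have "quad (c (Suc n)) \<xi> = 1/2 * (quad x \<xi> + quad (c n * c n) \<xi>)"
        by (simp only: cS h_def quad_simps)
      ultimately show "quad (c (Suc n)) \<xi> \<le> (norm \<xi>)\<^sup>2"
        using effect_quad(2)[OF x(2), of \<xi>] by simp
    qed
  qed
  have mono: "op_le (c m) (c n)" if "m \<le> n" for m n
    using that
  proof (induction rule: dec_induct)
    case (step k)
    have "op_le (c k) (c (Suc k))" using nn[OF dp[of k]] by (simp add: op_le_def)
    with step show ?case using op_le_trans by blast
  qed (rule op_le_refl)
  have chain: "op_le a b \<or> op_le b a" if "a \<in> range c" "b \<in> range c" for a b
    using that mono by (metis imageE nle_le)
  obtain s where s: "\<And>\<xi>. ((\<lambda>d. app d \<xi>) \<longlongrightarrow> app s \<xi>) (up_filter (range c))" "effect s"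
  proof (rule monotone_limit[of "range c"])
    show "effect a" if "a \<in> range c" for a using that eff by auto
  qed (use chain in auto)
  have "filterlim c (up_filter (range c)) sequentially"
    unfolding filterlim_iff
  proof (intro allI impI)
    fix P assume "eventually P (up_filter (range c))"
    then have "\<exists>d\<in>range c. \<forall>e\<in>range c. op_le d e \<longrightarrow> P e"
      by (subst (asm) eventually_up_filter) (use chain in auto)
    then show "\<forall>\<^sub>F n in sequentially. P (c n)"
      unfolding eventually_sequentially using mono by blast
  qed
  then have lim: "(\<lambda>n. app (c n) \<xi>) \<longlonglongrightarrow> app s \<xi>" for \<xi>
    using s(1) filterlim_compose by blast
  have "c n \<in> A" for n
    by (induction n) (auto simp: c0 cS x intro!: von_neumann_algebraD[OF A])
  then have sA: "s \<in> A"
    by (intro wot_limit_in_closed[OF von_neumann_algebraD(6)[OF A], of sequentially c])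
      (auto intro!: tendsto_intros lim)
  have "s = h *\<^sub>C (x + s * s)"
  proof (rule bop_eqI)
    fix \<xi>
    \<comment> \<open>A product of two strongly convergent sequences needs a uniform bound; here all
      \<open>c n\<close> are contractions.\<close>
    have "(\<lambda>n. app (c n) (app (c n) \<xi> - app s \<xi>)) \<longlonglongrightarrow> 0"
    proof (rule Lim_null_comparison)
      show "(\<lambda>n. norm (app (c n) \<xi> - app s \<xi>)) \<longlonglongrightarrow> 0"
        using lim[of \<xi>] by (simp add: LIM_zero tendsto_norm_zero)
    qed (simp add: effect_norm_le[OF eff])
    from tendsto_add[OF this lim[of "app s \<xi>"]]
    have "(\<lambda>n. app (c n) (app (c n) \<xi>)) \<longlonglongrightarrow> app s (app s \<xi>)"
      by (simp add: app_diff)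
    then have "(\<lambda>n. h *\<^sub>C (app x \<xi> + app (c n) (app (c n) \<xi>))) \<longlonglongrightarrow> h *\<^sub>C (app x \<xi> + app s (app s \<xi>))"
      by (intro tendsto_intros)
    moreover have "(\<lambda>n. app (c (Suc n)) \<xi>) \<longlonglongrightarrow> app s \<xi>" using lim by (rule LIMSEQ_Suc)
    ultimately show "app s \<xi> = app (h *\<^sub>C (x + s * s)) \<xi>"
      unfolding cS app_scaleC app_plus app_times by (rule LIMSEQ_unique[rotated])
  qed
  then have "s + s = (h + h) *\<^sub>C (x + s * s)" by (metis scaleC_add_left)
  then have ss: "s + s = x + s * s" by (simp add: h_def scaleC_one)
  show ?thesis
  proof (rule that[of "1 - s"])
    show "1 - s \<in> A" using sA by (intro von_neumann_algebraD[OF A])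
    show "selfadjoint (1 - s)" using effect_selfadjoint[OF s(2)] by auto
    have "(1 - s) * (1 - s) = 1 - (s + s) + s * s" by (simp add: algebra_simps)
    then show "(1 - s) * (1 - s) = 1 - x" by (simp add: ss)
  qed
qed

section \<open>GNS representations of normal states\<close>

text \<open>The elements commuting with both \<open>T\<close> and \<open>T'\<close> form a von
  Neumann algebra containing \<open>S\<close>. \<open>T'\<close> is carried along because the
  adjoint of an operator commuting with \<open>T\<close> commutes with \<open>T'\<close>. Linearity
  of \<open>T\<close> comes from having an adjoint, and the relations are WOT closed because they
  equate matrix coefficients.\<close>

lemma commutes_with_vn_generated:
  fixes S :: "'k :: chilbert_space bop set" and T T' :: "'k \<Rightarrow> 'k"
  assumes vn: "von_neumann_algebra (vn_generated S)"
    and adj: "\<And>\<kappa> \<kappa>'. cinner (T \<kappa>) \<kappa>' = cinner \<kappa> (T' \<kappa>')"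
    and S: "\<And>x \<kappa>. x \<in> S \<Longrightarrow> app x (T \<kappa>) = T (app x \<kappa>)" "\<And>x \<kappa>. x \<in> S \<Longrightarrow> app x (T' \<kappa>) = T' (app x \<kappa>)"
    and a: "a \<in> vn_generated S"
  shows "app a (T \<kappa>) = T (app a \<kappa>)"
proof -
  let ?A = "vn_generated S"
  have adj': "cinner (T' \<kappa>) \<kappa>' = cinner \<kappa> (T \<kappa>')" for \<kappa> \<kappa>' by (metis adj cinner_commute)
  have lin: "T (\<kappa> + \<kappa>') = T \<kappa> + T \<kappa>'" "T (c *\<^sub>C \<kappa>) = c *\<^sub>C T \<kappa>"
    "T' (\<kappa> + \<kappa>') = T' \<kappa> + T' \<kappa>'" "T' (c *\<^sub>C \<kappa>) = c *\<^sub>C T' \<kappa>" for \<kappa> \<kappa>' c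
    by (rule cinner_eqI, simp add: adj adj' cinner_add_left cinner_scaleC_left)+
  define M where "M = {a \<in> ?A. (\<forall>\<kappa>. app a (T \<kappa>) = T (app a \<kappa>)) \<and> (\<forall>\<kappa>. app a (T' \<kappa>) = T' (app a \<kappa>))}"
  have M_eq: "M = ?A \<inter> (\<Inter>\<kappa>. \<Inter>\<kappa>'. {a. cinner (app a (T \<kappa>)) \<kappa>' = cinner (app a \<kappa>) (T' \<kappa>')})
      \<inter> (\<Inter>\<kappa>. \<Inter>\<kappa>'. {a. cinner (app a (T' \<kappa>)) \<kappa>' = cinner (app a \<kappa>) (T \<kappa>')})"
    by (auto simp: M_def adj[symmetric] adj'[symmetric] intro: cinner_eqI)
  have "closedin wot M"
    unfolding M_eq by (intro closedin_Int closedin_INT von_neumann_algebraD(6)[OF vn] closedin_wot_eq) auto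
  moreover have "\<exists>b\<in>M. is_adjoint a b" if "a \<in> M" for a
  proof -
    obtain b where b: "b \<in> ?A" "is_adjoint a b"
      using \<open>a \<in> M\<close> von_neumann_algebraD(5)[OF vn, of a] unfolding M_def by blast
    have "app a (T \<kappa>) = T (app a \<kappa>)" "app a (T' \<kappa>) = T' (app a \<kappa>)" for \<kappa>
      using \<open>a \<in> M\<close> by (auto simp: M_def)
    then have "app b (T \<kappa>) = T (app b \<kappa>)" "app b (T' \<kappa>) = T' (app b \<kappa>)" for \<kappa>
      by (rule_tac cinner_eqI, simp add: adj adj' is_adjointD'[OF b(2)])+
    with b show ?thesis by (auto simp: M_def)
  qed
  ultimately have "von_neumann_algebra M"
    unfolding von_neumann_algebra_def
    by (auto simp: M_def app_simps lin intro: von_neumann_algebraD[OF vn])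
  moreover have "S \<subseteq> M" using S by (auto simp: M_def vn_generated_def)
  ultimately have "?A \<subseteq> M" unfolding vn_generated_def by blast
  then show ?thesis using a by (auto simp: M_def)
qed

lemma norm_le_if_cinner_bounded:
  fixes w :: "'a :: chilbert_space"
  assumes "w \<in> closure V" "0 \<le> C" "\<And>v. v \<in> V \<Longrightarrow> cmod (cinner v w) \<le> C * norm v"
  shows "norm w \<le> C"
proof -
  obtain v where v: "\<And>n. v n \<in> V" "v \<longlonglongrightarrow> w" using assms(1) by (auto simp: closure_sequential)
  have "(\<lambda>n. cmod (cinner (v n) w)) \<longlonglongrightarrow> cmod (cinner w w)" "(\<lambda>n. C * norm (v n)) \<longlonglongrightarrow> C * norm w"
    by (intro tendsto_intros v)+
  then have "cmod (cinner w w) \<le> C * norm w"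
    by (rule LIMSEQ_le) (use assms(3) v in auto)
  then have "norm w * norm w \<le> C * norm w"
    by (simp add: cinner_self norm_power power2_eq_square norm_mult)
  then show ?thesis using assms(2) by (cases "w = 0") auto
qed

lemma effect_one: "effect 1"
  by (auto intro!: effectI simp: quad_simps)

section \<open>Positivity and normality in the GNS space\<close>

locale gns_normal =
  fixes A :: "'k :: chilbert_space bop set" and \<phi> :: "'k bop \<Rightarrow> complex"
    and \<pi> :: "'k bop \<Rightarrow> 'h :: chilbert_space bop" and \<Omega> :: 'h
  assumes vn: "von_neumann_algebra A" and nm: "normal_on A \<phi>"
    and gns: "gns_representation A \<phi> \<pi> \<Omega>"
begin

lemmas A_intros = von_neumann_algebraD(1-4,7,8)[OF vn]

lemma
  shows pi_one: "\<pi> 1 = 1"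
    and pi_add: "a \<in> A \<Longrightarrow> b \<in> A \<Longrightarrow> \<pi> (a + b) = \<pi> a + \<pi> b"
    and pi_scale: "a \<in> A \<Longrightarrow> \<pi> (c *\<^sub>C a) = c *\<^sub>C \<pi> a"
    and pi_mult: "a \<in> A \<Longrightarrow> b \<in> A \<Longrightarrow> \<pi> (a * b) = \<pi> a * \<pi> b"
  using gns by (auto simp: gns_representation_def)

lemma pi_adjoint: "a \<in> A \<Longrightarrow> b \<in> A \<Longrightarrow> is_adjoint a b \<Longrightarrow> is_adjoint (\<pi> a) (\<pi> b)"
  using gns by (auto simp: gns_representation_def)

lemma pi_selfadjoint: "a \<in> A \<Longrightarrow> selfadjoint a \<Longrightarrow> selfadjoint (\<pi> a)"
  by (simp add: selfadjoint_def pi_adjoint)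

lemma phi_eq: "a \<in> A \<Longrightarrow> \<phi> a = cinner (app (\<pi> a) \<Omega>) \<Omega>"
  using gns by (auto simp: gns_representation_def)

lemma pi_zero: "\<pi> 0 = 0"
  using pi_scale[OF A_intros(1), of 0] by simp

lemma pi_diff: "a \<in> A \<Longrightarrow> b \<in> A \<Longrightarrow> \<pi> (a - b) = \<pi> a - \<pi> b"
  using pi_add[of "a - b" b] A_intros by simp

lemma adjoint_obtain:
  assumes "a \<in> A" obtains b where "b \<in> A" "is_adjoint a b"
  using von_neumann_algebraD(5)[OF vn assms] by blast

lemma orthogonal_cyclic:
  assumes "\<And>a. a \<in> A \<Longrightarrow> cinner (app (\<pi> a) \<Omega>) h = 0" shows "h = 0"
proof -
  have "h \<in> closure ((\<lambda>a. app (\<pi> a) \<Omega>) ` A)" using gns by (auto simp: gns_representation_def)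
  then have "norm h \<le> 0" by (rule norm_le_if_cinner_bounded) (auto simp: assms)
  then show ?thesis by simp
qed

text \<open>Taking the root inside \<open>A\<close> lets it pass through \<open>\<pi>\<close>, so
  that positivity of \<open>\<pi> a\<close> follows from multiplicativity.
  \<open>square_root_exists\<close> produces roots of \<open>1 - x\<close>, hence the detour through
  \<open>1 - a\<close>.\<close>

lemma effect_square:
  assumes "a \<in> A" "effect a"
  obtains c where "c \<in> A" "selfadjoint c" "\<And>\<zeta>. quad (\<pi> a) \<zeta> = (norm (app (\<pi> c) \<zeta>))\<^sup>2"
proof -
  have e: "effect (1 - a)" by (rule effect_diff[OF assms(2) effect_one]) (use assms in \<open>auto simp: effect_def\<close>)
  have mem: "1 - a \<in> A" by (intro A_intros assms)
  obtain c where c: "c \<in> A" "selfadjoint c" "c * c = 1 - (1 - a)"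
    by (rule square_root_exists[OF vn mem e])
  then have "\<pi> a = \<pi> c * \<pi> c" using pi_mult[OF c(1) c(1)] by simp
  then have "quad (\<pi> a) \<zeta> = (norm (app (\<pi> c) \<zeta>))\<^sup>2" for \<zeta>
    by (simp add: quad_def app_times selfadjointD[OF pi_selfadjoint[OF c(1,2)]] flip: Re_cinner_self)
  with c show ?thesis using that by blast
qed

lemma quad_pi_nonneg: "a \<in> A \<Longrightarrow> effect a \<Longrightarrow> 0 \<le> quad (\<pi> a) \<zeta>"
  by (metis effect_square zero_le_power2)

text \<open>Normality concerns only the vector functional of \<open>\<Omega>\<close>; domination
  passes it to \<open>\<zeta>\<close>, because the form of \<open>\<pi> (s - d)\<close> at
  \<open>\<zeta>\<close> is squeezed between 0 and its value at \<open>\<Omega>\<close>.\<close>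

lemma quad_pi_normal:
  assumes D: "D \<noteq> {}" "D \<subseteq> A" and eff: "\<And>a. a \<in> D \<Longrightarrow> effect a"
    and chain: "\<And>a b. a \<in> D \<Longrightarrow> b \<in> D \<Longrightarrow> op_le a b \<or> op_le b a"
    and s: "s \<in> A" "effect s" "\<And>d. d \<in> D \<Longrightarrow> op_le d s"
      "\<And>t. selfadjoint t \<Longrightarrow> (\<And>d. d \<in> D \<Longrightarrow> op_le d t) \<Longrightarrow> op_le s t"
    and dom: "\<And>a. a \<in> A \<Longrightarrow> effect a \<Longrightarrow> quad (\<pi> a) \<zeta> \<le> quad (\<pi> a) \<Omega>"
  shows "((\<lambda>d. quad (\<pi> d) \<zeta>) \<longlongrightarrow> quad (\<pi> s) \<zeta>) (up_filter D)"
proof -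
  have ev: "eventually P (up_filter D) \<longleftrightarrow> (\<exists>d\<in>D. \<forall>e\<in>D. op_le d e \<longrightarrow> P e)" for P
    by (rule eventually_up_filter) (use D chain in auto)
  have q\<phi>: "Re (\<phi> a) = quad (\<pi> a) \<Omega>" if "a \<in> A" for a using that by (simp add: phi_eq quad_def)
  have diff: "quad (\<pi> (b - a)) \<eta> = quad (\<pi> b) \<eta> - quad (\<pi> a) \<eta>" if "a \<in> A" "b \<in> A" for a b \<eta>
    using that by (simp add: pi_diff quad_simps)
  have mono: "0 \<le> quad (\<pi> b) \<eta> - quad (\<pi> a) \<eta>"
    if "a \<in> A" "b \<in> A" "effect a" "effect b" "op_le a b" for a b \<eta>
    using quad_pi_nonneg[of "b - a" \<eta>] effect_diff[of a b] that diff A_intros by auto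
  have lub: "is_lub_in A D s"
    unfolding is_lub_in_def using s effect_selfadjoint[OF s(2)] by blast
  have "\<forall>a\<in>D. \<forall>b\<in>D. \<exists>c\<in>D. op_le a c \<and> op_le b c"
    using chain op_le_refl by blast
  moreover have "\<forall>a\<in>D. op_le 0 a" using eff by (auto simp: effect_def)
  ultimately have "Re (\<phi> s) = (SUP a\<in>D. Re (\<phi> a))"
    using nm[unfolded normal_on_def, rule_format, of D s] lub D by blast
  then have sup: "quad (\<pi> s) \<Omega> = (SUP a\<in>D. quad (\<pi> a) \<Omega>)"
    using q\<phi> s(1) D(2) by (simp add: subset_iff cong: SUP_cong_simp)
  have bdd: "bdd_above ((\<lambda>a. quad (\<pi> a) \<Omega>) ` D)"
    using mono s eff D by (intro bdd_aboveI2[of _ _ "quad (\<pi> s) \<Omega>"]) (metis diff_ge_0_iff_ge subset_iff)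
  show ?thesis
  proof (rule tendstoI)
    fix e :: real assume "0 < e"
    then have "quad (\<pi> s) \<Omega> - e < (SUP a\<in>D. quad (\<pi> a) \<Omega>)" using sup by linarith
    then obtain d0 where d0: "d0 \<in> D" "quad (\<pi> s) \<Omega> - e < quad (\<pi> d0) \<Omega>"
      using less_cSUP_iff[OF D(1) bdd] by blast
    have "dist (quad (\<pi> d) \<zeta>) (quad (\<pi> s) \<zeta>) < e" if "d \<in> D" "op_le d0 d" for d
    proof -
      have mem: "d \<in> A" "d0 \<in> A" "effect d" "effect d0" "op_le d s" using that d0 D eff s by auto
      have "quad (\<pi> (s - d)) \<zeta> \<le> quad (\<pi> (s - d)) \<Omega>"
        using mem s by (intro dom effect_diff A_intros) auto
      moreover have "0 \<le> quad (\<pi> s) \<zeta> - quad (\<pi> d) \<zeta>" "0 \<le> quad (\<pi> d) \<Omega> - quad (\<pi> d0) \<Omega>"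
        using mem s that by (intro mono; auto)+
      ultimately show ?thesis using d0 mem s by (simp add: diff dist_real_def)
    qed
    then show "\<forall>\<^sub>F d in up_filter D. dist (quad (\<pi> d) \<zeta>) (quad (\<pi> s) \<zeta>) < e"
      unfolding ev using d0 by blast
  qed
qed

text \<open>Zorn's lemma for effects below \<open>u\<close> under a constraint
  \<open>0 \<le> g t\<close> that is continuous along increasing chains. It is applied twice below:
  to exhaust the part that a positive functional annihilates, and to exhaust the part where that
  functional exceeds a vector functional.\<close>

lemma maximal_effect:
  assumes u: "u \<in> A" "effect u" and g0: "0 \<le> g 0"
    and lim: "\<And>D s. D \<noteq> {} \<Longrightarrow> D \<subseteq> A \<Longrightarrow> (\<And>a. a \<in> D \<Longrightarrow> effect a) \<Longrightarrow>
      (\<And>a b. a \<in> D \<Longrightarrow> b \<in> D \<Longrightarrow> op_le a b \<or> op_le b a) \<Longrightarrow> s \<in> A \<Longrightarrow> effect s \<Longrightarrow>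
      (\<And>d. d \<in> D \<Longrightarrow> op_le d s) \<Longrightarrow>
      (\<And>t. selfadjoint t \<Longrightarrow> (\<And>d. d \<in> D \<Longrightarrow> op_le d t) \<Longrightarrow> op_le s t) \<Longrightarrow>
      (\<And>\<xi>. ((\<lambda>d. app d \<xi>) \<longlongrightarrow> app s \<xi>) (up_filter D)) \<Longrightarrow> (g \<longlongrightarrow> g s) (up_filter D)"
  obtains t where "t \<in> A" "effect t" "op_le t u" "(0 :: real) \<le> g t"
    "\<And>t'. t' \<in> A \<Longrightarrow> op_le t t' \<Longrightarrow> op_le t' u \<Longrightarrow> 0 \<le> g t' \<Longrightarrow> t' = t"
proof -
  define T where "T = {t \<in> A. effect t \<and> op_le t u \<and> 0 \<le> g t}"
  have "\<exists>m\<in>T. \<forall>a\<in>T. op_le m a \<longrightarrow> a = m"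
  proof (rule predicate_Zorn)
    show "partial_order_on T (relation_of op_le T)"
      by (rule partial_order_on_relation_ofI) (auto intro: op_le_refl op_le_trans op_le_antisym)
  next
    fix D assume D: "D \<in> Chains (relation_of op_le T)"
    have DT: "D \<subseteq> T" using D by (auto simp: Chains_def relation_of_def)
    have chain: "op_le a b \<or> op_le b a" if "a \<in> D" "b \<in> D" for a b
      using D that by (auto simp: Chains_def relation_of_def)
    show "\<exists>b\<in>T. \<forall>a\<in>D. op_le a b"
    proof (cases "D = {}")
      case True
      have "0 \<in> T" using g0 A_intros u by (auto simp: T_def effect_def intro!: op_leI simp: quad_simps)
      then show ?thesis using True by auto
    next
      case False
      have eff: "effect a" if "a \<in> D" for a using DT that by (auto simp: T_def)
      obtain s where s: "\<And>\<xi>. ((\<lambda>d. app d \<xi>) \<longlongrightarrow> app s \<xi>) (up_filter D)" "effect s"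
        "\<And>d. d \<in> D \<Longrightarrow> op_le d s"
        "\<And>t. selfadjoint t \<Longrightarrow> (\<And>d. d \<in> D \<Longrightarrow> op_le d t) \<Longrightarrow> op_le s t"
        "up_filter D \<noteq> bot"
        using monotone_limit[OF False eff chain] by metis
      have ev: "\<forall>\<^sub>F d in up_filter D. d \<in> D"
        by (subst eventually_up_filter) (use False chain in auto)
      have "s \<in> A"
      proof (rule wot_limit_in_closed[OF von_neumann_algebraD(6)[OF vn] s(5)])
        show "\<forall>\<^sub>F d in up_filter D. d \<in> A" by (rule eventually_mono[OF ev]) (use DT in \<open>auto simp: T_def\<close>)
      qed (intro tendsto_intros s(1))
      moreover have "0 \<le> g s"
      proof (rule tendsto_lowerbound[OF lim[OF False _ eff chain \<open>s \<in> A\<close> s(2,3,4,1)] _ s(5)])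
        show "D \<subseteq> A" using DT by (auto simp: T_def)
        show "\<forall>\<^sub>F x in up_filter D. 0 \<le> g x" by (rule eventually_mono[OF ev]) (use DT in \<open>auto simp: T_def\<close>)
      qed
      moreover have "op_le s u" using DT effect_selfadjoint[OF u(2)] by (intro s(4)) (auto simp: T_def)
      ultimately have "s \<in> T" using s by (auto simp: T_def)
      then show ?thesis using s(3) by blast
    qed
  qed
  then obtain t where t: "t \<in> T" "\<And>a. a \<in> T \<Longrightarrow> op_le t a \<Longrightarrow> a = t" by blast
  show ?thesis
  proof (rule that[of t])
    fix t' assume t': "t' \<in> A" "op_le t t'" "op_le t' u" "0 \<le> g t'"
    have "effect t'"
      using t' t(1) u op_le_trans by (auto simp: T_def effect_def)
    with t' t show "t' = t" by (auto simp: T_def)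
  qed (use t in \<open>auto simp: T_def\<close>)
qed

text \<open>\<open>Q\<close> maps the GNS space to the space on which \<open>A\<close> is given. As
  \<open>bop\<close> holds only maps of a space to itself, \<open>Q\<close> is a bare function, and
  its everywhere defined adjoint \<open>R\<close> stands in for boundedness.\<close>

definition intertwiner :: "('h \<Rightarrow> 'k) \<Rightarrow> ('k \<Rightarrow> 'h) \<Rightarrow> bool" where
  "intertwiner Q R \<longleftrightarrow> (\<forall>h \<kappa>. cinner (Q h) \<kappa> = cinner h (R \<kappa>)) \<and>
     (\<forall>a\<in>A. \<forall>h. Q (app (\<pi> a) h) = app a (Q h))"

text \<open>By domination, sending \<open>app c \<kappa>0\<close> to
  \<open>app (\<pi> c) \<eta>\<close> is a contraction that respects the action of \<open>A\<close>.
  \<open>Q\<close> is its adjoint, and a second use of the Riesz theorem gives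
  \<open>R\<close>.\<close>

lemma dominated_intertwiner:
  assumes dom: "\<And>c. c \<in> A \<Longrightarrow> norm (app (\<pi> c) \<eta>) \<le> norm (app c \<kappa>0)"
  obtains Q R where "intertwiner Q R"
    "\<And>c h. c \<in> A \<Longrightarrow> cinner (app (\<pi> c) \<eta>) h = cinner (app c \<kappa>0) (Q h)"
proof -
  define V where "V = (\<lambda>c. app c \<kappa>0) ` A"
  have V: "csubspace V"
    unfolding csubspace_def V_def using A_intros
    by (auto simp: image_iff app_plus[symmetric] app_scaleC[symmetric] intro: bexI[of _ 0])
  have "\<exists>w. w \<in> closure V \<and> (\<forall>c\<in>A. cinner (app (\<pi> c) \<eta>) h = cinner (app c \<kappa>0) w)" for h
  proof -
    \<comment> \<open>As a graph the functional needs no separate proof of being well defined; the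
      bound takes care of it.\<close>
    define G where "G = (\<lambda>c. (app c \<kappa>0, cinner (app (\<pi> c) \<eta>) h)) ` A"
    have GV: "fst ` G = V" by (auto simp: G_def V_def image_image)
    obtain w where "w \<in> closure (fst ` G)" "\<And>v z. (v, z) \<in> G \<Longrightarrow> z = cinner v w"
    proof (rule Riesz_graph[of G "norm h"])
      show "(0, 0) \<in> G" unfolding G_def using A_intros(5) by (intro image_eqI[of _ _ 0]) (auto simp: pi_zero)
      fix v z v' z' c
      assume "(v, z) \<in> G"
      then obtain a where a: "a \<in> A" "v = app a \<kappa>0" "z = cinner (app (\<pi> a) \<eta>) h" by (auto simp: G_def)
      have "cmod z \<le> norm (app (\<pi> a) \<eta>) * norm h" unfolding a by (rule complex_Cauchy_Schwarz)
      also have "\<dots> \<le> norm v * norm h" unfolding a by (intro mult_right_mono dom a) auto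
      finally show "cmod z \<le> norm h * norm v" by (simp add: mult.commute)
      show "(c *\<^sub>C v, c * z) \<in> G" unfolding G_def
        using a A_intros(3)[of a c] by (intro image_eqI[of _ _ "c *\<^sub>C a"]) (auto simp: app_scaleC pi_scale cinner_scaleC_left)
      assume "(v', z') \<in> G"
      then obtain b where b: "b \<in> A" "v' = app b \<kappa>0" "z' = cinner (app (\<pi> b) \<eta>) h" by (auto simp: G_def)
      show "(v + v', z + z') \<in> G" unfolding G_def
        using a b A_intros(2)[of a b] by (intro image_eqI[of _ _ "a + b"]) (auto simp: app_plus pi_add cinner_add_left)
    qed blast
    then show ?thesis unfolding GV by (auto simp: G_def)
  qed
  then obtain Q where QV: "\<And>h. Q h \<in> closure V"
    and Q: "\<And>c h. c \<in> A \<Longrightarrow> cinner (app (\<pi> c) \<eta>) h = cinner (app c \<kappa>0) (Q h)" by metis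
  \<comment> \<open>Vectors of \<open>closure V\<close> are determined by their inner products with
    \<open>V\<close>. Linearity of \<open>Q\<close> and its compatibility with \<open>A\<close> are
    both read off from this.\<close>
  have uniq: "w = w'" if "w \<in> closure V" "w' \<in> closure V"
    "\<And>c. c \<in> A \<Longrightarrow> cinner (app c \<kappa>0) w = cinner (app c \<kappa>0) w'" for w w'
  proof -
    have "norm (w - w') \<le> 0"
      using csubspace_diff[OF csubspace_closure[OF V] that(1,2)]
      by (rule norm_le_if_cinner_bounded) (use that(3) in \<open>auto simp: V_def cinner_diff_right\<close>)
    then show ?thesis by simp
  qed
  have cV: "csubspace (closure V)" using V by (rule csubspace_closure)
  have Q_add: "Q (h + h') = Q h + Q h'" for h h'
    by (rule uniq) (auto simp: QV cinner_add_right Q[symmetric] intro: csubspaceD[OF cV])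
  have Q_scale: "Q (c *\<^sub>C h) = c *\<^sub>C Q h" for c h
    by (rule uniq) (auto simp: QV cinner_scaleC_right Q[symmetric] intro: csubspaceD[OF cV])
  have Q_norm: "norm (Q h) \<le> norm h" for h
  proof (rule norm_le_if_cinner_bounded[OF QV])
    fix v assume "v \<in> V"
    then obtain c where c: "c \<in> A" "v = app c \<kappa>0" by (auto simp: V_def)
    have "cmod (cinner v (Q h)) \<le> norm (app (\<pi> c) \<eta>) * norm h"
      unfolding c(2) Q[OF c(1), symmetric] by (rule complex_Cauchy_Schwarz)
    also have "\<dots> \<le> norm v * norm h" unfolding c(2) by (intro mult_right_mono dom c) auto
    finally show "cmod (cinner v (Q h)) \<le> norm h * norm v" by (simp add: mult.commute)
  qed simp
  have "\<exists>r. \<forall>h. cinner (Q h) \<kappa> = cinner h r" for \<kappa>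
  proof -
    obtain r where "\<And>v z. (v, z) \<in> range (\<lambda>h. (h, cinner (Q h) \<kappa>)) \<Longrightarrow> z = cinner v r"
    proof (rule Riesz_graph[of "range (\<lambda>h. (h, cinner (Q h) \<kappa>))" "norm \<kappa>"])
      show "(0, 0) \<in> range (\<lambda>h. (h, cinner (Q h) \<kappa>))"
        using Q_scale[of 0 0] by (intro image_eqI[of _ _ 0]) auto
      show "cmod z \<le> norm \<kappa> * norm v" if "(v, z) \<in> range (\<lambda>h. (h, cinner (Q h) \<kappa>))" for v z
        using that order_trans[OF complex_Cauchy_Schwarz mult_right_mono[OF Q_norm[of v], of "norm \<kappa>"]]
        by (auto simp: mult.commute)
    qed (auto simp: Q_add Q_scale cinner_add_left cinner_scaleC_left)
    then have "cinner (Q h) \<kappa> = cinner h r" for h by blast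
    then show ?thesis by blast
  qed
  then obtain R where R: "\<And>h \<kappa>. cinner (Q h) \<kappa> = cinner h (R \<kappa>)" by metis
  have "Q (app (\<pi> a) h) = app a (Q h)" if "a \<in> A" for a h
  proof (rule uniq[OF QV])
    obtain f where f: "\<And>n. f n \<in> V" "f \<longlonglongrightarrow> Q h" using QV[of h] by (auto simp: closure_sequential)
    have "app a v \<in> V" if "v \<in> V" for v
      using that \<open>a \<in> A\<close> A_intros(4) by (auto simp: V_def image_iff) (metis app_times)
    then show "app a (Q h) \<in> closure V"
      unfolding closure_sequential using f by (intro exI[of _ "\<lambda>n. app a (f n)"]) (auto intro!: tendsto_intros)
    fix c assume "c \<in> A"
    obtain b where b: "b \<in> A" "is_adjoint a b" using adjoint_obtain[OF \<open>a \<in> A\<close>] .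
    have "cinner (app c \<kappa>0) (app a (Q h)) = cinner (app (b * c) \<kappa>0) (Q h)"
      by (simp add: app_times is_adjointD'[OF b(2)])
    also have "\<dots> = cinner (app (\<pi> (b * c)) \<eta>) h" using Q A_intros(4)[OF b(1) \<open>c \<in> A\<close>] by simp
    also have "\<dots> = cinner (app (\<pi> c) \<eta>) (app (\<pi> a) h)"
      by (simp add: pi_mult[OF b(1) \<open>c \<in> A\<close>] app_times is_adjointD'[OF pi_adjoint[OF \<open>a \<in> A\<close> b]])
    also have "\<dots> = cinner (app c \<kappa>0) (Q (app (\<pi> a) h))" using Q[OF \<open>c \<in> A\<close>] .
    finally show "cinner (app c \<kappa>0) (Q (app (\<pi> a) h)) = cinner (app c \<kappa>0) (app a (Q h))" by simp
  qed
  with R have "intertwiner Q R" by (simp add: intertwiner_def)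
  then show ?thesis using that Q by blast
qed

text \<open>Otherwise the component \<open>\<Omega>'\<close> of \<open>\<Omega>\<close> in the common kernel is nonzero, and by normality its
  vector functional is dominated, below some effect \<open>s\<close> that it does not annihilate, by a vector
  functional of the given representation.  This yields an intertwiner that does not vanish
  at \<open>\<pi> s \<Omega>'\<close>.\<close>

lemma intertwiners_separate:
  assumes h0: "\<And>Q R. intertwiner Q R \<Longrightarrow> Q h0 = 0"
  shows "h0 = 0"
proof (rule ccontr)
  assume "h0 \<noteq> 0"
  define E where "E = {h. \<forall>Q R. intertwiner Q R \<longrightarrow> Q h = 0}"
  have E_iff: "h \<in> E \<longleftrightarrow> (\<forall>Q R \<kappa>. intertwiner Q R \<longrightarrow> cinner h (R \<kappa>) = 0)" for h
  proof -
    have "Q h = 0 \<longleftrightarrow> (\<forall>\<kappa>. cinner h (R \<kappa>) = 0)" if "intertwiner Q R" for Q R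
    proof -
      have eq: "cinner (Q h) \<kappa> = cinner h (R \<kappa>)" for \<kappa> using that by (simp add: intertwiner_def)
      show ?thesis using cinner_eqI[of "Q h" 0] by (auto simp flip: eq)
    qed
    then show ?thesis unfolding E_def by blast
  qed
  have Esub: "csubspace E"
    by (auto simp: csubspace_def E_iff cinner_add_left cinner_scaleC_left)
  have "E = (\<Inter>R\<in>{R. \<exists>Q. intertwiner Q R}. \<Inter>\<kappa>. {h. cinner h (R \<kappa>) = 0})"
    unfolding set_eq_iff INT_iff mem_Collect_eq E_iff by blast
  moreover have "closed \<dots>"
    by (intro closed_INT ballI closed_Collect_eq continuous_intros)
  ultimately have Ecl: "closed E" by simp
  have Einv: "app (\<pi> a) h \<in> E" if "a \<in> A" "h \<in> E" for a h
  proof -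
    have "Q (app (\<pi> a) h) = 0" if "intertwiner Q R" for Q R
    proof -
      have "Q (app (\<pi> a) h) = app a (Q h)" using that \<open>a \<in> A\<close> by (simp add: intertwiner_def)
      also have "Q h = 0" using that \<open>h \<in> E\<close> unfolding E_def by blast
      finally show ?thesis by simp
    qed
    then show ?thesis unfolding E_def by blast
  qed
  obtain \<Omega>' where \<Omega>': "\<Omega>' \<in> E" and orth: "\<And>v. v \<in> E \<Longrightarrow> cinner v (\<Omega> - \<Omega>') = 0"
    using orthogonal_projection_exists[OF Esub Ecl, of \<Omega>] by blast
  \<comment> \<open>If \<open>\<Omega>\<close> were orthogonal to the invariant subspace
    \<open>E\<close>, then \<open>h0 \<in> E\<close> would be orthogonal to all
    \<open>app (\<pi> a) \<Omega>\<close>, hence 0.\<close>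
  have "\<Omega>' \<noteq> 0"
  proof
    assume "\<Omega>' = 0"
    have "cinner (app (\<pi> a) \<Omega>) h0 = 0" if "a \<in> A" for a
    proof -
      obtain b where b: "b \<in> A" "is_adjoint a b" using adjoint_obtain[OF \<open>a \<in> A\<close>] .
      have "app (\<pi> b) h0 \<in> E" using h0 b by (intro Einv) (simp_all only: E_def, blast)
      from orth[OF this] have "cinner \<Omega> (app (\<pi> b) h0) = 0"
        using \<open>\<Omega>' = 0\<close> by (metis cinner_commute complex_cnj_zero diff_zero)
      then show ?thesis by (simp add: is_adjointD[OF pi_adjoint[OF that b]])
    qed
    then have "h0 = 0" by (rule orthogonal_cyclic)
    with \<open>h0 \<noteq> 0\<close> show False ..
  qed
  \<comment> \<open>With \<open>c\<close> a root of \<open>a\<close>, invariance of \<open>E\<close>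
    makes the images under \<open>\<pi> c\<close> of \<open>\<Omega>'\<close> and
    \<open>\<Omega> - \<Omega>'\<close> orthogonal, so Pythagoras applies.\<close>
  have dom: "quad (\<pi> a) \<Omega>' \<le> quad (\<pi> a) \<Omega>" if a: "a \<in> A" "effect a" for a
  proof -
    obtain c where c: "c \<in> A" "selfadjoint c"
      and q: "\<And>\<zeta>. quad (\<pi> a) \<zeta> = (norm (app (\<pi> c) \<zeta>))\<^sup>2" using effect_square[OF a] by blast
    have "cinner (app (\<pi> c) \<Omega>') (app (\<pi> c) (\<Omega> - \<Omega>')) = cinner (app (\<pi> c) (app (\<pi> c) \<Omega>')) (\<Omega> - \<Omega>')"
      by (simp add: selfadjointD[OF pi_selfadjoint[OF c]])
    also have "\<dots> = 0" by (intro orth Einv c \<Omega>')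
    finally have "(norm (app (\<pi> c) \<Omega>' + app (\<pi> c) (\<Omega> - \<Omega>')))\<^sup>2 =
        (norm (app (\<pi> c) \<Omega>'))\<^sup>2 + (norm (app (\<pi> c) (\<Omega> - \<Omega>')))\<^sup>2"
      by (simp add: norm_add_sq)
    then show ?thesis by (simp add: q app_diff)
  qed
  define f where "f a = quad (\<pi> a) \<Omega>'" for a
  have f0: "f 0 = 0" by (simp add: f_def pi_zero quad_simps)
  have f_add: "f (a + b) = f a + f b" if "a \<in> A" "b \<in> A" for a b
    using that by (simp add: f_def pi_add quad_simps)
  have f_diff: "f (a - b) = f a - f b" if "a \<in> A" "b \<in> A" for a b
    using that by (simp add: f_def pi_diff quad_simps)
  have f1: "f 1 > 0" using \<open>\<Omega>' \<noteq> 0\<close> by (simp add: f_def pi_one quad_simps)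
  have f_nonneg: "0 \<le> f a" if "a \<in> A" "effect a" for a
    unfolding f_def by (rule quad_pi_nonneg[OF that])
  \<comment> \<open>Since \<open>f\<close> is nonnegative on effects, the constraint says
    \<open>f r = 0\<close>. Maximality means that no nonzero effect of \<open>A\<close> below
    \<open>1 - r\<close> is annihilated by \<open>f\<close>.\<close>
  obtain r where r: "r \<in> A" "effect r" "op_le r 1" "0 \<le> - f r"
    and rmax: "\<And>t'. t' \<in> A \<Longrightarrow> op_le r t' \<Longrightarrow> op_le t' 1 \<Longrightarrow> 0 \<le> - f t' \<Longrightarrow> t' = r"
  proof (rule maximal_effect[of 1 "\<lambda>a. - f a"])
    fix D s
    assume *: "D \<noteq> {}" "D \<subseteq> A" "\<And>a. a \<in> D \<Longrightarrow> effect a"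
      "\<And>a b. a \<in> D \<Longrightarrow> b \<in> D \<Longrightarrow> op_le a b \<or> op_le b a" "s \<in> A" "effect s"
      "\<And>d. d \<in> D \<Longrightarrow> op_le d s"
      "\<And>t. selfadjoint t \<Longrightarrow> (\<And>d. d \<in> D \<Longrightarrow> op_le d t) \<Longrightarrow> op_le s t"
    show "((\<lambda>a. - f a) \<longlongrightarrow> - f s) (up_filter D)"
      unfolding f_def by (intro tendsto_minus quad_pi_normal) (use * dom in auto)
  qed (use A_intros effect_one f0 in auto)
  have fr: "f r = 0" using r f_nonneg[of r] by simp
  have q: "1 - r \<in> A" "effect (1 - r)"
    using effect_diff[OF r(2) effect_one r(3)] by (auto intro: A_intros r)
  \<comment> \<open>A long enough \<open>\<xi>\<close> makes \<open>1 - r\<close> itself violate the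
    constraint imposed on \<open>t\<close> below, so \<open>t\<close> cannot exhaust
    \<open>1 - r\<close>.\<close>
  have "\<exists>\<xi>. quad (1 - r) \<xi> > f 1"
  proof -
    have "\<exists>\<xi>. quad (1 - r) \<xi> > 0"
    proof (rule ccontr)
      assume "\<not> ?thesis"
      then have "op_le (1 - r) 0"
        using effect_selfadjoint[OF q(2)] by (intro op_leI) (auto simp: quad_simps(1) not_less)
      then have "1 - r = 0" using q(2) by (intro op_le_antisym) (auto simp: effect_def)
      then show False using fr f1 by simp
    qed
    then obtain \<xi> where \<xi>: "quad (1 - r) \<xi> > 0" ..
    obtain N :: nat where N: "f 1 < N * quad (1 - r) \<xi>" using reals_Archimedean3[OF \<xi>] by blast
    have "quad (1 - r) (complex_of_real (sqrt N) *\<^sub>C \<xi>) = N * quad (1 - r) \<xi>"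
      unfolding quad_def app_scale cinner_scaleC_left cinner_scaleC_right
      by (simp flip: of_real_mult mult.assoc)
    with N show ?thesis by metis
  qed
  then obtain \<xi> where \<xi>: "quad (1 - r) \<xi> > f 1" ..
  obtain t where t: "t \<in> A" "effect t" "op_le t (1 - r)" "0 \<le> f t - quad t \<xi>"
    and tmax: "\<And>t'. t' \<in> A \<Longrightarrow> op_le t t' \<Longrightarrow> op_le t' (1 - r) \<Longrightarrow> 0 \<le> f t' - quad t' \<xi> \<Longrightarrow> t' = t"
  proof (rule maximal_effect[of "1 - r" "\<lambda>a. f a - quad a \<xi>"])
    fix D s
    assume *: "D \<noteq> {}" "D \<subseteq> A" "\<And>a. a \<in> D \<Longrightarrow> effect a"
      "\<And>a b. a \<in> D \<Longrightarrow> b \<in> D \<Longrightarrow> op_le a b \<or> op_le b a" "s \<in> A" "effect s"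
      "\<And>d. d \<in> D \<Longrightarrow> op_le d s"
      "\<And>t. selfadjoint t \<Longrightarrow> (\<And>d. d \<in> D \<Longrightarrow> op_le d t) \<Longrightarrow> op_le s t"
      "\<And>\<xi>. ((\<lambda>d. app d \<xi>) \<longlongrightarrow> app s \<xi>) (up_filter D)"
    have "((\<lambda>d. quad d \<xi>) \<longlongrightarrow> quad s \<xi>) (up_filter D)"
      unfolding quad_def by (intro tendsto_intros *(9))
    moreover have "(f \<longlongrightarrow> f s) (up_filter D)"
      unfolding f_def by (intro quad_pi_normal) (use * dom in auto)
    ultimately show "((\<lambda>a. f a - quad a \<xi>) \<longlongrightarrow> f s - quad s \<xi>) (up_filter D)"
      by (intro tendsto_intros)
  qed (use q f0 in \<open>auto simp: quad_simps\<close>)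
  \<comment> \<open>By maximality of \<open>t\<close>, \<open>f\<close> is dominated by the vector
    functional of \<open>\<xi>\<close> on positive elements below \<open>s\<close>. If
    \<open>f s = 0\<close>, maximality of \<open>r\<close> forces \<open>t = 1 - r\<close>, against
    the choice of \<open>\<xi>\<close>.\<close>
  define s where "s = (1 - r) - t"
  have s: "s \<in> A" "effect s" unfolding s_def by (intro A_intros q t, intro effect_diff q t)
  have s_dom: "f a \<le> quad a \<xi>" if a: "a \<in> A" "op_le 0 a" "op_le a s" for a
  proof (rule ccontr)
    assume "\<not> ?thesis"
    then have "0 \<le> f (t + a) - quad (t + a) \<xi>" using t a by (simp add: f_add quad_simps)
    moreover have "op_le t (t + a)" using a by (auto simp: op_le_iff quad_simps)
    moreover have "op_le (t + a) (1 - r)" using a(3) by (simp add: op_le_def s_def algebra_simps)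
    ultimately have "t + a = t" by (intro tmax A_intros t a)
    with \<open>\<not> f a \<le> quad a \<xi>\<close> f0 show False by (simp add: quad_simps)
  qed
  have fs: "f s > 0"
  proof (rule ccontr)
    assume "\<not> ?thesis"
    then have "0 \<le> - f (r + s)" using r s fr by (simp add: f_add)
    moreover have "op_le r (r + s)" using s(2) by (auto simp: effect_def op_le_iff quad_simps)
    moreover have "op_le (r + s) 1"
      using t(2) by (auto simp: s_def op_le_iff quad_simps effect_def)
    ultimately have "r + s = r" by (intro rmax A_intros r s)
    then have "t = 1 - r" by (auto simp: s_def)
    with t(4) \<xi> A_intros(1) r(1) fr show False by (simp add: f_diff)
  qed
  define \<eta> where "\<eta> = app (\<pi> s) \<Omega>'"
  have "norm (app (\<pi> c) \<eta>) \<le> norm (app c (app s \<xi>))" if c: "c \<in> A" for c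
  proof -
    obtain c' where c': "c' \<in> A" "is_adjoint c c'" using adjoint_obtain[OF c] .
    obtain K where K: "K > 0" "\<And>\<zeta>. norm (app c \<zeta>) \<le> K * norm \<zeta>" using app_bounded by blast
    \<comment> \<open>Divided by the square of a bound \<open>K\<close> for \<open>c\<close>, this
      operator lies below \<open>s * s\<close> and hence below \<open>s\<close>, so
      \<open>s_dom\<close> applies; the factor cancels afterwards.\<close>
    define a0 where "a0 = s * (c' * (c * s))"
    define a where "a = complex_of_real (1 / K\<^sup>2) *\<^sub>C a0"
    note sa = selfadjointD[OF effect_selfadjoint[OF s(2)]]
    have mem: "c * s \<in> A" "c' * (c * s) \<in> A" "a0 \<in> A" "a \<in> A"
      unfolding a_def a0_def by (intro A_intros c c' s)+
    have q0: "quad a0 \<zeta> = (norm (app c (app s \<zeta>)))\<^sup>2" for \<zeta>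
      by (simp add: quad_def a0_def app_times sa is_adjointD'[OF c'(2)] flip: Re_cinner_self)
    have "selfadjoint a0"
      by (rule selfadjointI) (simp add: a0_def app_times sa is_adjointD'[OF c'(2)] is_adjointD[OF c'(2)])
    then have saa: "selfadjoint a" unfolding a_def by (rule selfadjoint_intros)
    have qa: "quad a \<zeta> = (norm (app c (app s \<zeta>)))\<^sup>2 / K\<^sup>2" for \<zeta>
      unfolding a_def quad_simps(5) q0 by simp
    have "quad a \<zeta> \<le> quad s \<zeta>" for \<zeta>
    proof -
      have "(norm (app c (app s \<zeta>)))\<^sup>2 \<le> (K * norm (app s \<zeta>))\<^sup>2" by (intro power_mono K) auto
      then have "quad a \<zeta> \<le> (norm (app s \<zeta>))\<^sup>2"
        unfolding qa using K(1) by (simp add: power_mult_distrib field_simps)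
      also have "\<dots> \<le> quad s \<zeta>" by (rule effect_norm_sq_le[OF s(2)])
      finally show ?thesis .
    qed
    then have "f a \<le> quad a \<xi>"
      using saa effect_selfadjoint[OF s(2)] mem by (intro s_dom op_leI) (auto simp: quad_simps(1) qa)
    moreover have "\<pi> a0 = \<pi> s * (\<pi> c' * (\<pi> c * \<pi> s))"
      using c c' s mem by (simp add: a0_def pi_mult)
    then have "quad (\<pi> a0) \<Omega>' = (norm (app (\<pi> c) \<eta>))\<^sup>2"
      by (simp add: quad_def \<eta>_def app_times is_adjointD'[OF pi_adjoint[OF c c']]
          selfadjointD[OF pi_selfadjoint[OF s(1) effect_selfadjoint[OF s(2)]]] flip: Re_cinner_self)
    then have "f a = (norm (app (\<pi> c) \<eta>))\<^sup>2 / K\<^sup>2"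
      unfolding f_def a_def pi_scale[OF mem(3)] quad_simps(5) by simp
    ultimately have "(norm (app (\<pi> c) \<eta>))\<^sup>2 \<le> (norm (app c (app s \<xi>)))\<^sup>2"
      using K(1) by (simp add: qa field_simps)
    then show ?thesis by (rule power2_le_imp_le) simp
  qed
  then obtain Q R where QR: "intertwiner Q R"
    and Q: "\<And>c h. c \<in> A \<Longrightarrow> cinner (app (\<pi> c) \<eta>) h = cinner (app c (app s \<xi>)) (Q h)"
    using dominated_intertwiner[of \<eta> "app s \<xi>"] by blast
  \<comment> \<open>\<open>Q\<close> vanishes on \<open>E\<close>, while its defining identity at
    \<open>c = 1\<close> turns \<open>cinner \<eta> \<eta>\<close> into a pairing with
    \<open>Q \<eta>\<close>. Hence \<open>\<eta> = 0\<close>, against \<open>fs\<close>.\<close>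
  have "\<eta> \<in> E" unfolding \<eta>_def by (intro Einv s \<Omega>')
  with QR have "Q \<eta> = 0" unfolding E_def by blast
  with Q[OF A_intros(1), of \<eta>] have "\<eta> = 0" by (simp add: pi_one)
  then have "f s = 0" by (simp add: f_def quad_def \<eta>_def)
  with fs show False by simp
qed

text \<open>For the projection \<open>p\<close> onto \<open>V\<close> and intertwiners \<open>Q\<close>, \<open>R'\<close>, the operator \<open>Q p R'\<close> commutes with
  the generators and hence with \<open>A\<close>; since intertwiners separate points, \<open>p\<close> commutes with \<open>\<pi> A\<close>.\<close>

theorem invariant_subspace_of_generators:
  assumes gen: "A = vn_generated S" and Ssa: "\<And>x. x \<in> S \<Longrightarrow> selfadjoint x"
    and V: "csubspace V" "closed V" "\<Omega> \<in> V"
    and inv: "\<And>x v. x \<in> S \<Longrightarrow> v \<in> V \<Longrightarrow> app (\<pi> x) v \<in> V"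
  shows "V = UNIV"
proof -
  have SA: "x \<in> A" if "x \<in> S" for x using that unfolding gen vn_generated_def by blast
  have "\<exists>w. w \<in> V \<and> (\<forall>v\<in>V. cinner v (h - w) = 0)" for h
    using orthogonal_projection_exists[OF V(1,2)] by metis
  then obtain p where pV: "\<And>h. p h \<in> V" and p: "\<And>h v. v \<in> V \<Longrightarrow> cinner v (h - p h) = 0" by metis
  have p': "cinner (h - p h) v = 0" if "v \<in> V" for h v using p[OF that] by (metis cinner_commute complex_cnj_zero)
  have p_sym: "cinner (p h) h' = cinner h (p h')" for h h'
    using p[OF pV, of h h'] p'[OF pV, of h h'] by (simp add: cinner_diff_left cinner_diff_right)
  have p_fix: "p v = v" if "v \<in> V" for v
    using p[OF csubspace_diff[OF V(1) that pV], of v v] by simp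
  have p_comm: "p (app (\<pi> x) h) = app (\<pi> x) (p h)" if "x \<in> S" for x h
  proof (rule cinner_eqI)
    fix h'
    note sa = selfadjointD[OF pi_selfadjoint[OF SA[OF that] Ssa[OF that]]]
    have "cinner (p (app (\<pi> x) h)) h' = cinner h (app (\<pi> x) (p h'))" by (simp add: p_sym sa)
    also have "\<dots> = cinner (p h) (app (\<pi> x) (p h'))"
      using p'[OF inv[OF that pV], of h h'] by (simp add: cinner_diff_left)
    also have "\<dots> = cinner (app (\<pi> x) (p h)) (p h')" by (simp add: sa)
    also have "\<dots> = cinner (app (\<pi> x) (p h)) h'"
      using p[OF inv[OF that pV], of h h'] by (simp add: cinner_diff_right)
    finally show "cinner (p (app (\<pi> x) h)) h' = cinner (app (\<pi> x) (p h)) h'" .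
  qed
  have p_comm_A: "p (app (\<pi> a) h) = app (\<pi> a) (p h)" if a: "a \<in> A" for a h
  proof -
    have RQ: "R (app a \<kappa>) = app (\<pi> a) (R \<kappa>)" if QR: "intertwiner Q R" and a: "a \<in> A" for Q R a \<kappa>
    proof (rule cinner_eqI_right)
      fix h
      obtain b where b: "b \<in> A" "is_adjoint a b" using adjoint_obtain[OF a] .
      have "cinner h (R (app a \<kappa>)) = cinner (app b (Q h)) \<kappa>"
        using QR by (simp add: intertwiner_def is_adjointD'[OF b(2)])
      also have "\<dots> = cinner (app (\<pi> b) h) (R \<kappa>)" using QR b unfolding intertwiner_def by metis
      finally show "cinner h (R (app a \<kappa>)) = cinner h (app (\<pi> a) (R \<kappa>))"
        by (simp add: is_adjointD'[OF pi_adjoint[OF a b]])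
    qed
    have comm: "p (app (\<pi> a) (R' \<kappa>)) = app (\<pi> a) (p (R' \<kappa>))" if QR': "intertwiner Q' R'" and a: "a \<in> A" for Q' R' \<kappa> a
    proof -
      have "Q (p (app (\<pi> a) (R' \<kappa>)) - app (\<pi> a) (p (R' \<kappa>))) = 0" if QR: "intertwiner Q R" for Q R
      proof -
        have 1: "app a (Q (p (R' \<kappa>))) = Q (p (R' (app a \<kappa>)))"
        proof (rule commutes_with_vn_generated[where S = S and T = "\<lambda>\<kappa>. Q (p (R' \<kappa>))" and T' = "\<lambda>\<kappa>. Q' (p (R \<kappa>))"])
          show "von_neumann_algebra (vn_generated S)" using vn gen by simp
          show "a \<in> vn_generated S" using a gen by simp
          show "cinner (Q (p (R' \<kappa>))) \<kappa>' = cinner \<kappa> (Q' (p (R \<kappa>')))" for \<kappa> \<kappa>'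
            using QR QR' unfolding intertwiner_def by (metis cinner_commute p_sym)
          show "app x (Q (p (R' \<kappa>))) = Q (p (R' (app x \<kappa>)))" if "x \<in> S" for x \<kappa>
            using QR that SA[OF that] by (simp add: RQ[OF QR'] p_comm) (simp add: intertwiner_def)
          show "app x (Q' (p (R \<kappa>))) = Q' (p (R (app x \<kappa>)))" if "x \<in> S" for x \<kappa>
            using QR' that SA[OF that] by (simp add: RQ[OF QR] p_comm) (simp add: intertwiner_def)
        qed
        have diff: "Q (h - h') = Q h - Q h'" for h h'
          using QR by (intro cinner_eqI) (simp add: intertwiner_def cinner_diff_left)
        have "Q (app (\<pi> a) (p (R' \<kappa>))) = app a (Q (p (R' \<kappa>)))"
          using QR a by (simp add: intertwiner_def)
        then show ?thesis by (simp add: diff 1 RQ[OF QR' a])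
      qed
      then have "p (app (\<pi> a) (R' \<kappa>)) - app (\<pi> a) (p (R' \<kappa>)) = 0" by (rule intertwiners_separate)
      then show ?thesis by simp
    qed
    obtain b where b: "b \<in> A" "is_adjoint a b" using adjoint_obtain[OF a] .
    note adj = is_adjointD[OF pi_adjoint[OF a b]]
    \<comment> \<open>\<open>comm\<close> covers only vectors in the range of an \<open>R'\<close>.
      Moving all operators to the other side of the inner product reduces an arbitrary
      \<open>h\<close> to \<open>comm\<close> for the adjoint \<open>b\<close>.\<close>
    have "p (app (\<pi> a) h) - app (\<pi> a) (p h) = 0"
    proof (rule intertwiners_separate)
      fix Q R assume QR: "intertwiner Q R"
      show "Q (p (app (\<pi> a) h) - app (\<pi> a) (p h)) = 0"
      proof (rule cinner_eqI)
        fix \<kappa>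
        have "cinner (Q (p (app (\<pi> a) h) - app (\<pi> a) (p h))) \<kappa> =
            cinner (p (app (\<pi> a) h) - app (\<pi> a) (p h)) (R \<kappa>)"
          using QR by (simp add: intertwiner_def)
        also have "\<dots> = cinner h (app (\<pi> b) (p (R \<kappa>))) - cinner h (p (app (\<pi> b) (R \<kappa>)))"
          by (simp add: cinner_diff_left p_sym adj)
        also have "\<dots> = 0" by (simp add: comm[OF QR b(1)])
        finally show "cinner (Q (p (app (\<pi> a) h) - app (\<pi> a) (p h))) \<kappa> = cinner 0 \<kappa>" by simp
      qed
    qed
    then show ?thesis by simp
  qed
  have "app (\<pi> a) \<Omega> \<in> V" if "a \<in> A" for a
    using p_comm_A[OF that, of \<Omega>] p_fix[OF V(3)] pV[of "app (\<pi> a) \<Omega>"] by simp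
  then have "closure ((\<lambda>a. app (\<pi> a) \<Omega>) ` A) \<subseteq> V" using V(2) by (intro closure_minimal) auto
  then show ?thesis using gns by (auto simp: gns_representation_def)
qed

end

section \<open>Boolean spreadability in a representation of the relations\<close>

text \<open>Takes any function of words in place of a functional on polynomials, so that an
  induction along a word may absorb a prefix into \<open>f\<close>.\<close>

definition word_map :: "(nc_word \<Rightarrow> complex) \<Rightarrow> (nc_word \<Rightarrow>\<^sub>0 'b :: complex_algebra_1) \<Rightarrow> 'b" where
  "word_map f q = (\<Sum>w\<in>Poly_Mapping.keys q. f w *\<^sub>C Poly_Mapping.lookup q w)"

lemma tensor_id_eq: "tensor_id \<mu> = word_map (\<lambda>w. \<mu> (Poly_Mapping.single w 1))"
  by (rule ext) (simp add: tensor_id_def word_map_def)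

lemma word_map_add: "word_map f (p + q) = word_map f p + word_map f q"
  unfolding word_map_def by (rule setsum_keys_plus_distrib) (simp_all add: scaleC_add_right)

lemma word_map_zero: "word_map f 0 = 0"
  by (simp add: word_map_def)

lemma word_map_sum: "word_map f (\<Sum>i\<in>I. g i) = (\<Sum>i\<in>I. word_map f (g i))"
  by (induction I rule: infinite_finite_induct) (simp_all add: word_map_add word_map_zero)

lemma word_map_single: "word_map f (Poly_Mapping.single w b) = f w *\<^sub>C b"
  by (cases "b = 0") (simp_all add: word_map_def)

lemma sum_singles:
  "q = (\<Sum>k\<in>Poly_Mapping.keys q. Poly_Mapping.single k (Poly_Mapping.lookup q k))"
  by (rule poly_mapping_eqI) (simp add: lookup_sum lookup_single when_def in_keys_iff)

lemma word_map_single_mult: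
  "word_map f (Poly_Mapping.single v b * q) = b * word_map (\<lambda>w. f (v + w)) q"
proof -
  have "word_map f (Poly_Mapping.single v b * q) =
      (\<Sum>k\<in>Poly_Mapping.keys q. word_map f (Poly_Mapping.single v b * Poly_Mapping.single k (Poly_Mapping.lookup q k)))"
    by (subst sum_singles[of q]) (simp only: sum_distrib_left word_map_sum)
  then show ?thesis
    by (simp add: mult_single word_map_single) (simp add: word_map_def sum_distrib_left scaleC_mult_right)
qed

text \<open>The value of \<open>f \<otimes> id\<close> at the image of a monomial under
  \<open>alpha_b\<close>, as a recursion on the first letter; \<open>word_map_prod\<close> makes the
  link.\<close>

fun word_sum ::
  "nat \<Rightarrow> (nat \<Rightarrow> nat \<Rightarrow> 'b :: complex_algebra_1) \<Rightarrow> (nat list \<Rightarrow> complex) \<Rightarrow> nat list \<Rightarrow> 'b" where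
  "word_sum n u f [] = f [] *\<^sub>C 1"
| "word_sum n u f (j # w) = (\<Sum>i=1..n. u i j * word_sum n u (\<lambda>v. f (i # v)) w)"

lemma word_map_prod:
  "word_map f (prod_list (map (\<lambda>j. \<Sum>i=1..n. Poly_Mapping.single (Word [i]) (u i j)) w)) =
     word_sum n u (\<lambda>v. f (Word v)) w"
proof (induction w arbitrary: f)
  case Nil
  have "word_map f 1 = f 0 *\<^sub>C 1"
    using word_map_single[of f 0 1] by (simp only: single_one)
  then show ?case by (simp add: zero_nc_word_def)
next
  case (Cons j w)
  then show ?case
    by (simp add: sum_distrib_right word_map_sum word_map_single_mult plus_nc_word_def)
qed

lemma word_sum_apply:
  fixes u :: "nat \<Rightarrow> nat \<Rightarrow> 'a \<Rightarrow> 'b :: complex_algebra_1"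
  shows "word_sum n u f w r = word_sum n (\<lambda>i j. u i j r) f w"
proof (induction w arbitrary: f)
  case Nil
  then show ?case by (simp add: scaleC_fun_def)
next
  case (Cons j w)
  have "(\<Sum>i\<in>I. g i) r = (\<Sum>i\<in>I. g i r)" for I and g :: "nat \<Rightarrow> 'a \<Rightarrow> 'b"
    by (induction I rule: infinite_finite_induct) simp_all
  then show ?case by (simp add: Cons)
qed

lemma nc_eval_single: "nc_eval x (Poly_Mapping.single w 1) = prod_list (map x (letters w))"
  by (simp add: nc_eval_def scaleC_one)

text \<open>Elements of the universal algebra are functions on families of operators, so its
  identities may be evaluated at the family \<open>(u, P)\<close>.\<close>

lemma boolean_spreadable_representation:
  fixes P :: "ell2 bop"
  assumes sp: "boolean_spreadable \<phi> n y" and k: "1 \<le> k" "k < n"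
    and w: "set w \<subseteq> {1..k}" and rel: "bi_relations n k u P"
  shows "\<phi> (prod_list (map y w)) *\<^sub>C P = P * word_sum n u (\<lambda>v. \<phi> (prod_list (map y v))) w * P"
proof -
  let ?p = "Poly_Mapping.single (Word w) 1 :: nc_poly"
  have "?p \<in> nc_polys k" using w by (simp add: nc_polys_def)
  then have "joint_distribution \<phi> y ?p *\<^sub>C bi_P n k =
      bi_P n k * tensor_id (joint_distribution \<phi> y) (alpha_b n k ?p) * bi_P n k"
    using sp k by (simp add: boolean_spreadable_def)
  from fun_cong[OF this, of "(u, P)"]
  show ?thesis
    by (simp add: scaleC_fun_def joint_distribution_def nc_eval_single bi_universal[OF rel]
        alpha_b_def tensor_id_eq word_map_prod word_sum_apply del: One_nat_def)
qed

section \<open>A representation of the relations by three rank one projections\<close>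

definition rank_one :: "'h :: chilbert_space \<Rightarrow> 'h bop" where
  "rank_one v = Bop (\<lambda>\<xi>. cinner \<xi> v *\<^sub>C v)"

lemma app_rank_one: "app (rank_one v) \<xi> = cinner \<xi> v *\<^sub>C v"
proof -
  have "app (rank_one v) = (\<lambda>\<xi>. cinner \<xi> v *\<^sub>C v)"
    unfolding rank_one_def
  proof (rule app_Bop)
    show "norm (cinner \<xi> v *\<^sub>C v) \<le> (norm v)\<^sup>2 * norm \<xi>" for \<xi>
      using mult_right_mono[OF complex_Cauchy_Schwarz[of \<xi> v] norm_ge_zero[of v]]
      by (simp add: norm_scaleC power2_eq_square algebra_simps)
  qed (simp_all add: cinner_add_left cinner_scaleC_left scaleC_add_left scaleC_scaleC)
  then show ?thesis by simp
qed

lemma selfadjoint_rank_one: "selfadjoint (rank_one v)"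
  unfolding selfadjoint_def is_adjoint_def app_rank_one cinner_scaleC_left cinner_scaleC_right
  by (metis cinner_commute mult.commute)

lemma ell2_orthonormal_pair:
  obtains e0 e1 :: ell2 where "cinner e0 e0 = 1" "cinner e1 e1 = 1" "cinner e0 e1 = 0"
proof -
  define e where "e i = Ell2 (\<lambda>n. if n = i then 1 else 0)" for i :: nat
  have c: "coord (e i) n = (if n = i then 1 else 0)" for i n
  proof -
    have "summable (\<lambda>n. (cmod (if n = i then 1 else 0 :: complex))\<^sup>2)"
      by (rule summable_finite[of "{i}"]) auto
    then show ?thesis unfolding e_def by (subst Ell2_inverse) auto
  qed
  have "cinner (e i) (e j) = (if i = j then 1 else 0)" for i j
  proof -
    have "cinner (e i) (e j) = (\<Sum>n\<in>{i}. coord (e i) n * cnj (coord (e j) n))"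
      unfolding cinner_ell2_def by (rule suminf_finite) (auto simp: c)
    then show ?thesis by (simp add: c)
  qed
  then show ?thesis using that[of "e 0" "e 1"] by simp
qed

text \<open>\<open>E\<^sub>0\<close>, \<open>E\<^sub>1\<close> project onto the vectors of an orthonormal pair, \<open>P\<close> onto their diagonal.\<close>

lemma three_projections:
  obtains E0 E1 P :: "ell2 bop" where "projection E0" "projection E1" "projection P"
    "E0 * E1 = 0" "E1 * E0 = 0" "(E0 + E1) * P = P"
    "P * E0 * P = (1/2) *\<^sub>C P" "P * E1 * P = (1/2) *\<^sub>C P" "P \<noteq> 0"
proof -
  obtain e0 e1 :: ell2 where e: "cinner e0 e0 = 1" "cinner e1 e1 = 1" "cinner e0 e1 = 0"
    using ell2_orthonormal_pair .
  have e': "cinner e1 e0 = 0" using e(3) by (metis cinner_commute complex_cnj_zero)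
  define v where "v = e0 + e1"
  have v: "cinner e0 v = 1" "cinner e1 v = 1" "cinner v e0 = 1" "cinner v e1 = 1" "cinner v v = 2"
    by (simp_all add: v_def cinner_add_left cinner_add_right e e')
  \<comment> \<open>The squared norm of \<open>v\<close> is 2, hence the factor.\<close>
  define P where "P = (1/2) *\<^sub>C rank_one v"
  note s = app_times app_scaleC app_plus app_rank_one cinner_scaleC_left scaleC_scaleC v e e' app_scale
    cinner_add_left
  show ?thesis
  proof (rule that[of "rank_one e0" "rank_one e1" P])
    show "projection (rank_one e0)" "projection (rank_one e1)"
      unfolding projection_def by (auto simp: selfadjoint_rank_one s intro!: bop_eqI)
    have "selfadjoint P"
      using selfadjoint_rank_one[of v]
      by (simp add: P_def selfadjoint_def is_adjoint_def app_scaleC cinner_scaleC_left cinner_scaleC_right)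
    then show "projection P"
      unfolding projection_def by (auto simp: P_def s intro!: bop_eqI)
    show "rank_one e0 * rank_one e1 = 0" "rank_one e1 * rank_one e0 = 0"
      by (auto simp: s intro!: bop_eqI)
    show "(rank_one e0 + rank_one e1) * P = P"
      by (rule bop_eqI) (simp add: P_def s scaleC_add_right[symmetric], simp add: v_def)
    show "P * rank_one e0 * P = (1/2) *\<^sub>C P" "P * rank_one e1 * P = (1/2) *\<^sub>C P"
      by (auto simp: P_def s intro!: bop_eqI)
    show "P \<noteq> 0"
    proof
      assume "P = 0"
      then have "cinner (app P v) v = 0" by simp
      then show False by (simp add: P_def s)
    qed
  qed
qed

locale two_copies =
  fixes n k :: nat and \<tau>0 \<tau>1 :: "nat \<Rightarrow> nat" and C :: "nat set" and E0 E1 P :: "ell2 bop"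
  assumes k: "1 \<le> k" "k < n"
    and mono: "strict_mono_on {1..k} \<tau>0" "strict_mono_on {1..k} \<tau>1"
    and range: "\<tau>0 ` {1..k} \<subseteq> {1..n}" "\<tau>1 ` {1..k} \<subseteq> {1..n}"
    and agree: "\<And>j. j \<in> C \<Longrightarrow> \<tau>0 j = \<tau>1 j"
    and pr: "projection E0" "projection E1" "projection P"
    and E: "E0 * E1 = 0" "E1 * E0 = 0" "(E0 + E1) * P = P"
      "P * E0 * P = (1/2) *\<^sub>C P" "P * E1 * P = (1/2) *\<^sub>C P" "P \<noteq> 0"
begin

text \<open>Outside \<open>C\<close> the copies \<open>\<tau>0\<close> and \<open>\<tau>1\<close>
  are marked by \<open>E0\<close> and \<open>E1\<close>; on \<open>C\<close> they coincide and
  \<open>P\<close> is allowed. Where both copies of a letter outside \<open>C\<close> have the same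
  index the entry is \<open>E0 + E1\<close>. A product that must vanish either mixes
  \<open>E0\<close> with \<open>E1\<close> or would need one of the two increasing maps to reverse
  an order.\<close>

definition U :: "nat \<Rightarrow> nat \<Rightarrow> ell2 bop" where
  "U i j = (if j \<in> C then if i = \<tau>0 j then P else 0
     else (if i = \<tau>0 j then E0 else 0) + (if i = \<tau>1 j then E1 else 0))"

lemma idem: "E0 * E0 = E0" "E1 * E1 = E1" "P * P = P"
  using pr by (auto simp: projection_def)

lemma projection_zero: "projection 0"
  by (simp add: projection_def selfadjoint_def is_adjoint_def)

lemma projection_E: "projection (E0 + E1)"
  using pr E by (simp add: projection_def algebra_simps selfadjoint_def is_adjoint_def app_plus
      cinner_add_left cinner_add_right)

lemma U_sum_C:
  assumes "j \<in> C" "j \<in> {1..k}" shows "(\<Sum>i=1..n. U i j * g i) = P * g (\<tau>0 j)"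
proof -
  have "(\<Sum>i=1..n. U i j * g i) = (\<Sum>i=1..n. if i = \<tau>0 j then P * g i else 0)"
    using assms by (intro sum.cong) (auto simp: U_def)
  moreover have "\<tau>0 j \<in> {1..n}" using assms range by blast
  ultimately show ?thesis by (simp add: sum.delta)
qed

lemma U_sum_not_C:
  assumes "j \<notin> C" "j \<in> {1..k}" shows "(\<Sum>i=1..n. U i j * g i) = E0 * g (\<tau>0 j) + E1 * g (\<tau>1 j)"
proof -
  have "(\<Sum>i=1..n. U i j * g i) =
      (\<Sum>i=1..n. if i = \<tau>0 j then E0 * g i else 0) + (\<Sum>i=1..n. if i = \<tau>1 j then E1 * g i else 0)"
    unfolding sum.distrib[symmetric] using assms by (intro sum.cong) (auto simp: U_def algebra_simps)
  moreover have "\<tau>0 j \<in> {1..n}" "\<tau>1 j \<in> {1..n}" using assms range by blast+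
  ultimately show ?thesis by (simp add: sum.delta)
qed

lemma U_relations: "bi_relations n k U P"
  unfolding bi_relations_def
proof (intro conjI ballI impI)
  show "projection P" by (rule pr)
  show "projection (U i j)" for i j
    using pr projection_zero projection_E by (auto simp: U_def)
  show "(\<Sum>i=1..n. U i j * P) = P" if "j \<in> {1..k}" for j
    using that U_sum_C[of j "\<lambda>_. P"] U_sum_not_C[of j "\<lambda>_. P"] idem E(3)
    by (cases "j \<in> C") (auto simp: algebra_simps)
  show "U i j * U i' j' = 0"
    if "j \<in> {1..k}" "j' \<in> {1..k}" and ji: "j < j' \<and> i' \<le> i" for i i' j j'
  proof -
    have "\<tau>0 j < \<tau>0 j'" "\<tau>1 j < \<tau>1 j'"
      using that mono by (auto simp: strict_mono_on_def)
    then show ?thesis using ji agree[of j] agree[of j'] E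
      by (auto simp: U_def)
  qed
qed

lemma word_sum_C:
  assumes "J \<noteq> []" "set J \<subseteq> C \<inter> {1..k}"
  shows "word_sum n U f (J @ w) = P * word_sum n U (\<lambda>v. f (map \<tau>0 J @ v)) w"
  using assms
proof (induction J arbitrary: f rule: list_nonempty_induct)
  case (single j)
  then show ?case by (simp add: U_sum_C del: One_nat_def)
next
  case (cons j J)
  then show ?case by (simp add: U_sum_C del: One_nat_def) (simp add: idem flip: mult.assoc)
qed

text \<open>Mixed products of \<open>E0\<close> and \<open>E1\<close> vanish, so a block outside
  \<open>C\<close> is moved by one and the same copy throughout.\<close>

lemma word_sum_not_C:
  assumes "I \<noteq> []" "set I \<subseteq> {1..k} - C"
  shows "word_sum n U f (I @ w) = E0 * word_sum n U (\<lambda>v. f (map \<tau>0 I @ v)) w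
     + E1 * word_sum n U (\<lambda>v. f (map \<tau>1 I @ v)) w"
  using assms
proof (induction I arbitrary: f rule: list_nonempty_induct)
  case (single j)
  then show ?case by (simp add: U_sum_not_C del: One_nat_def)
next
  case (cons j I)
  then show ?case
    by (simp add: U_sum_not_C del: One_nat_def) (simp add: idem distrib_left E flip: mult.assoc)
qed

text \<open>Nested to the right, the shape that rewriting with \<open>mult.assoc\<close>
  produces.\<close>

lemma PE: "P * (E0 * (P * (E0 * P))) = (1/4) *\<^sub>C P" "P * (E0 * (P * (E1 * P))) = (1/4) *\<^sub>C P"
    "P * (E1 * (P * (E0 * P))) = (1/4) *\<^sub>C P" "P * (E1 * (P * (E1 * P))) = (1/4) *\<^sub>C P"
  using E(4,5) by (simp_all add: mult.assoc scaleC_mult_right scaleC_scaleC)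

lemma scaleC_P_cancel: "a *\<^sub>C P = b *\<^sub>C P \<Longrightarrow> a = b"
proof -
  assume "a *\<^sub>C P = b *\<^sub>C P"
  then have "(a - b) *\<^sub>C P = 0"
    using scaleC_add_left[of "a - b" b P] by simp
  then have "a - b \<noteq> 0 \<Longrightarrow> P = 0"
    using scaleC_scaleC[of "inverse (a - b)" "a - b" P] by (simp add: scaleC_one)
  then show "a = b" using E(6) by auto
qed

lemma moment_invariant:
  assumes "boolean_spreadable \<phi> n y" "J \<noteq> []" "set J \<subseteq> C \<inter> {1..k}"
  shows "\<phi> (prod_list (map y J)) = \<phi> (prod_list (map y (map \<tau>0 J)))"
proof (rule scaleC_P_cancel)
  let ?m = "\<lambda>v. \<phi> (prod_list (map y v))"
  have "?m J *\<^sub>C P = P * word_sum n U ?m (J @ []) * P"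
    using boolean_spreadable_representation[OF assms(1) k _ U_relations] assms(3) by simp
  also have "\<dots> = ?m (map \<tau>0 J) *\<^sub>C P"
    unfolding word_sum_C[OF assms(2,3)] by (simp add: scaleC_mult_left scaleC_mult_right idem mult.assoc)
  finally show "?m J *\<^sub>C P = ?m (map \<tau>0 J) *\<^sub>C P" .
qed

text \<open>The block \<open>J\<close> contributes a \<open>P\<close> between the two outer blocks,
  so these choose their copies independently. Each choice has weight 1/2, as
  \<open>P * E0 * P\<close> and \<open>P * E1 * P\<close> are both half of \<open>P\<close>.\<close>

lemma moment_average:
  assumes "boolean_spreadable \<phi> n y" "J \<noteq> []" "set J \<subseteq> C \<inter> {1..k}"
    and "I \<noteq> []" "set I \<subseteq> {1..k} - C" "I' \<noteq> []" "set I' \<subseteq> {1..k} - C"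
  defines "m \<equiv> \<lambda>v. \<phi> (prod_list (map y v))"
  shows "4 * m (I @ J @ I') =
    m (map \<tau>0 I @ map \<tau>0 J @ map \<tau>0 I') + m (map \<tau>0 I @ map \<tau>0 J @ map \<tau>1 I') +
    m (map \<tau>1 I @ map \<tau>0 J @ map \<tau>0 I') + m (map \<tau>1 I @ map \<tau>0 J @ map \<tau>1 I')"
    (is "_ = ?r")
proof -
  have "set (I @ J @ I') \<subseteq> {1..k}" using assms(3,5,7) by auto
  then have "m (I @ J @ I') *\<^sub>C P = P * word_sum n U m (I @ J @ I' @ []) * P"
    using boolean_spreadable_representation[OF assms(1) k _ U_relations] unfolding m_def append_Nil2 by blast
  also have "\<dots> = (?r / 4) *\<^sub>C P"
    unfolding word_sum_not_C[OF assms(4,5)] word_sum_C[OF assms(2,3)] word_sum_not_C[OF assms(6,7)]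
    by (simp add: scaleC_mult_left scaleC_mult_right distrib_left distrib_right mult.assoc PE scaleC_scaleC
        add_divide_distrib scaleC_add_left)
  finally have "m (I @ J @ I') = ?r / 4" by (rule scaleC_P_cancel)
  then show ?thesis by (simp add: mult.commute)
qed

end

section \<open>Moments of a boolean spreadable sequence\<close>

definition shift :: "int \<Rightarrow> int list \<Rightarrow> int list" where
  "shift d w = map (\<lambda>t. t + d) w"

lemma shift_simps [simp]:
  "shift d [] = []" "shift 0 w = w" "shift d (v @ w) = shift d v @ shift d w"
  "shift d (shift e w) = shift (d + e) w" "set (shift d w) = (\<lambda>t. t + d) ` set w"
  "rev (shift d w) = shift d (rev w)" "shift d w = [] \<longleftrightarrow> w = []"
  by (auto simp: shift_def rev_map)

locale spreadable_moments =
  fixes \<phi> :: "'k :: chilbert_space bop \<Rightarrow> complex" and x :: "int \<Rightarrow> 'k bop"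
  assumes spreadable: "boolean_spreadable_seq \<phi> x"
begin

definition mom :: "int list \<Rightarrow> complex" where
  "mom w = \<phi> (prod_list (map x w))"

text \<open>The sequence to which spreadability is applied lists a copy of \<open>T\<close> translated far to the left,
  followed by \<open>\<sigma>0 T \<union> \<sigma>1 T\<close>.\<close>

lemma two_copies_of_int:
  fixes T C :: "int set" and \<sigma>0 \<sigma>1 :: "int \<Rightarrow> int"
  assumes T: "finite T" "T \<noteq> {}" and mono: "strict_mono_on T \<sigma>0" "strict_mono_on T \<sigma>1"
    and agree: "\<And>t. t \<in> C \<Longrightarrow> \<sigma>0 t = \<sigma>1 t"
    and N: "\<And>t t'. t \<in> T \<Longrightarrow> t' \<in> T \<Longrightarrow> t - N < \<sigma>0 t'" "\<And>t t'. t \<in> T \<Longrightarrow> t' \<in> T \<Longrightarrow> t - N < \<sigma>1 t'"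
  obtains n k \<iota> p \<tau>0 \<tau>1 E0 E1 P where
    "two_copies n k \<tau>0 \<tau>1 (p ` (C \<inter> T)) E0 E1 P" "boolean_spreadable \<phi> n (\<lambda>m. x (\<iota> m))"
    "\<And>t. t \<in> T \<Longrightarrow> p t \<in> {1..k}" "inj_on p T" "\<And>t. t \<in> T \<Longrightarrow> \<iota> (p t) = t - N"
    "\<And>t. t \<in> T \<Longrightarrow> \<iota> (\<tau>0 (p t)) = \<sigma>0 t" "\<And>t. t \<in> T \<Longrightarrow> \<iota> (\<tau>1 (p t)) = \<sigma>1 t"
proof -
  define T' where "T' = (\<lambda>t. t - N) ` T"
  define Y where "Y = T' \<union> \<sigma>0 ` T \<union> \<sigma>1 ` T"
  have fin: "finite Y" "finite T'" using T by (auto simp: Y_def T'_def)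
  \<comment> \<open>The rank of \<open>z\<close> in \<open>Y\<close>. It counts \<open>z\<close>
    itself, so that the ranks of elements of \<open>Y\<close> start at 1, as the indices in
    \<open>boolean_spreadable\<close> do.\<close>
  define pos where "pos z = card {u \<in> Y. u \<le> z}" for z
  define n where "n = card Y"
  define k where "k = card T'"
  have pos_mono: "pos z < pos z'" if "z' \<in> Y" "z < z'" for z z'
    unfolding pos_def
  proof (rule psubset_card_mono)
    have "z' \<in> {u \<in> Y. u \<le> z'} - {u \<in> Y. u \<le> z}" using that by simp
    moreover have "{u \<in> Y. u \<le> z} \<subseteq> {u \<in> Y. u \<le> z'}" using that by auto
    ultimately show "{u \<in> Y. u \<le> z} \<subset> {u \<in> Y. u \<le> z'}" by blast
  qed (use fin in simp)
  have pos_range: "pos z \<in> {1..n}" if "z \<in> Y" for z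
  proof -
    have "card {z} \<le> pos z" unfolding pos_def using fin that by (intro card_mono) auto
    moreover have "pos z \<le> n" unfolding pos_def n_def using fin by (intro card_mono) auto
    ultimately show ?thesis by simp
  qed
  have inj: "inj_on pos Y"
    proof (rule inj_onI)
    show "z = z'" if "z \<in> Y" "z' \<in> Y" "pos z = pos z'" for z z'
      using that pos_mono[of z z'] pos_mono[of z' z] by (cases z z' rule: linorder_cases) auto
  qed
  have img: "pos ` Y = {1..n}"
    using pos_range card_image[OF inj] by (intro card_subset_eq) (auto simp: n_def)
  \<comment> \<open>Spreadability relates words in the first \<open>k\<close> variables to words in
    all \<open>n\<close>, so \<open>T'\<close> has to occupy exactly the lowest ranks;
    \<open>N\<close> places it to the left of both images.\<close>
  have pos_T': "pos z \<in> {1..k}" if "z \<in> T'" for z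
  proof -
    obtain t where t: "t \<in> T" "z = t - N" using \<open>z \<in> T'\<close> by (auto simp: T'_def)
    have "z < \<sigma>0 t'" "z < \<sigma>1 t'" if "t' \<in> T" for t' using N t that by auto
    then have "{u \<in> Y. u \<le> z} \<subseteq> T'" unfolding Y_def by (auto simp: not_le[symmetric])
    then have "pos z \<le> k" unfolding pos_def k_def using fin by (intro card_mono) auto
    then show ?thesis using pos_range[of z] that by (simp add: Y_def)
  qed
  have T'Y: "T' \<subseteq> Y" by (auto simp: Y_def)
  have img': "pos ` T' = {1..k}"
    using pos_T' card_image[OF inj_on_subset[OF inj T'Y]] by (intro card_subset_eq) (auto simp: k_def)
  define \<iota> where "\<iota> = the_inv_into Y pos"
  have \<iota>_pos: "\<iota> (pos z) = z" if "z \<in> Y" for z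
    unfolding \<iota>_def using the_inv_into_f_f[OF inj that] .
  have \<iota>_Y: "\<iota> j \<in> Y" "pos (\<iota> j) = j" if "j \<in> {1..n}" for j
    using that img \<iota>_pos by (metis imageE)+
  have \<iota>_mono: "\<iota> j < \<iota> j'" if "j \<in> {1..n}" "j' \<in> {1..n}" "j < j'" for j j'
  proof (rule ccontr)
    assume "\<not> ?thesis"
    then consider "\<iota> j' < \<iota> j" | "\<iota> j = \<iota> j'" by linarith
    then show False
    proof cases
      case 1
      then show ?thesis using pos_mono[of "\<iota> j" "\<iota> j'"] \<iota>_Y[OF that(1)] \<iota>_Y[OF that(2)] that(3) by simp
    next
      case 2
      then show ?thesis using \<iota>_Y(2)[OF that(1)] \<iota>_Y(2)[OF that(2)] that(3) by simp
    qed
  qed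
  have "k < n"
  proof -
    obtain t where "t \<in> T" using T by blast
    then have "\<sigma>0 t \<in> Y" "\<sigma>0 t \<notin> T'" using N(1)[OF _ \<open>t \<in> T\<close>] unfolding Y_def T'_def by (blast, metis imageE less_irrefl)
    then have "T' \<subset> Y" using T'Y by blast
    then show ?thesis unfolding k_def n_def using fin by (intro psubset_card_mono)
  qed
  have "1 \<le> k" using T fin unfolding k_def T'_def by (simp add: Suc_le_eq card_gt_0_iff)
  have \<iota>_T: "\<iota> j + N \<in> T" if "j \<in> {1..k}" for j
  proof -
    obtain t where "t \<in> T" "j = pos (t - N)" using \<open>j \<in> {1..k}\<close> img' unfolding T'_def by blast
    then show ?thesis using \<iota>_pos[of "t - N"] T'Y by (auto simp: T'_def)
  qed
  define p where "p t = pos (t - N)" for t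
  have p: "p t \<in> {1..k}" "\<iota> (p t) = t - N" if "t \<in> T" for t
    using that pos_T'[of "t - N"] \<iota>_pos[of "t - N"] T'Y by (auto simp: p_def T'_def)
  \<comment> \<open>The map \<open>\<sigma>\<close> read through the enumeration; adding
    \<open>N\<close> undoes the translation of \<open>T\<close>.\<close>
  define \<tau> where "\<tau> \<sigma> j = pos (\<sigma> (\<iota> j + N))" for \<sigma> :: "int \<Rightarrow> int" and j
  have \<tau>_mono: "strict_mono_on {1..k} (\<tau> \<sigma>)" if "strict_mono_on T \<sigma>" "\<sigma> ` T \<subseteq> Y" for \<sigma>
  proof (rule strict_mono_onI)
    fix j j' assume j: "j \<in> {1..k}" "j' \<in> {1..k}" "j < j'"
    then have "\<iota> j + N < \<iota> j' + N" using \<iota>_mono[of j j'] \<open>k < n\<close> by auto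
    then have "\<sigma> (\<iota> j + N) < \<sigma> (\<iota> j' + N)" using that(1) \<iota>_T j by (auto simp: strict_mono_on_def)
    then show "\<tau> \<sigma> j < \<tau> \<sigma> j'" unfolding \<tau>_def using that(2) \<iota>_T j by (intro pos_mono) auto
  qed
  have \<tau>_range: "\<tau> \<sigma> ` {1..k} \<subseteq> {1..n}" if "\<sigma> ` T \<subseteq> Y" for \<sigma>
    unfolding \<tau>_def using that \<iota>_T pos_range by blast
  have \<tau>_val: "\<iota> (\<tau> \<sigma> (p t)) = \<sigma> t" if "\<sigma> ` T \<subseteq> Y" "t \<in> T" for \<sigma> t
    unfolding \<tau>_def using that p by (auto intro!: \<iota>_pos)
  have sub: "\<sigma>0 ` T \<subseteq> Y" "\<sigma>1 ` T \<subseteq> Y" by (auto simp: Y_def)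
  obtain E0 E1 P :: "ell2 bop" where E: "projection E0" "projection E1" "projection P"
    "E0 * E1 = 0" "E1 * E0 = 0" "(E0 + E1) * P = P"
    "P * E0 * P = (1/2) *\<^sub>C P" "P * E1 * P = (1/2) *\<^sub>C P" "P \<noteq> 0"
    using three_projections .
  have "two_copies n k (\<tau> \<sigma>0) (\<tau> \<sigma>1) (p ` (C \<inter> T)) E0 E1 P"
    using \<open>k < n\<close> \<open>1 \<le> k\<close> \<tau>_mono[OF mono(1) sub(1)] \<tau>_mono[OF mono(2) sub(2)]
      \<tau>_range[OF sub(1)] \<tau>_range[OF sub(2)] E agree p
    by unfold_locales (auto simp: \<tau>_def)
  moreover have "strict_mono_on {1..n} \<iota>" using \<iota>_mono by (auto intro: strict_mono_onI)
  then have "boolean_spreadable \<phi> n (\<lambda>m. x (\<iota> m))"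
    using spreadable by (simp add: boolean_spreadable_seq_def)
  moreover have "inj_on p T" by (rule inj_onI) (metis p(2) diff_add_cancel)
  ultimately show ?thesis
    using that p \<tau>_val[OF sub(1)] \<tau>_val[OF sub(2)] by blast
qed

lemma exists_left_translation:
  fixes T Z :: "int set"
  assumes "finite T" "finite Z"
  obtains N where "\<And>t z. t \<in> T \<Longrightarrow> z \<in> Z \<Longrightarrow> t - N < z"
proof -
  have "bdd_above T" "bdd_below Z" using assms by auto
  then obtain a b where "\<And>t. t \<in> T \<Longrightarrow> t \<le> a" "\<And>z. z \<in> Z \<Longrightarrow> b \<le> z"
    by (meson bdd_above.E bdd_below.E)
  then have "t - (a - b + 1) < z" if "t \<in> T" "z \<in> Z" for t z using that by fastforce
  then show ?thesis using that by blast
qed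

lemma mom_translate_left:
  assumes "strict_mono_on (set w) \<sigma>" "w \<noteq> []" "\<And>t t'. t \<in> set w \<Longrightarrow> t' \<in> set w \<Longrightarrow> t - N < \<sigma> t'"
  shows "mom (map (\<lambda>t. t - N) w) = mom (map \<sigma> w)"
proof -
  obtain n k \<iota> p \<tau>0 \<tau>1 E0 E1 P where tc: "two_copies n k \<tau>0 \<tau>1 (p ` (UNIV \<inter> set w)) E0 E1 P"
    and sp: "boolean_spreadable \<phi> n (\<lambda>m. x (\<iota> m))"
    and p: "\<And>t. t \<in> set w \<Longrightarrow> p t \<in> {1..k}" "\<And>t. t \<in> set w \<Longrightarrow> \<iota> (p t) = t - N"
    "\<And>t. t \<in> set w \<Longrightarrow> \<iota> (\<tau>0 (p t)) = \<sigma> t"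
    by (rule two_copies_of_int[of "set w" \<sigma> \<sigma> UNIV N]) (use assms in auto)
  interpret two_copies n k \<tau>0 \<tau>1 "p ` (UNIV \<inter> set w)" E0 E1 P by (rule tc)
  have "map (\<lambda>m. x (\<iota> m)) (map p w) = map x (map (\<lambda>t. t - N) w)"
    "map (\<lambda>m. x (\<iota> m)) (map \<tau>0 (map p w)) = map x (map \<sigma> w)"
    using p by auto
  moreover have "set (map p w) \<subseteq> p ` (UNIV \<inter> set w) \<inter> {1..k}" using p(1) by auto
  ultimately show ?thesis
    using moment_invariant[OF sp, of "map p w"] assms(2) by (simp only: mom_def map_is_Nil_conv simp_thms)
qed

text \<open>The two words cannot be compared directly, since one side of spreadability uses only an
  initial segment of the variables. Both are compared with one translate far to the left.\<close>

lemma mom_strict_mono: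
  assumes "strict_mono_on (set w) \<sigma>"
  shows "mom (map \<sigma> w) = mom w"
proof (cases "w = []")
  case False
  obtain N where N: "\<And>t z. t \<in> set w \<Longrightarrow> z \<in> set w \<union> \<sigma> ` set w \<Longrightarrow> t - N < z"
    using exists_left_translation[of "set w" "set w \<union> \<sigma> ` set w"] by auto
  have "mom (map (\<lambda>t. t - N) w) = mom (map \<sigma> w)"
    by (rule mom_translate_left[OF assms False]) (use N in auto)
  moreover have "mom (map (\<lambda>t. t - N) w) = mom (map (\<lambda>t. t) w)"
    by (rule mom_translate_left[OF _ False]) (use N in \<open>auto simp: strict_mono_on_def\<close>)
  ultimately show ?thesis by simp
qed simp

lemma mom_shift: "mom (shift d w) = mom w"
  unfolding shift_def by (rule mom_strict_mono) (auto simp: strict_mono_on_def)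

text \<open>The first copy is the identity, the second moves \<open>I\<close> and \<open>I'\<close>
  by \<open>d\<close> away from \<open>J\<close>, and \<open>C\<close> consists of the letters of
  \<open>J\<close>. Of the four moments in \<open>moment_average\<close>, the two in which
  \<open>I\<close> and \<open>I'\<close> use the same copy equal the original one by order
  invariance.\<close>

lemma mom_separate:
  assumes ne: "I \<noteq> []" "J \<noteq> []" "I' \<noteq> []"
    and far: "(\<forall>j\<in>set J. \<forall>i\<in>set I \<union> set I'. j < i) \<and> 0 \<le> d \<or>
      (\<forall>j\<in>set J. \<forall>i\<in>set I \<union> set I'. i < j) \<and> d \<le> 0"
  shows "2 * mom (I @ J @ I') = mom (I @ J @ shift d I') + mom (shift d I @ J @ I')"
  unfolding shift_def
proof -
  let ?sh = "\<lambda>d :: int. map (\<lambda>t. t + d)"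
  let ?T = "set I \<union> set J \<union> set I'"
  let ?\<sigma>0 = "\<lambda>t. t :: int"
  define \<sigma>1 where "\<sigma>1 t = (if t \<in> set J then t else t + d)" for t
  have disj: "set J \<inter> (set I \<union> set I') = {}" using far by fastforce
  have mono1: "strict_mono_on ?T \<sigma>1"
  proof (rule strict_mono_onI)
    fix r s assume rs: "r \<in> ?T" "s \<in> ?T" "r < s"
    show "\<sigma>1 r < \<sigma>1 s"
    proof (cases "r \<in> set J \<longleftrightarrow> s \<in> set J")
      case False
      then have "(r \<in> set J \<and> s \<in> set I \<union> set I') \<or> (s \<in> set J \<and> r \<in> set I \<union> set I')"
        using rs by blast
      then have "(r \<in> set J \<and> s \<notin> set J \<and> 0 \<le> d) \<or> (s \<in> set J \<and> r \<notin> set J \<and> d \<le> 0)"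
        using far disj rs(3) by (meson False order.asym)
      then show ?thesis using rs(3) by (auto simp: \<sigma>1_def)
    qed (use rs in \<open>auto simp: \<sigma>1_def\<close>)
  qed
  obtain N where N: "\<And>t z. t \<in> ?T \<Longrightarrow> z \<in> ?T \<union> \<sigma>1 ` ?T \<Longrightarrow> t - N < z"
    using exists_left_translation[of ?T "?T \<union> \<sigma>1 ` ?T"] by auto
  obtain n k \<iota> p \<tau>0 \<tau>1 E0 E1 P where tc: "two_copies n k \<tau>0 \<tau>1 (p ` (set J \<inter> ?T)) E0 E1 P"
    and sp: "boolean_spreadable \<phi> n (\<lambda>m. x (\<iota> m))"
    and p: "\<And>t. t \<in> ?T \<Longrightarrow> p t \<in> {1..k}" "inj_on p ?T" "\<And>t. t \<in> ?T \<Longrightarrow> \<iota> (p t) = t - N"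
    "\<And>t. t \<in> ?T \<Longrightarrow> \<iota> (\<tau>0 (p t)) = t" "\<And>t. t \<in> ?T \<Longrightarrow> \<iota> (\<tau>1 (p t)) = \<sigma>1 t"
  proof (rule two_copies_of_int[of ?T ?\<sigma>0 \<sigma>1 "set J" N])
    show "t = \<sigma>1 t" if "t \<in> set J" for t using that by (simp add: \<sigma>1_def)
  qed (use mono1 N ne in \<open>auto simp: strict_mono_on_def\<close>)
  interpret two_copies n k \<tau>0 \<tau>1 "p ` (set J \<inter> ?T)" E0 E1 P by (rule tc)
  have subs: "set (map p J) \<subseteq> p ` (set J \<inter> ?T) \<inter> {1..k}" using p(1) by auto
  have notC: "set (map p w) \<subseteq> {1..k} - p ` (set J \<inter> ?T)" if "set w \<subseteq> set I \<union> set I'" for w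
  proof -
    have "p a \<noteq> p b" if "a \<in> set I \<union> set I'" "b \<in> set J" for a b
      using that disj inj_onD[OF p(2), of a b] by blast
    then have "p a \<notin> p ` (set J \<inter> ?T)" if "a \<in> set w" for a
      using that \<open>set w \<subseteq> set I \<union> set I'\<close> by blast
    then show ?thesis using p(1) that by auto
  qed
  have a: "map (\<lambda>m. x (\<iota> m)) (map p w) = map x (?sh (- N) w)"
    "map (\<lambda>m. x (\<iota> m)) (map \<tau>0 (map p w)) = map x w" if "set w \<subseteq> ?T" for w
    using that p by (auto simp: subset_iff)
  have sub: "set I \<subseteq> ?T" "set J \<subseteq> ?T" "set I' \<subseteq> ?T" by auto
  have b: "map (\<lambda>m. x (\<iota> m)) (map \<tau>1 (map p w)) = map x (?sh d w)" if "set w \<subseteq> set I \<union> set I'" for w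
  proof -
    have "\<iota> (\<tau>1 (p t)) = t + d" if "t \<in> set w" for t
    proof -
      have "t \<in> set I \<union> set I'" using that \<open>set w \<subseteq> set I \<union> set I'\<close> by blast
      then show ?thesis using p(5)[of t] disj by (auto simp: \<sigma>1_def)
    qed
    then show ?thesis by simp
  qed
  have "4 * mom (?sh (- N) (I @ J @ I')) =
     mom (I @ J @ I') + mom (I @ J @ ?sh d I') + mom (?sh d I @ J @ I') + mom (?sh d I @ J @ ?sh d I')"
    using moment_average[OF sp, of "map p J" "map p I" "map p I'"] ne subs notC[of I] notC[of I']
      a[of I, OF sub(1)] a[of J, OF sub(2)] a[of I', OF sub(3)] b[of I] b[of I']
    by (simp add: mom_def del: map_map)
  moreover have "mom (?sh d I @ J @ ?sh d I') = mom (map \<sigma>1 (I @ J @ I'))"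
  proof -
    have "map \<sigma>1 J = J" by (rule map_idI) (simp add: \<sigma>1_def)
    moreover have "map \<sigma>1 I = ?sh d I" "map \<sigma>1 I' = ?sh d I'" using disj by (auto simp: \<sigma>1_def)
    ultimately show ?thesis by (simp only: map_append)
  qed
  moreover have "mom (map \<sigma>1 (I @ J @ I')) = mom (I @ J @ I')"
    using mono1 by (intro mom_strict_mono) (simp add: Un_assoc)
  ultimately have "4 * mom (I @ J @ I') =
      mom (I @ J @ I') + mom (I @ J @ ?sh d I') + mom (?sh d I @ J @ I') + mom (I @ J @ I')"
    by (simp only: mom_shift[unfolded shift_def])
  then show "2 * mom (I @ J @ I') = mom (I @ J @ ?sh d I') + mom (?sh d I @ J @ I')" by algebra
qed

end

section \<open>Words acting on the GNS space\<close>

text \<open>The supremum of the two image filters is a Cauchy filter, which gives one limit for both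
  sequences.\<close>

lemma common_limit:
  fixes a b :: "nat \<Rightarrow> complex"
  assumes "\<And>e. e > 0 \<Longrightarrow> \<exists>c. (\<forall>\<^sub>F n in sequentially. dist (a n) c < e) \<and> (\<forall>\<^sub>F n in sequentially. dist (b n) c < e)"
  obtains L where "a \<longlonglongrightarrow> L" "b \<longlonglongrightarrow> L"
proof -
  let ?F = "sup (filtermap a sequentially) (filtermap b sequentially)"
  have "cauchy_filter ?F"
    unfolding cauchy_filter_metric
  proof (intro allI impI)
    fix e :: real assume "0 < e"
    then obtain c where "\<forall>\<^sub>F n in sequentially. dist (a n) c < e / 2" "\<forall>\<^sub>F n in sequentially. dist (b n) c < e / 2"
      using assms[of "e / 2"] by auto
    then show "\<exists>P. eventually P ?F \<and> (\<forall>x y. P x \<and> P y \<longrightarrow> dist x y < e)"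
      by (intro exI[of _ "\<lambda>z. dist z c < e / 2"])
        (auto simp: eventually_sup eventually_filtermap dist_commute intro: dist_triangle_half_r)
  qed
  moreover have "?F \<noteq> bot" by (simp add: filtermap_bot_iff)
  ultimately obtain L where "?F \<le> nhds L"
    using cauchy_filter_complete_converges[OF _ complete_UNIV, of ?F] by auto
  then show ?thesis using that[of L] by (simp add: filterlim_def)
qed

text \<open>Bessel's inequality in effect: the sum of \<open>M\<close> of the vectors has squared
  norm at most \<open>M * B\<close>, yet its inner product with \<open>h\<close> is
  \<open>M * \<delta>\<close>.\<close>

lemma constant_inner_orthogonal_sequence:
  fixes \<Delta> :: "nat \<Rightarrow> 'a :: chilbert_space"
  assumes orth: "\<And>i j. i \<noteq> j \<Longrightarrow> cinner (\<Delta> i) (\<Delta> j) = 0" and bound: "\<And>i. (norm (\<Delta> i))\<^sup>2 \<le> B"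
    and const: "\<And>i. cinner (\<Delta> i) h = \<delta>"
  shows "\<delta> = 0"
proof (rule ccontr)
  assume "\<delta> \<noteq> 0"
  have le: "real M * (cmod \<delta>)\<^sup>2 \<le> B * (norm h)\<^sup>2" if "M > 0" for M
  proof -
    let ?S = "\<Sum>i<M. \<Delta> i"
    have "cinner ?S ?S = (\<Sum>i<M. cinner (\<Delta> i) (\<Delta> i))"
      unfolding cinner_sum_left cinner_sum_right
      by (intro sum.cong refl) (simp add: sum.remove[of "{..<M}"] orth)
    then have "(norm ?S)\<^sup>2 = (\<Sum>i<M. (norm (\<Delta> i))\<^sup>2)"
      unfolding Re_cinner_self[symmetric] by simp
    also have "\<dots> \<le> M * B" using sum_bounded_above[of "{..<M}" "\<lambda>i. (norm (\<Delta> i))\<^sup>2" B] bound by simp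
    finally have S: "(norm ?S)\<^sup>2 \<le> M * B" .
    have "cinner ?S h = M * \<delta>" unfolding cinner_sum_left by (simp add: const)
    then have "M * cmod \<delta> \<le> norm ?S * norm h"
      using complex_Cauchy_Schwarz[of ?S h] by (simp add: norm_mult)
    then have "(M * cmod \<delta>)\<^sup>2 \<le> (norm ?S * norm h)\<^sup>2" by (intro power_mono) auto
    also have "\<dots> \<le> (M * B) * (norm h)\<^sup>2" unfolding power_mult_distrib by (intro mult_right_mono S) auto
    finally have "M * (M * (cmod \<delta>)\<^sup>2) \<le> M * (B * (norm h)\<^sup>2)" by (simp add: power_mult_distrib power2_eq_square ac_simps)
    then show ?thesis using that by simp
  qed
  have "(cmod \<delta>)\<^sup>2 > 0" using \<open>\<delta> \<noteq> 0\<close> by simp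
  then obtain M :: nat where "B * (norm h)\<^sup>2 < M * (cmod \<delta>)\<^sup>2" using reals_Archimedean3 by blast
  then have "B * (norm h)\<^sup>2 < Suc M * (cmod \<delta>)\<^sup>2" using \<open>(cmod \<delta>)\<^sup>2 > 0\<close>
    unfolding of_nat_Suc distrib_right by linarith
  with le[of "Suc M"] show False by simp
qed

section \<open>Moving blocks of letters towards either end\<close>

context spreadable_moments
begin

text \<open>The sign \<open>s\<close> selects an end of the integers, so that
  \<open>s * t < s * t'\<close> says that \<open>t'\<close> is nearer to that end. Moving the outer
  letters further out keeps the order.\<close>

lemma mom_move:
  assumes s: "s \<in> {1, - 1 :: int}" "0 \<le> s * d"
    and far: "\<And>t t'. t \<in> set w \<Longrightarrow> t' \<in> set w \<Longrightarrow> t \<notin> S \<Longrightarrow> t' \<in> S \<Longrightarrow> s * t < s * t'"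
  shows "mom (map (\<lambda>t. if t \<in> S then t + d else t) w) = mom w"
proof (rule mom_strict_mono, rule strict_mono_onI)
  fix r r' assume r: "r \<in> set w" "r' \<in> set w" "r < r'"
  then show "(if r \<in> S then r + d else r) < (if r' \<in> S then r' + d else r')"
    using far[of r r'] far[of r' r] s by (cases "r \<in> S"; cases "r' \<in> S") auto
qed

lemma mom_move_segment:
  assumes s: "s \<in> {1, - 1 :: int}" "0 \<le> s * d"
    and far: "\<And>t t'. t \<in> set u \<Longrightarrow> t' \<in> set v \<Longrightarrow> s * t < s * t'"
  shows "mom (u @ shift d v) = mom (u @ v)" "mom (shift d v @ u) = mom (v @ u)"
proof -
  let ?\<sigma> = "\<lambda>t. if t \<in> set v then t + d else t"
  have "map ?\<sigma> v = shift d v" by (auto simp: shift_def)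
  moreover have "map ?\<sigma> u = u" using far by (intro map_idI) auto
  moreover have "mom (map ?\<sigma> (u @ v)) = mom (u @ v)" "mom (map ?\<sigma> (v @ u)) = mom (v @ u)"
    by (intro mom_move[OF s]; use far in auto)+
  ultimately show "mom (u @ shift d v) = mom (u @ v)" "mom (shift d v @ u) = mom (v @ u)"
    by (simp_all only: map_append)
qed

lemma mom_separate_signed:
  assumes s: "s \<in> {1, - 1 :: int}" "0 \<le> s * d" and J: "J \<noteq> []"
    and far: "\<And>j i. j \<in> set J \<Longrightarrow> i \<in> set I \<union> set I' \<Longrightarrow> s * j < s * i"
  shows "2 * mom (I @ J @ I') = mom (I @ J @ shift d I') + mom (shift d I @ J @ I')"
proof -
  consider "I = []" | "I' = []" | "I \<noteq> []" "I' \<noteq> []" by blast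
  then show ?thesis
  proof cases
    case 1
    then show ?thesis using mom_move_segment(1)[OF s, of J I'] far by auto
  next
    case 2
    then show ?thesis using mom_move_segment(2)[OF s, of J I] far by auto
  next
    case 3
    show ?thesis by (rule mom_separate[OF 3(1) J 3(2)]) (use s far in auto)
  qed
qed

text \<open>For \<open>s = 1\<close> or \<open>s = - 1\<close>, translating \<open>v\<close> by
  \<open>s * D\<close> puts all of it beyond \<open>u\<close> in the direction
  \<open>s\<close>.\<close>

lemma exists_signed_bound:
  fixes s :: int
  obtains D :: int where "0 < D" "\<And>t t'. t \<in> set u \<Longrightarrow> t' \<in> set v \<Longrightarrow> s * t < s * t' + D"
proof -
  let ?S = "(\<lambda>(t, t'). \<bar>s * t - s * t'\<bar>) ` (set u \<times> set v)"
  have "bdd_above ?S" by (rule bdd_above_finite) auto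
  then obtain B where B: "\<And>z. z \<in> ?S \<Longrightarrow> z \<le> B" by (meson bdd_above.E)
  show ?thesis
  proof (rule that[of "\<bar>B\<bar> + 1"])
    fix t t' assume "t \<in> set u" "t' \<in> set v"
    then have "\<bar>s * t - s * t'\<bar> \<le> B" by (intro B) (auto intro: image_eqI[of _ _ "(t, t')"])
    then show "s * t < s * t' + (\<bar>B\<bar> + 1)" by linarith
  qed simp
qed

end

section \<open>Word vectors and their translates\<close>

locale boolean_tail = gns_normal A \<phi> \<pi> \<Omega> + spreadable_moments \<phi> x
  for A :: "'k :: chilbert_space bop set" and \<phi> :: "'k bop \<Rightarrow> complex"
    and \<pi> :: "'k bop \<Rightarrow> 'h :: chilbert_space bop" and \<Omega> :: 'h and x :: "int \<Rightarrow> 'k bop" +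
  assumes x_selfadjoint: "\<And>i. selfadjoint (x i)" and generated: "A = vn_generated (range x)"
begin

lemma x_in_A: "x i \<in> A"
  unfolding generated vn_generated_def by blast

definition X :: "int list \<Rightarrow> 'k bop" where "X w = prod_list (map x w)"
definition Y :: "int list \<Rightarrow> 'h bop" where "Y w = \<pi> (X w)"
definition vec :: "int list \<Rightarrow> 'h" where "vec w = app (Y w) \<Omega>"

lemma X_in_A: "X w \<in> A"
  by (induction w) (auto simp: X_def intro: A_intros x_in_A)

lemma Y_append: "Y (v @ w) = Y v * Y w"
  using pi_mult[OF X_in_A X_in_A, of v w] by (simp add: Y_def X_def)

lemma Y_vec: "app (Y v) (vec w) = vec (v @ w)"
  by (simp add: vec_def Y_append app_times)

lemma vec_Nil: "vec [] = \<Omega>"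
  by (simp add: vec_def Y_def X_def pi_one)

lemma is_adjoint_X: "is_adjoint (X w) (X (rev w))"
proof (induction w)
  case Nil
  then show ?case by (simp add: X_def is_adjoint_def)
next
  case (Cons i w)
  then show ?case
    using selfadjointD[OF x_selfadjoint[of i]] by (simp add: X_def is_adjoint_def app_times)
qed

lemma Y_adjoint: "cinner (app (Y w) \<xi>) \<eta> = cinner \<xi> (app (Y (rev w)) \<eta>)"
  unfolding Y_def by (rule is_adjointD[OF pi_adjoint[OF X_in_A X_in_A is_adjoint_X]])

lemma cinner_vec: "cinner (vec v) (vec w) = mom (rev w @ v)"
proof -
  have "cinner (vec v) (vec w) = cinner (vec (rev w @ v)) \<Omega>"
    using Y_adjoint[of "rev w" "vec v" \<Omega>] by (simp add: Y_vec) (simp add: vec_def)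
  also have "\<dots> = mom (rev w @ v)"
    using phi_eq[OF X_in_A, of "rev w @ v"] unfolding vec_def Y_def mom_def X_def by simp
  finally show ?thesis .
qed

lemma mom_rev: "mom (rev w) = cnj (mom w)"
proof -
  have "mom (rev w) = cinner (vec []) (vec w)" "mom w = cinner (vec w) (vec [])"
    by (simp_all add: cinner_vec)
  then show ?thesis by (metis cinner_commute)
qed

lemma cinner_vec_shift: "cinner (vec (shift d v)) (vec (shift d w)) = cinner (vec v) (vec w)"
proof -
  have "rev (shift d w) @ shift d v = shift d (rev w @ v)" by simp
  then show ?thesis unfolding cinner_vec using mom_shift by metis
qed

text \<open>Formal combinations, because translation acts on words. That it descends to an isometry
  on vectors is the content of \<open>cinner_comb_shift\<close> and
  \<open>norm_comb\<close>.\<close>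

definition comb :: "int \<Rightarrow> (complex \<times> int list) list \<Rightarrow> 'h" where
  "comb d f = sum_list (map (\<lambda>(c, w). c *\<^sub>C vec (shift d w)) f)"

lemma comb_simps:
  "comb d [] = 0" "comb d ((c, w) # f) = c *\<^sub>C vec (shift d w) + comb d f"
  "comb d (f @ g) = comb d f + comb d g" "c *\<^sub>C comb d f = comb d (map (\<lambda>(c', w). (c * c', w)) f)"
proof -
  show "c *\<^sub>C comb d f = comb d (map (\<lambda>(c', w). (c * c', w)) f)"
    unfolding comb_def by (induction f) (auto simp: scaleC_add_right scaleC_scaleC)
qed (simp_all add: comb_def)

lemma cinner_comb_shift: "cinner (comb d f) (comb d g) = cinner (comb 0 f) (comb 0 g)"
proof (induction f)
  case Nil
  then show ?case by (simp add: comb_simps)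
next
  case (Cons cw f)
  obtain c w where cw: "cw = (c, w)" by (cases cw)
  have "cinner (vec (shift d w)) (comb d g) = cinner (vec (shift 0 w)) (comb 0 g)"
  proof (induction g)
    case (Cons c'w' g)
    then show ?case
      by (cases c'w') (simp add: comb_simps cinner_add_right cinner_scaleC_right cinner_vec_shift)
  qed (simp add: comb_simps)
  then show ?case using Cons by (simp add: cw comb_simps cinner_add_left cinner_scaleC_left)
qed

lemma norm_comb: "norm (comb d f) = norm (comb 0 f)"
  using cinner_comb_shift[of d f f] by (simp add: cinner_self flip: of_real_power)

lemma norm_vec_shift: "norm (vec (shift d w)) = norm (vec w)"
  using cinner_vec_shift[of d w w] by (simp add: cinner_self flip: of_real_power)

lemma closure_comb: "closure (range (comb 0)) = UNIV"
proof (rule invariant_subspace_of_generators[OF generated])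
  have "csubspace (range (comb 0))"
    unfolding csubspace_def
  proof (intro conjI ballI allI)
    show "0 \<in> range (comb 0)" by (metis comb_simps(1) rangeI)
    show "a + b \<in> range (comb 0)" if "a \<in> range (comb 0)" "b \<in> range (comb 0)" for a b
      using that unfolding image_iff by (auto simp flip: comb_simps(3))
    show "c *\<^sub>C a \<in> range (comb 0)" if "a \<in> range (comb 0)" for a c
      using that unfolding image_iff by (auto simp: comb_simps(4))
  qed
  then show "csubspace (closure (range (comb 0)))" by (rule csubspace_closure)
  have "\<Omega> = comb 0 [(1, [])]" by (simp add: comb_simps scaleC_one vec_Nil)
  then have "\<Omega> \<in> range (comb 0)" by (rule range_eqI)
  then show "\<Omega> \<in> closure (range (comb 0))" by (rule subsetD[OF closure_subset])
  fix y v assume y: "y \<in> range x" and v: "v \<in> closure (range (comb 0))"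
  obtain i where i: "y = x i" using y by blast
  have "app (\<pi> (x i)) (comb 0 f) = comb 0 (map (\<lambda>(c, w). (c, i # w)) f)" for f
  proof (induction f)
    case (Cons cw f)
    have "app (\<pi> (x i)) (vec w) = vec (i # w)" for w
      using Y_vec[of "[i]" w] by (simp add: Y_def X_def)
    with Cons show ?case by (cases cw) (simp add: comb_simps app_simps)
  qed (simp add: comb_simps)
  then have inv: "app (\<pi> (x i)) a \<in> range (comb 0)" if "a \<in> range (comb 0)" for a using that by auto
  obtain f where "\<And>n. f n \<in> range (comb 0)" "f \<longlonglongrightarrow> v" using v by (auto simp: closure_sequential)
  then show "app (\<pi> y) v \<in> closure (range (comb 0))"
    unfolding i closure_sequential using inv
    by (intro exI[of _ "\<lambda>n. app (\<pi> (x i)) (f n)"]) (auto intro!: tendsto_intros)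
qed (use x_selfadjoint in auto)

lemma vec_dense_induct:
  assumes "closed {h. P h}" "\<And>h h'. P h \<Longrightarrow> P h' \<Longrightarrow> P (h + h')" "\<And>c h. P h \<Longrightarrow> P (c *\<^sub>C h)"
    and "\<And>w. P (vec w)"
  shows "P h"
proof -
  have "P 0" using assms(3)[OF assms(4), of 0] by simp
  have "P (comb 0 f)" for f
  proof (induction f)
    case (Cons cw f)
    then show ?case by (cases cw) (auto simp: comb_simps intro: assms)
  qed (simp add: comb_simps \<open>P 0\<close>)
  then have "closure (range (comb 0)) \<subseteq> {h. P h}" using assms(1) by (intro closure_minimal) auto
  then show ?thesis using closure_comb by auto
qed

lemma comb_approx:
  assumes "e > 0" obtains f where "norm (h - comb 0 f) < e"
proof -
  have "h \<in> closure (range (comb 0))" using closure_comb by simp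
  then obtain f where "dist (comb 0 f) h < e" using assms by (auto simp: closure_approachable)
  then show ?thesis using that[of f] by (simp add: dist_norm norm_minus_commute)
qed

lemma vec_ext:
  assumes "\<And>w. cinner (vec w) h = cinner (vec w) h'" shows "h = h'"
proof (rule cinner_eqI_right)
  show "cinner z h = cinner z h'" for z
    by (rule vec_dense_induct[of "\<lambda>z. cinner z h = cinner z h'"])
      (auto simp: assms cinner_add_left cinner_scaleC_left intro!: closed_Collect_eq continuous_intros)
qed

lemma bop_vec_ext:
  assumes "\<And>v w. cinner (app a (vec v)) (vec w) = cinner (app b (vec v)) (vec w)" shows "a = b"
proof (rule bop_eqI)
  have eq: "app a (vec v) = app b (vec v)" for v
    by (rule vec_ext) (metis assms cinner_commute)
  show "app a h = app b h" for h
    by (rule vec_dense_induct[of "\<lambda>h. app a h = app b h"])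
      (auto simp: eq app_simps intro!: closed_Collect_eq continuous_intros)
qed

section \<open>The projection onto the shift-invariant vectors\<close>

text \<open>Copies of \<open>v\<close> are placed ever further out on both sides of
  \<open>u\<close>. The inner product of \<open>vec (rev u)\<close> with the difference of the two
  outermost copies is always the same number, so orthogonality of the differences forces it to be
  0.\<close>

lemma mom_flip:
  assumes up: "\<And>t t'. t \<in> set u \<Longrightarrow> t' \<in> set v \<Longrightarrow> t < t' + a"
    and down: "\<And>t t'. t \<in> set u \<Longrightarrow> t' \<in> set v \<Longrightarrow> t' + b < t"
  shows "mom (u @ shift a v) = mom (u @ shift b v)"
proof (cases "u = [] \<or> v = []")
  case True
  then show ?thesis using mom_shift[of a v] mom_shift[of b v] by auto
next
  case False
  then obtain t t' where "t \<in> set u" "t' \<in> set v" by (meson list.set_sel(1))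
  then have ab: "b < a" using up down by force
  obtain D :: int where D: "0 < D" "\<And>t t'. t \<in> set v \<Longrightarrow> t' \<in> set v \<Longrightarrow> 1 * t < 1 * t' + D"
    using exists_signed_bound[of v v 1] by blast
  define \<xi> where "\<xi> p = vec (shift p v)" for p
  \<comment> \<open>The inner product of two copies of \<open>v\<close> at distance at least
    \<open>D\<close> is \<open>g\<close> or its conjugate, according to which one lies
    higher.\<close>
  define g where "g = cinner (\<xi> D) (\<xi> 0)"
  have g: "cinner (\<xi> p) (\<xi> q) = g" if "q + D \<le> p" for p q
  proof -
    have "cinner (\<xi> p) (\<xi> q) = cinner (vec (shift q (shift (p - q) v))) (vec (shift q v))"
      by (simp add: \<xi>_def)
    also have "\<dots> = mom (rev v @ shift (p - q) v)" by (subst cinner_vec_shift) (rule cinner_vec)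
    also have "shift (p - q) v = shift (p - q - D) (shift D v)" by simp
    also have "mom (rev v @ \<dots>) = mom (rev v @ shift D v)"
      by (rule mom_move_segment(1)[of 1]) (use that D in auto)
    also have "\<dots> = g" by (simp add: g_def \<xi>_def cinner_vec)
    finally show ?thesis .
  qed
  have g': "cinner (\<xi> p) (\<xi> q) = cnj g" if "p + D \<le> q" for p q
    using g[OF that] by (metis cinner_commute)
  \<comment> \<open>The upper copy of either index lies above the lower copy of the other, so among
    the four inner products of two differences \<open>g\<close> and its conjugate each occur twice
    with opposite signs.\<close>
  define \<Delta> where "\<Delta> i = \<xi> (a + int i * D) - \<xi> (b - int i * D)" for i
  have sep: "int j * D + D \<le> int i * D" if "j < i" for i j
  proof -
    have "(int j + 1) * D \<le> int i * D" using that D(1) by (intro mult_right_mono) auto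
    then show ?thesis by (simp add: distrib_right)
  qed
  have nn: "0 \<le> int i * D" for i using D(1) by simp
  have "mom (u @ shift a v) - mom (u @ shift b v) = 0"
  proof (rule constant_inner_orthogonal_sequence)
    fix i j :: nat assume "i \<noteq> j"
    then consider "j < i" | "i < j" by linarith
    then show "cinner (\<Delta> i) (\<Delta> j) = 0"
    proof cases
      case 1
      have "cinner (\<xi> (a + int i * D)) (\<xi> (a + int j * D)) = g"
        "cinner (\<xi> (a + int i * D)) (\<xi> (b - int j * D)) = g"
        "cinner (\<xi> (b - int i * D)) (\<xi> (a + int j * D)) = cnj g"
        "cinner (\<xi> (b - int i * D)) (\<xi> (b - int j * D)) = cnj g"
        using sep[OF 1] nn[of i] nn[of j] ab by (intro g g'; linarith)+
      then show ?thesis by (simp add: \<Delta>_def cinner_diff_left cinner_diff_right)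
    next
      case 2
      have "cinner (\<xi> (a + int i * D)) (\<xi> (a + int j * D)) = cnj g"
        "cinner (\<xi> (a + int i * D)) (\<xi> (b - int j * D)) = g"
        "cinner (\<xi> (b - int i * D)) (\<xi> (a + int j * D)) = cnj g"
        "cinner (\<xi> (b - int i * D)) (\<xi> (b - int j * D)) = g"
        using sep[OF 2] nn[of i] nn[of j] ab by (intro g g'; linarith)+
      then show ?thesis by (simp add: \<Delta>_def cinner_diff_left cinner_diff_right)
    qed
  next
    fix i
    have "norm (\<Delta> i) \<le> norm (vec v) + norm (vec v)"
      unfolding \<Delta>_def \<xi>_def by (rule order_trans[OF norm_triangle_ineq4]) (simp add: norm_vec_shift)
    then show "(norm (\<Delta> i))\<^sup>2 \<le> (norm (vec v) + norm (vec v))\<^sup>2" by (intro power_mono) auto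
    have "shift (a + int i * D) v = shift (int i * D) (shift a v)"
      "shift (b - int i * D) v = shift (- int i * D) (shift b v)" by (simp_all add: algebra_simps)
    moreover have "mom (u @ shift (int i * D) (shift a v)) = mom (u @ shift a v)"
      by (rule mom_move_segment(1)[of 1]) (use nn up in auto)
    moreover have "mom (u @ shift (- int i * D) (shift b v)) = mom (u @ shift b v)"
      by (rule mom_move_segment(1)[of "- 1"]) (use nn down in auto)
    ultimately show "cinner (\<Delta> i) (vec (rev u)) = mom (u @ shift a v) - mom (u @ shift b v)"
      by (simp only: \<Delta>_def \<xi>_def cinner_diff_left cinner_vec rev_rev_ident)
  qed
  then show ?thesis by simp
qed

text \<open>Once \<open>v\<close> has left the range of \<open>w\<close>, only the side on which it
  lies could matter, and \<open>mom_flip\<close> identifies the sides.\<close>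

lemma cinner_vec_eventually_const:
  obtains c where
    "\<And>s. s \<in> {1, - 1} \<Longrightarrow> \<forall>\<^sub>F n in sequentially. cinner (vec (shift (s * int n) v)) (vec w) = c"
proof -
  obtain D :: int where D: "0 < D" "\<And>t t'. t \<in> set w \<Longrightarrow> t' \<in> set v \<Longrightarrow> 1 * t < 1 * t' + D"
    using exists_signed_bound[of w v 1] by blast
  obtain D' :: int where D': "0 < D'" "\<And>t t'. t \<in> set v \<Longrightarrow> t' \<in> set w \<Longrightarrow> 1 * t < 1 * t' + D'"
    using exists_signed_bound[of v w 1] by blast
  have "cinner (vec (shift (s * int n) v)) (vec w) = mom (rev w @ shift D v)"
    if s: "s \<in> {1, - 1}" and n: "int n \<ge> D + D'" for s n
  proof -
    have up: "t < t' + (D + d)" "t' + (- D' - d) < t" if "t \<in> set w" "t' \<in> set v" "0 \<le> d" for t t' d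
      using D D' that by (simp, force)+
    have "mom (rev w @ shift (s * int n) v) = mom (rev w @ shift D v)"
    proof (cases "s = 1")
      case True
      have "shift (s * int n) v = shift (int n - D) (shift D v)" using True by simp
      moreover have "mom (rev w @ shift (int n - D) (shift D v)) = mom (rev w @ shift D v)"
        by (rule mom_move_segment(1)[of 1]) (use n D' up[of _ _ 0] in auto)
      ultimately show ?thesis by (simp only:)
    next
      case False
      then have s: "s = - 1" using s by simp
      show ?thesis unfolding s
        by (rule mom_flip[symmetric]) (use up[of _ _ 0] up[of _ _ "int n - D'"] n D in auto)
    qed
    then show ?thesis by (simp add: cinner_vec)
  qed
  then have "\<forall>\<^sub>F n in sequentially. cinner (vec (shift (s * int n) v)) (vec w) = mom (rev w @ shift D v)"
    if "s \<in> {1, - 1}" for s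
    using that unfolding eventually_sequentially by (intro exI[of _ "nat (D + D')"]) auto
  then show ?thesis using that by blast
qed

lemma cinner_vec_limit:
  obtains L where
    "\<And>s. s \<in> {1, - 1} \<Longrightarrow> (\<lambda>n. cinner (vec (shift (s * int n) v)) h) \<longlonglongrightarrow> L"
proof -
  have const: "\<exists>c. \<forall>s\<in>{1, - 1}. \<forall>\<^sub>F n in sequentially. cinner (vec (shift (s * int n) v)) (comb 0 f) = c" for f
  proof (induction f)
    case Nil
    then show ?case by (simp add: comb_simps)
  next
    case (Cons cw f)
    obtain c w where cw: "cw = (c, w)" by (cases cw)
    obtain a where a: "\<forall>s\<in>{1, - 1}. \<forall>\<^sub>F n in sequentially. cinner (vec (shift (s * int n) v)) (comb 0 f) = a"
      using Cons by blast
    obtain b where b: "\<And>s. s \<in> {1, - 1} \<Longrightarrow> \<forall>\<^sub>F n in sequentially. cinner (vec (shift (s * int n) v)) (vec w) = b"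
      using cinner_vec_eventually_const[of v w] by blast
    have "\<forall>\<^sub>F n in sequentially. cinner (vec (shift (s * int n) v)) (comb 0 (cw # f)) = cnj c * b + a"
      if "s \<in> {1, - 1}" for s
      using eventually_conj[OF a[rule_format, OF that] b[OF that]]
      by (rule eventually_mono) (simp add: cw comb_simps cinner_add_right cinner_scaleC_right)
    then show ?case by blast
  qed
  define z where "z s n = cinner (vec (shift (s * int n) v)) h" for s n
  obtain L where "z 1 \<longlonglongrightarrow> L" "z (- 1) \<longlonglongrightarrow> L"
  proof (rule common_limit)
    fix e :: real assume "0 < e"
    define M where "M = norm (vec v) + 1"
    have "M > 0" by (simp add: M_def add_nonneg_pos)
    then obtain f where f: "norm (h - comb 0 f) < e / M" using comb_approx[of "e / M"] \<open>0 < e\<close> by auto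
    obtain c where c: "\<And>s. s \<in> {1, - 1} \<Longrightarrow> \<forall>\<^sub>F n in sequentially. cinner (vec (shift (s * int n) v)) (comb 0 f) = c"
      using const by blast
    have "dist (z s n) (cinner (vec (shift (s * int n) v)) (comb 0 f)) < e" for s n
    proof -
      have "dist (z s n) (cinner (vec (shift (s * int n) v)) (comb 0 f)) =
          cmod (cinner (vec (shift (s * int n) v)) (h - comb 0 f))"
        by (simp add: z_def dist_norm cinner_diff_right)
      also have "\<dots> \<le> norm (vec v) * norm (h - comb 0 f)"
        using complex_Cauchy_Schwarz[of "vec (shift (s * int n) v)" "h - comb 0 f"] by (simp only: norm_vec_shift)
      also have "\<dots> \<le> M * norm (h - comb 0 f)" by (intro mult_right_mono) (auto simp: M_def)
      also have "\<dots> < e" using f \<open>M > 0\<close> by (simp add: field_simps)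
      finally show ?thesis .
    qed
    then have "\<forall>\<^sub>F n in sequentially. dist (z s n) c < e" if "s \<in> {1, - 1}" for s
      using c[OF that] by (auto elim: eventually_mono)
    then show "\<exists>c. (\<forall>\<^sub>F n in sequentially. dist (z 1 n) c < e) \<and> (\<forall>\<^sub>F n in sequentially. dist (z (- 1) n) c < e)"
      by blast
  qed
  then show ?thesis using that[of L] unfolding z_def by blast
qed

text \<open>The limit is a functional of the formal combination, bounded because translation
  preserves norms; the Riesz theorem is applied to its graph.\<close>

lemma exists_weak_limit:
  "\<exists>w. \<forall>v. \<forall>s\<in>{1, - 1}. (\<lambda>n. cinner (vec (shift (s * int n) v)) h) \<longlonglongrightarrow> cinner (vec v) w"
proof -
  define G where "G = {(comb 0 f, L) | f L. (\<lambda>n. cinner (comb (int n) f) h) \<longlonglongrightarrow> L}"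
  obtain w where w: "\<And>v z. (v, z) \<in> G \<Longrightarrow> z = cinner v w"
  proof (rule Riesz_graph[of G "norm h"])
    show "(0, 0) \<in> G" unfolding G_def
      by (rule CollectI, rule exI[of _ "[]"]) (simp add: comb_simps)
    fix v z v' z' c
    assume "(v, z) \<in> G"
    then obtain f where f: "v = comb 0 f" "(\<lambda>n. cinner (comb (int n) f) h) \<longlonglongrightarrow> z" by (auto simp: G_def)
    show "cmod z \<le> norm h * norm v"
    proof (rule LIMSEQ_le_const2[OF tendsto_norm[OF f(2)]])
      have "cmod (cinner (comb (int n) f) h) \<le> norm h * norm v" for n
        using complex_Cauchy_Schwarz[of "comb (int n) f" h] by (simp add: f(1) norm_comb[of "int n"] mult.commute)
      then show "\<exists>N. \<forall>n\<ge>N. cmod (cinner (comb (int n) f) h) \<le> norm h * norm v" by blast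
    qed
    have "(\<lambda>n. cinner (c *\<^sub>C comb (int n) f) h) \<longlonglongrightarrow> c * z"
      unfolding cinner_scaleC_left by (intro tendsto_intros f)
    then show "(c *\<^sub>C v, c * z) \<in> G" unfolding G_def f(1) comb_simps(4) by blast
    assume "(v', z') \<in> G"
    then obtain g where g: "v' = comb 0 g" "(\<lambda>n. cinner (comb (int n) g) h) \<longlonglongrightarrow> z'" by (auto simp: G_def)
    have "(\<lambda>n. cinner (comb (int n) f + comb (int n) g) h) \<longlonglongrightarrow> z + z'"
      unfolding cinner_add_left by (intro tendsto_intros f g)
    then show "(v + v', z + z') \<in> G" unfolding G_def f(1) g(1) comb_simps(3)[symmetric] by blast
  qed blast
  have "(\<lambda>n. cinner (vec (shift (s * int n) v)) h) \<longlonglongrightarrow> cinner (vec v) w" if s: "s \<in> {1, - 1}" for v s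
  proof -
    obtain L where L: "\<And>s. s \<in> {1, - 1} \<Longrightarrow> (\<lambda>n. cinner (vec (shift (s * int n) v)) h) \<longlonglongrightarrow> L"
      using cinner_vec_limit[of v h] by blast
    have "comb d [(1, v)] = vec (shift d v)" for d by (simp add: comb_simps scaleC_one)
    then have "(vec (shift 0 v), L) \<in> G"
      unfolding G_def using L[of 1] by (intro CollectI exI[of _ "[(1, v)]"] exI[of _ L]) simp
    from w[OF this] show ?thesis using L[OF s] by simp
  qed
  then show ?thesis by blast
qed

text \<open>Introduced through pairings with translated vectors, which is what the Riesz theorem
  provides. Only with \<open>F_symmetric\<close> does it become the weak limit of the translates
  themselves.\<close>

definition F :: "'h \<Rightarrow> 'h" where
  "F h = (SOME w. \<forall>v. \<forall>s\<in>{1, - 1}. (\<lambda>n. cinner (vec (shift (s * int n) v)) h) \<longlonglongrightarrow> cinner (vec v) w)"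

lemma F_limit:
  assumes "s \<in> {1, - 1}"
  shows "(\<lambda>n. cinner (vec (shift (s * int n) v)) h) \<longlonglongrightarrow> cinner (vec v) (F h)"
  using someI_ex[OF exists_weak_limit[of h]] assms unfolding F_def by blast

lemma F_add: "F (h + h') = F h + F h'"
proof (rule vec_ext)
  fix v
  have "(\<lambda>n. cinner (vec (shift (1 * int n) v)) (h + h')) \<longlonglongrightarrow> cinner (vec v) (F h + F h')"
    unfolding cinner_add_right by (intro tendsto_intros F_limit) auto
  then show "cinner (vec v) (F (h + h')) = cinner (vec v) (F h + F h')"
    using F_limit[of 1 v "h + h'"] LIMSEQ_unique by blast
qed

lemma F_scale: "F (c *\<^sub>C h) = c *\<^sub>C F h"
proof (rule vec_ext)
  fix v
  have "(\<lambda>n. cinner (vec (shift (1 * int n) v)) (c *\<^sub>C h)) \<longlonglongrightarrow> cinner (vec v) (c *\<^sub>C F h)"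
    unfolding cinner_scaleC_right by (intro tendsto_intros F_limit) auto
  then show "cinner (vec v) (F (c *\<^sub>C h)) = cinner (vec v) (c *\<^sub>C F h)"
    using F_limit[of 1 v "c *\<^sub>C h"] LIMSEQ_unique by blast
qed

lemma F_norm: "norm (F h) \<le> norm h"
proof (rule norm_le_if_cinner_bounded[of _ "range (comb 0)"])
  show "F h \<in> closure (range (comb 0))" using closure_comb by simp
  fix v assume "v \<in> range (comb 0)"
  then obtain f where f: "v = comb 0 f" by blast
  have lim: "(\<lambda>n. cinner (comb (int n) f) h) \<longlonglongrightarrow> cinner (comb 0 f) (F h)" for f
  proof (induction f)
    case (Cons cw f)
    obtain c w where cw: "cw = (c, w)" by (cases cw)
    show ?case unfolding cw comb_simps cinner_add_left cinner_scaleC_left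
      using F_limit[of 1 w h] by (intro tendsto_add tendsto_mult_left Cons) simp
  qed (simp add: comb_simps)
  have "cmod (cinner (comb 0 f) (F h)) \<le> norm h * norm v"
  proof (rule LIMSEQ_le_const2[OF tendsto_norm[OF lim]])
    have "cmod (cinner (comb (int n) f) h) \<le> norm h * norm v" for n
      using complex_Cauchy_Schwarz[of "comb (int n) f" h] by (simp add: f norm_comb[of "int n"] mult.commute)
    then show "\<exists>N. \<forall>n\<ge>N. cmod (cinner (comb (int n) f) h) \<le> norm h * norm v" by blast
  qed
  then show "cmod (cinner v (F h)) \<le> norm h * norm v" by (simp add: f)
qed simp

definition Fop :: "'h bop" where "Fop = Bop F"

lemma app_Fop: "app Fop h = F h"
proof -
  have "app Fop = F" unfolding Fop_def
    by (rule app_Bop[of _ 1]) (simp_all add: F_add F_scale F_norm)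
  then show ?thesis by simp
qed

text \<open>Translating one vector to the right amounts, inside an inner product, to translating the
  other to the left. So symmetry is the agreement of the limits at the two ends.\<close>

lemma F_symmetric: "cinner (F h) h' = cinner h (F h')"
proof -
  have vv: "cinner (vec v) (F (vec u)) = cinner (F (vec v)) (vec u)" for u v
  proof -
    have "(\<lambda>n. cnj (cinner (vec (shift (- 1 * int n) u)) (vec v))) \<longlonglongrightarrow> cnj (cinner (vec u) (F (vec v)))"
      by (intro tendsto_intros F_limit) auto
    moreover have "cnj (cinner (vec (shift (- 1 * int n) u)) (vec v)) = cinner (vec (shift (1 * int n) v)) (vec u)" for n
    proof -
      have "cinner (vec (shift (int n) v)) (vec (shift (int n) (shift (- int n) u))) = cinner (vec v) (vec (shift (- int n) u))"
        by (rule cinner_vec_shift)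
      moreover have "shift (int n) (shift (- int n) u) = u" by simp
      ultimately show ?thesis by (simp flip: cinner_commute)
    qed
    ultimately have "(\<lambda>n. cinner (vec (shift (1 * int n) v)) (vec u)) \<longlonglongrightarrow> cnj (cinner (vec u) (F (vec v)))" by simp
    with F_limit[of 1 v "vec u"] show ?thesis using LIMSEQ_unique by (metis cinner_commute insertI1)
  qed
  have vh: "cinner (vec v) (F h) = cinner (F (vec v)) h" for v h
  proof (rule vec_dense_induct[of "\<lambda>h. cinner (vec v) (F h) = cinner (F (vec v)) h"])
    show "closed {h. cinner (vec v) (F h) = cinner (F (vec v)) h}"
      unfolding app_Fop[symmetric] by (intro closed_Collect_eq continuous_intros)
  qed (auto simp: vv F_add F_scale cinner_add_right cinner_scaleC_right)
  show ?thesis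
  proof (rule vec_dense_induct[of "\<lambda>h. cinner (F h) h' = cinner h (F h')"])
    show "closed {h. cinner (F h) h' = cinner h (F h')}"
      unfolding app_Fop[symmetric] by (intro closed_Collect_eq continuous_intros)
  qed (auto simp: vh F_add F_scale cinner_add_left cinner_scaleC_left)
qed

lemma F_weak_limit:
  assumes "s \<in> {1, - 1}"
  shows "(\<lambda>n. cinner (vec (shift (s * int n) v)) h) \<longlonglongrightarrow> cinner (F (vec v)) h"
  using F_limit[OF assms] by (simp add: F_symmetric)

lemma F_vec_shift: "F (vec (shift d v)) = F (vec v)"
proof (rule cinner_eqI)
  fix h
  define s :: int where "s = (if 0 \<le> d then 1 else - 1)"
  have s: "s \<in> {1, - 1}" "s * int (nat \<bar>d\<bar>) = d" by (auto simp: s_def)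
  have "shift (s * int n) (shift d v) = shift (s * int (n + nat \<bar>d\<bar>)) v" for n
  proof -
    have "s * int n + d = s * int (n + nat \<bar>d\<bar>)" unfolding of_nat_add distrib_left s(2) ..
    then show ?thesis by simp
  qed
  then have "(\<lambda>n. cinner (vec (shift (s * int (n + nat \<bar>d\<bar>)) v)) h) \<longlonglongrightarrow> cinner (F (vec (shift d v))) h"
    using F_weak_limit[OF s(1), of "shift d v" h] by (simp only:)
  then have "(\<lambda>n. cinner (vec (shift (s * int n) v)) h) \<longlonglongrightarrow> cinner (F (vec (shift d v))) h"
    by (rule LIMSEQ_offset)
  then show "cinner (F (vec (shift d v))) h = cinner (F (vec v)) h"
    using F_weak_limit[OF s(1), of v h] LIMSEQ_unique by blast
qed

end

section \<open>Matrix coefficients between limit vectors\<close>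

context boolean_tail
begin

text \<open>An iterated limit in direction \<open>s\<close>, first for \<open>v\<close>, then for
  \<open>w\<close>. For fixed \<open>m\<close> and all large \<open>n\<close> the letters are
  ordered as in the word on the right, so every inner limit is one of eventually constant
  values.\<close>

lemma cinner_F_eq_mom:
  assumes s: "s \<in> {1, - 1 :: int}" and D: "0 \<le> D"
    and far: "\<And>j i. j \<in> set J \<Longrightarrow> i \<in> set v \<union> set w \<Longrightarrow> s * j < s * i"
    and bound: "\<And>t t'. t \<in> set w \<union> set J \<Longrightarrow> t' \<in> set v \<Longrightarrow> s * t < s * t' + D"
  shows "cinner (app (Y J) (F (vec v))) (F (vec w)) = mom (rev w @ J @ shift (s * D) v)" (is "_ = ?\<alpha>")
proof -
  have ss: "s * (t + s * d) = s * t + d" for t d using s by (auto simp: distrib_left)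
  have sn: "s * (s * d) = d" for d using s by auto
  have const: "cinner (app (Y J) (F (vec v))) (vec (shift (s * int m) w)) = ?\<alpha>" for m
  proof -
    let ?z = "vec (shift (s * int m) w)"
    have "(\<lambda>n. cinner (vec (shift (s * int n) v)) (app (Y (rev J)) ?z)) \<longlonglongrightarrow>
        cinner (F (vec v)) (app (Y (rev J)) ?z)" by (rule F_weak_limit[OF s])
    then have "(\<lambda>n. mom (shift (s * int m) (rev w) @ J @ shift (s * int n) v)) \<longlonglongrightarrow>
        cinner (app (Y J) (F (vec v))) ?z"
      by (simp add: Y_adjoint[of J] Y_vec cinner_vec)
    moreover have "mom (shift (s * int m) (rev w) @ J @ shift (s * int n) v) = ?\<alpha>" if n: "D + int m \<le> int n" for n
    proof -
      define d where "d = int n - (D + int m)"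
      define V where "V = shift (s * (D + int m)) v"
      have "shift (s * int n) v = shift (s * d) V" by (simp add: V_def d_def algebra_simps)
      moreover have "mom ((shift (s * int m) (rev w) @ J) @ shift (s * d) V) =
          mom ((shift (s * int m) (rev w) @ J) @ V)"
      proof (rule mom_move_segment(1)[OF s])
        show "0 \<le> s * (s * d)" using n by (simp add: sn d_def)
        fix t t' assume t: "t \<in> set (shift (s * int m) (rev w) @ J)" "t' \<in> set V"
        then obtain t0' where t0': "t0' \<in> set v" "t' = t0' + s * (D + int m)" by (auto simp: V_def)
        from t(1) consider t0 where "t0 \<in> set w" "t = t0 + s * int m" | "t \<in> set J" by auto
        then show "s * t < s * t'"
        proof cases
          case 1
          then show ?thesis using bound[of t0 t0'] t0' by (simp only: ss) simp
        next
          case 2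
          then show ?thesis using bound[of t t0'] t0' by (simp only: ss) simp
        qed
      qed
      \<comment> \<open>Everything except \<open>J\<close> moves outwards together; \<open>J\<close>
        is the innermost block.\<close>
      moreover have "mom (map (\<lambda>t. if t \<in> - set J then t + s * int m else t) (rev w @ J @ shift (s * D) v)) = ?\<alpha>"
      proof (rule mom_move[OF s])
        show "0 \<le> s * (s * int m)" by (simp add: sn)
        fix t t' assume t: "t \<in> set (rev w @ J @ shift (s * D) v)" "t' \<in> set (rev w @ J @ shift (s * D) v)"
          "t \<notin> - set J" "t' \<in> - set J"
        then have tJ: "t \<in> set J" by simp
        from t consider "t' \<in> set w" | t0 where "t0 \<in> set v" "t' = t0 + s * D" by auto
        then show "s * t < s * t'"
        proof cases
          case 1
          then show ?thesis using far[OF tJ] by simp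
        next
          case 2
          then show ?thesis using bound[of t t0] tJ by (simp only: ss) simp
        qed
      qed
      moreover have "map (\<lambda>t. if t \<in> - set J then t + s * int m else t) (rev w @ J @ shift (s * D) v) =
          shift (s * int m) (rev w) @ J @ V"
      proof -
        have "t \<notin> set J" if "t \<in> set w" for t using far[of t t] that by auto
        moreover have "t + s * D \<notin> set J" if "t \<in> set v" for t
          using bound[of "t + s * D" t] that by (auto simp: ss)
        ultimately show ?thesis
          by (auto simp: shift_def V_def algebra_simps intro!: map_idI)
      qed
      ultimately show ?thesis by simp
    qed
    then have "\<forall>\<^sub>F n in sequentially. mom (shift (s * int m) (rev w) @ J @ shift (s * int n) v) = ?\<alpha>"
      unfolding eventually_sequentially by (intro exI[of _ "nat (D + int m)"]) auto
    then have "(\<lambda>n. mom (shift (s * int m) (rev w) @ J @ shift (s * int n) v)) \<longlonglongrightarrow> ?\<alpha>"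
      by (rule tendsto_eventually)
    ultimately show ?thesis by (rule LIMSEQ_unique)
  qed
  have "(\<lambda>m. cnj (cinner (vec (shift (s * int m) w)) (app (Y J) (F (vec v))))) \<longlonglongrightarrow>
      cnj (cinner (F (vec w)) (app (Y J) (F (vec v))))"
    by (intro tendsto_intros F_weak_limit[OF s])
  then have "(\<lambda>m :: nat. ?\<alpha>) \<longlonglongrightarrow> cinner (app (Y J) (F (vec v))) (F (vec w))"
    by (simp only: cinner_commute[symmetric] const)
  then show ?thesis by (simp add: LIMSEQ_const_iff)
qed

text \<open>Here \<open>s\<close> points from \<open>J\<close> towards \<open>v\<close> and
  \<open>w\<close>, so operators far out in one direction are treated with the opposite sign. The
  two moments of \<open>mom_separate_signed\<close> are the two iterated limits, the second one
  obtained by passing to adjoints, and both equal the right-hand side.\<close>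

lemma cinner_Y_F:
  assumes s: "s \<in> {1, - 1 :: int}" and J: "J \<noteq> []"
    and far: "\<And>j i. j \<in> set J \<Longrightarrow> i \<in> set v \<union> set w \<Longrightarrow> s * j < s * i"
  shows "cinner (app (Y J) (vec v)) (vec w) = cinner (app (Y J) (F (vec v))) (F (vec w))"
proof -
  obtain D1 :: int where D1: "0 < D1" "\<And>t t'. t \<in> set (w @ J) \<Longrightarrow> t' \<in> set v \<Longrightarrow> s * t < s * t' + D1"
    using exists_signed_bound[of "w @ J" v s] by blast
  obtain D2 :: int where D2: "0 < D2" "\<And>t t'. t \<in> set (v @ J) \<Longrightarrow> t' \<in> set w \<Longrightarrow> s * t < s * t' + D2"
    using exists_signed_bound[of "v @ J" w s] by blast
  define D where "D = D1 + D2"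
  let ?q = "cinner (app (Y J) (F (vec v))) (F (vec w))"
  have D: "0 \<le> D" "0 \<le> s * (s * D)" using D1 D2 s by (auto simp: D_def)
  have "?q = mom (rev w @ J @ shift (s * D) v)"
    using far D1 D2(1) D by (intro cinner_F_eq_mom[OF s]) (fastforce simp: D_def)+
  moreover have "cinner (app (Y (rev J)) (F (vec w))) (F (vec v)) = mom (rev v @ rev J @ shift (s * D) w)"
    using far D2 D1(1) D by (intro cinner_F_eq_mom[OF s]) (fastforce simp: D_def)+
  then have "?q = cnj (mom (rev v @ rev J @ shift (s * D) w))"
    unfolding Y_adjoint[of J] by (metis cinner_commute)
  then have "?q = mom (shift (s * D) (rev w) @ J @ v)" by (simp flip: mom_rev)
  moreover have "2 * mom (rev w @ J @ v) = mom (rev w @ J @ shift (s * D) v) + mom (shift (s * D) (rev w) @ J @ v)"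
    by (rule mom_separate_signed[OF s D(2) J]) (use far in auto)
  ultimately have "2 * mom (rev w @ J @ v) = 2 * ?q" by simp
  then show ?thesis by (simp add: Y_vec cinner_vec)
qed

lemma cinner_Y_shift_F:
  assumes J: "J \<noteq> []"
  shows "cinner (app (Y (shift d J)) (F (vec v))) (F (vec w)) = cinner (app (Y J) (F (vec v))) (F (vec w))"
proof -
  obtain e1 :: int where e1: "0 < e1" "\<And>t t'. t \<in> set J \<Longrightarrow> t' \<in> set (v @ w) \<Longrightarrow> 1 * t < 1 * t' + e1"
    using exists_signed_bound[of J "v @ w" 1] by blast
  have "cinner (app (Y (shift d J)) (F (vec (shift (d + e1) v)))) (F (vec (shift (d + e1) w))) =
      cinner (app (Y (shift d J)) (vec (shift (d + e1) v))) (vec (shift (d + e1) w))"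
    by (rule cinner_Y_F[of 1, symmetric]) (use J e1 in auto)
  also have "\<dots> = mom (shift d (rev (shift e1 w) @ J @ shift e1 v))"
    by (simp add: Y_vec cinner_vec)
  also have "\<dots> = cinner (app (Y J) (vec (shift e1 v))) (vec (shift e1 w))"
    unfolding mom_shift by (simp add: Y_vec cinner_vec)
  also have "\<dots> = cinner (app (Y J) (F (vec (shift e1 v)))) (F (vec (shift e1 w)))"
    by (rule cinner_Y_F[of 1]) (use J e1 in auto)
  finally show ?thesis by (simp only: F_vec_shift)
qed

section \<open>The tail algebras\<close>

text \<open>The span of nonempty words, an explicit form of the non-unital algebra that suits
  \<open>cinner_Y_F\<close>, which concerns nonempty words.\<close>

inductive_set word_span :: "int set \<Rightarrow> 'k bop set" for S where
  zero: "0 \<in> word_span S"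
| word: "J \<noteq> [] \<Longrightarrow> set J \<subseteq> S \<Longrightarrow> X J \<in> word_span S"
| add: "a \<in> word_span S \<Longrightarrow> b \<in> word_span S \<Longrightarrow> a + b \<in> word_span S"
| scale: "a \<in> word_span S \<Longrightarrow> c *\<^sub>C a \<in> word_span S"

lemma word_span_mult:
  assumes "a \<in> word_span S" "b \<in> word_span S" shows "a * b \<in> word_span S"
  using assms(1)
proof induction
  case (word J)
  from assms(2) show ?case
  proof induction
    case (word J')
    have "X (J @ J') \<in> word_span S" by (rule word_span.word) (use word \<open>J \<noteq> []\<close> \<open>set J \<subseteq> S\<close> in auto)
    then show ?case by (simp add: X_def)
  qed (auto simp: distrib_left scaleC_mult_right intro: word_span.intros)
qed (auto simp: distrib_right scaleC_mult_left intro: word_span.intros)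

lemma nonunital_alg_word_span: "nonunital_alg (x ` S) = word_span S"
proof (rule set_eqI, rule iffI)
  fix a assume "a \<in> nonunital_alg (x ` S)"
  then show "a \<in> word_span S"
  proof induction
    case (gen a)
    then obtain i where "i \<in> S" "a = x i" by blast
    then show ?case using word_span.word[of "[i]" S] by (simp add: X_def)
  qed (auto intro: word_span.intros word_span_mult)
next
  have X: "X J \<in> nonunital_alg (x ` S)" if "J \<noteq> []" "set J \<subseteq> S" for J
    using that
  proof (induction J rule: list_nonempty_induct)
    case (single i)
    then show ?case by (simp add: X_def nonunital_alg.gen)
  next
    case (cons i J)
    then have "x i * X J \<in> nonunital_alg (x ` S)" by (auto intro: nonunital_alg.mult nonunital_alg.gen)
    then show ?case by (simp add: X_def)
  qed
  fix a assume "a \<in> word_span S"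
  then show "a \<in> nonunital_alg (x ` S)"
    by induction (auto intro: nonunital_alg.intros X)
qed

lemma word_span_A: "a \<in> word_span S \<Longrightarrow> a \<in> A"
  by (induction rule: word_span.induct) (auto intro: A_intros X_in_A)

text \<open>For fixed \<open>v\<close> and \<open>w\<close> the claim equates two matrix
  coefficients of \<open>\<pi> a\<close>, a WOT closed condition, and it holds on the span of words
  far beyond \<open>v\<close> and \<open>w\<close>.\<close>

lemma tail_compressed:
  assumes s: "s \<in> {1, - 1 :: int}"
    and a: "\<And>k. 0 < s * k \<Longrightarrow> \<pi> a \<in> wot closure_of (\<pi> ` word_span {i. s * k \<le> s * i})"
  shows "\<pi> a = Fop * \<pi> a * Fop"
proof (rule bop_vec_ext)
  fix v w
  obtain K :: int where K: "0 < K" "\<And>t t'. t \<in> set (v @ w) \<Longrightarrow> t' \<in> set [0] \<Longrightarrow> s * t < s * t' + K"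
    using exists_signed_bound[of "v @ w" "[0]" s] by blast
  let ?S = "{i. s * (s * K) \<le> s * i}"
  let ?C = "{T. cinner (app T (vec v)) (vec w) = cinner (app T (F (vec v))) (F (vec w))}"
  have sK: "s * (s * K) = K" using s by auto
  have "\<pi> b \<in> ?C" if "b \<in> word_span ?S" for b
    using that
  proof induction
    case zero
    then show ?case by (simp add: pi_zero)
  next
    case (word J)
    have "cinner (app (Y J) (vec v)) (vec w) = cinner (app (Y J) (F (vec v))) (F (vec w))"
    proof (rule cinner_Y_F[of "- s"])
      fix j i assume "j \<in> set J" "i \<in> set v \<union> set w"
      then show "- s * j < - s * i" using K(2)[of i 0] word(2) sK by force
    qed (use s word in auto)
    then show ?case by (simp add: Y_def)
  next
    case (add a b)
    then show ?case by (simp add: pi_add word_span_A app_simps cinner_add_left)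
  next
    case (scale a c)
    then show ?case by (simp add: pi_scale word_span_A app_simps cinner_scaleC_left)
  qed
  then have "wot closure_of (\<pi> ` word_span ?S) \<subseteq> ?C"
    by (intro closure_of_minimal closedin_wot_eq) auto
  then have "\<pi> a \<in> ?C" using a[of "s * K"] sK K(1) by auto
  then show "cinner (app (\<pi> a) (vec v)) (vec w) = cinner (app (Fop * \<pi> a * Fop) (vec v)) (vec w)"
    by (simp add: app_times app_Fop F_symmetric)
qed

text \<open>Convergence on a dense subspace extends by the uniform bound. Scaling is asked for in
  modulus only, so that the lemma serves both the linear and the conjugate linear argument in
  \<open>Y_shift_limit\<close>.\<close>

lemma vec_tendsto_zero:
  fixes g :: "nat \<Rightarrow> 'h \<Rightarrow> complex"
  assumes bound: "\<And>n h. cmod (g n h) \<le> M * norm h" and add: "\<And>n h h'. g n (h + h') = g n h + g n h'"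
    and scale: "\<And>n c h. cmod (g n (c *\<^sub>C h)) = cmod c * cmod (g n h)"
    and vec: "\<And>w. (\<lambda>n. g n (vec w)) \<longlonglongrightarrow> 0"
  shows "(\<lambda>n. g n h) \<longlonglongrightarrow> 0"
proof (rule vec_dense_induct[of "\<lambda>h. (\<lambda>n. g n h) \<longlonglongrightarrow> 0"])
  show "closed {h. (\<lambda>n. g n h) \<longlonglongrightarrow> 0}"
    unfolding closed_sequential_limits
  proof (intro allI impI, elim conjE)
    fix f l assume f: "\<forall>k. f k \<in> {h. (\<lambda>n. g n h) \<longlonglongrightarrow> 0}" and l: "f \<longlonglongrightarrow> l"
    have "(\<lambda>n. g n l) \<longlonglongrightarrow> 0"
    proof (rule LIMSEQ_I)
      fix e :: real assume "0 < e"
      have M: "0 < \<bar>M\<bar> + 1" by simp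
      then have "0 < e / (2 * (\<bar>M\<bar> + 1))" using \<open>0 < e\<close> by simp
      then obtain k where k: "norm (f k - l) < e / (2 * (\<bar>M\<bar> + 1))" using LIMSEQ_D[OF l] by blast
      obtain N where N: "\<And>n. n \<ge> N \<Longrightarrow> cmod (g n (f k)) < e / 2"
        using f LIMSEQ_D[of "\<lambda>n. g n (f k)" 0 "e / 2"] \<open>0 < e\<close> by auto
      have "cmod (g n l - 0) < e" if "n \<ge> N" for n
      proof -
        have "g n l = g n (f k) + g n (l - f k)" using add[of n "f k" "l - f k"] by simp
        then have "cmod (g n l) \<le> cmod (g n (f k)) + cmod (g n (l - f k))" by (simp add: norm_triangle_ineq)
        moreover have "cmod (g n (l - f k)) \<le> (\<bar>M\<bar> + 1) * norm (f k - l)"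
          by (rule order_trans[OF bound]) (simp add: norm_minus_commute mult_right_mono)
        moreover have "(\<bar>M\<bar> + 1) * norm (f k - l) < e / 2" using k M by (simp add: field_simps)
        ultimately show ?thesis using N[OF that] by simp
      qed
      then show "\<exists>N. \<forall>n\<ge>N. cmod (g n l - 0) < e" by blast
    qed
    then show "l \<in> {h. (\<lambda>n. g n h) \<longlonglongrightarrow> 0}" by simp
  qed
  show "(\<lambda>n. g n (h + h')) \<longlonglongrightarrow> 0" if "(\<lambda>n. g n h) \<longlonglongrightarrow> 0" "(\<lambda>n. g n h') \<longlonglongrightarrow> 0" for h h'
    using tendsto_add[OF that] by (simp add: add)
  show "(\<lambda>n. g n (c *\<^sub>C h)) \<longlonglongrightarrow> 0" if "(\<lambda>n. g n h) \<longlonglongrightarrow> 0" for c h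
    using tendsto_mult_left[OF tendsto_norm_zero[OF that], of "cmod c"]
    by (rule_tac tendsto_norm_zero_cancel) (simp only: scale mult_zero_right)
qed (rule vec)

text \<open>Translation of words is isometric and carries \<open>Y J\<close> to
  \<open>Y (shift d J)\<close>, so one bound serves for all \<open>d\<close>.\<close>

lemma Y_shift_bounded:
  obtains K where "0 < K" "\<And>d \<xi>. norm (app (Y (shift d J)) \<xi>) \<le> K * norm \<xi>"
proof -
  obtain K where K: "0 < K" "\<And>\<xi>. norm (app (Y J) \<xi>) \<le> K * norm \<xi>" using app_bounded by blast
  have "norm (app (Y (shift d J)) \<xi>) \<le> K * norm \<xi>" for d \<xi>
  proof -
    let ?P = "{\<xi>. norm (app (Y (shift d J)) \<xi>) \<le> K * norm \<xi>}"
    have "comb 0 f \<in> ?P" for f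
    proof -
      let ?g = "map (\<lambda>(c, w). (c, J @ shift (- d) w)) f"
      have "app (Y (shift d J)) (comb 0 f) = comb d ?g"
        by (induction f) (auto simp: comb_simps app_simps Y_vec)
      moreover have "app (Y J) (comb (- d) f) = comb 0 ?g"
        by (induction f) (auto simp: comb_simps app_simps Y_vec)
      ultimately have "norm (app (Y (shift d J)) (comb 0 f)) = norm (app (Y J) (comb (- d) f))"
        by (simp add: norm_comb[of d])
      also have "\<dots> \<le> K * norm (comb 0 f)" using K(2)[of "comb (- d) f"] by (simp only: norm_comb[of "- d"])
      finally show ?thesis by simp
    qed
    moreover have "closed ?P" by (intro closed_Collect_le continuous_intros)
    ultimately have "closure (range (comb 0)) \<subseteq> ?P" by (intro closure_minimal) auto
    then show ?thesis using closure_comb by auto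
  qed
  then show ?thesis using that K(1) by blast
qed

lemma Y_shift_limit:
  assumes s: "s \<in> {1, - 1 :: int}" and J: "J \<noteq> []"
  shows "(\<lambda>n. cinner (app (Y (shift (s * int n) J)) \<xi>) \<eta>) \<longlonglongrightarrow> cinner (app (Y J) (F \<xi>)) (F \<eta>)"
proof -
  obtain K where K: "0 < K" "\<And>d \<xi>. norm (app (Y (shift d J)) \<xi>) \<le> K * norm \<xi>"
    using Y_shift_bounded by blast
  define g where "g n \<xi> \<eta> = cinner (app (Y (shift (s * int n) J)) \<xi>) \<eta> - cinner (app (Y J) (F \<xi>)) (F \<eta>)" for n \<xi> \<eta>
  have bound: "cmod (g n \<xi> \<eta>) \<le> 2 * K * norm \<xi> * norm \<eta>" for n \<xi> \<eta>
  proof -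
    have "cmod (cinner (app (Y (shift d J)) \<xi>) \<eta>) \<le> K * norm \<xi> * norm \<eta>" for d \<xi> \<eta>
      by (rule order_trans[OF complex_Cauchy_Schwarz mult_right_mono[OF K(2)]]) simp
    from this[of _ \<xi> \<eta>] this[of 0 "F \<xi>" "F \<eta>"]
    have "cmod (cinner (app (Y (shift (s * int n) J)) \<xi>) \<eta>) \<le> K * norm \<xi> * norm \<eta>"
      "cmod (cinner (app (Y J) (F \<xi>)) (F \<eta>)) \<le> K * norm (F \<xi>) * norm (F \<eta>)" by auto
    moreover have "K * norm (F \<xi>) * norm (F \<eta>) \<le> K * norm \<xi> * norm \<eta>"
      using K(1) by (intro mult_mono F_norm) auto
    ultimately show ?thesis
      unfolding g_def
      using norm_triangle_ineq4[of "cinner (app (Y (shift (s * int n) J)) \<xi>) \<eta>" "cinner (app (Y J) (F \<xi>)) (F \<eta>)"]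
      by linarith
  qed
  have vv: "(\<lambda>n. g n (vec v) (vec w)) \<longlonglongrightarrow> 0" for v w
  proof -
    obtain D :: int where D: "0 < D" "\<And>t t'. t \<in> set (v @ w) \<Longrightarrow> t' \<in> set J \<Longrightarrow> s * t < s * t' + D"
      using exists_signed_bound[of "v @ w" J s] by blast
    have "g n (vec v) (vec w) = 0" if n: "D \<le> int n" for n
    proof -
      have "cinner (app (Y (shift (s * int n) J)) (vec v)) (vec w) =
          cinner (app (Y (shift (s * int n) J)) (F (vec v))) (F (vec w))"
      proof (rule cinner_Y_F[of "- s"])
        fix j i assume "j \<in> set (shift (s * int n) J)" "i \<in> set v \<union> set w"
        then obtain j0 where "j0 \<in> set J" "j = j0 + s * int n" by auto
        moreover have "s * (j0 + s * int n) = s * j0 + int n" using s by (auto simp: distrib_left)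
        ultimately show "- s * j < - s * i"
          using D(2)[of i j0] n \<open>i \<in> set v \<union> set w\<close> by auto
      qed (use s J in auto)
      then show ?thesis by (simp add: g_def cinner_Y_shift_F[OF J])
    qed
    then have "\<forall>\<^sub>F n in sequentially. g n (vec v) (vec w) = 0"
      unfolding eventually_sequentially by (intro exI[of _ "nat D"]) auto
    then show ?thesis by (rule tendsto_eventually)
  qed
  have v\<eta>: "(\<lambda>n. g n (vec v) \<eta>) \<longlonglongrightarrow> 0" for v \<eta>
  proof (rule vec_tendsto_zero[of _ "2 * K * norm (vec v)"])
    show "cmod (g n (vec v) (c *\<^sub>C h)) = cmod c * cmod (g n (vec v) h)" for n c h
    proof -
      have "g n (vec v) (c *\<^sub>C h) = cnj c * g n (vec v) h"
        by (simp add: g_def F_scale cinner_scaleC_right algebra_simps)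
      then show ?thesis by (simp add: norm_mult)
    qed
  qed (use bound vv in \<open>auto simp: g_def F_add cinner_add_right\<close>)
  have "(\<lambda>n. g n \<xi> \<eta>) \<longlonglongrightarrow> 0"
  proof (rule vec_tendsto_zero[of "\<lambda>n \<xi>. g n \<xi> \<eta>" "2 * K * norm \<eta>"])
    show "cmod (g n (c *\<^sub>C h) \<eta>) = cmod c * cmod (g n h \<eta>)" for n c h
    proof -
      have "g n (c *\<^sub>C h) \<eta> = c * g n h \<eta>"
        by (simp add: g_def F_scale app_simps cinner_scaleC_left algebra_simps)
      then show ?thesis by (simp add: norm_mult)
    qed
    show "cmod (g n h \<eta>) \<le> 2 * K * norm \<eta> * norm h" for n h using bound[of n h \<eta>] by (simp add: mult_ac)
  qed (use v\<eta> in \<open>auto simp: g_def F_add app_simps cinner_add_left\<close>)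
  then show ?thesis unfolding g_def by (rule LIM_zero_cancel)
qed

lemma compression_in_closure:
  assumes s: "s \<in> {1, - 1 :: int}" and b: "b \<in> word_span UNIV"
  shows "Fop * \<pi> b * Fop \<in> wot closure_of (\<pi> ` word_span {i. s * k \<le> s * i})"
proof -
  let ?S = "{i. s * k \<le> s * i}"
  \<comment> \<open>Approximating sequences are stronger than membership in the closure, and they
    can be added term by term in the induction.\<close>
  have "\<exists>c :: nat \<Rightarrow> 'k bop. (\<forall>n. c n \<in> word_span ?S) \<and>
      (\<forall>\<xi> \<eta>. (\<lambda>n. cinner (app (\<pi> (c n)) \<xi>) \<eta>) \<longlonglongrightarrow> cinner (app (Fop * \<pi> b * Fop) \<xi>) \<eta>)"
    using b
  proof induction
    case zero
    show ?case by (rule exI[of _ "\<lambda>_. 0"]) (simp add: word_span.zero pi_zero app_times)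
  next
    case (word J)
    obtain D :: int where D: "0 < D" "\<And>t t'. t \<in> set [k] \<Longrightarrow> t' \<in> set J \<Longrightarrow> s * t < s * t' + D"
      using exists_signed_bound[of "[k]" J s] by blast
    let ?c = "\<lambda>n. X (shift (s * int (n + nat D)) J)"
    have "?c n \<in> word_span ?S" for n
    proof (rule word_span.word)
      show "set (shift (s * int (n + nat D)) J) \<subseteq> ?S"
      proof
        fix j assume "j \<in> set (shift (s * int (n + nat D)) J)"
        then obtain j0 where "j0 \<in> set J" "j = j0 + s * int (n + nat D)" by auto
        moreover have "s * (j0 + s * int (n + nat D)) = s * j0 + int (n + nat D)"
          using s by (auto simp: distrib_left)
        ultimately show "j \<in> ?S" using D(1) D(2)[of k j0] by simp
      qed
    qed (use word in simp)
    moreover have "(\<lambda>n. cinner (app (\<pi> (?c n)) \<xi>) \<eta>) \<longlonglongrightarrow> cinner (app (Fop * \<pi> (X J) * Fop) \<xi>) \<eta>" for \<xi> \<eta>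
      using LIMSEQ_ignore_initial_segment[OF Y_shift_limit[OF s word(1), of \<xi> \<eta>], of "nat D"]
      by (simp only: app_times app_Fop F_symmetric Y_def)
    ultimately show ?case by (intro exI[of _ ?c]) auto
  next
    case (add a b)
    then obtain c d where c: "\<And>n. c n \<in> word_span ?S"
        "\<And>\<xi> \<eta>. (\<lambda>n. cinner (app (\<pi> (c n)) \<xi>) \<eta>) \<longlonglongrightarrow> cinner (app (Fop * \<pi> a * Fop) \<xi>) \<eta>"
      and d: "\<And>n. d n \<in> word_span ?S"
        "\<And>\<xi> \<eta>. (\<lambda>n. cinner (app (\<pi> (d n)) \<xi>) \<eta>) \<longlonglongrightarrow> cinner (app (Fop * \<pi> b * Fop) \<xi>) \<eta>"
      by metis
    have "(\<lambda>n. cinner (app (\<pi> (c n + d n)) \<xi>) \<eta>) \<longlonglongrightarrow> cinner (app (Fop * \<pi> (a + b) * Fop) \<xi>) \<eta>" for \<xi> \<eta>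
    proof -
      have "\<pi> (c n + d n) = \<pi> (c n) + \<pi> (d n)" for n by (rule pi_add[OF word_span_A[OF c(1)] word_span_A[OF d(1)]])
      moreover have "\<pi> (a + b) = \<pi> a + \<pi> b" using add(1,2) by (intro pi_add word_span_A)
      ultimately show ?thesis
        using tendsto_add[OF c(2)[of \<xi> \<eta>] d(2)[of \<xi> \<eta>]]
        by (simp add: distrib_left distrib_right app_plus cinner_add_left)
    qed
    then show ?case using c(1) d(1) by (intro exI[of _ "\<lambda>n. c n + d n"]) (auto intro: word_span.add)
  next
    case (scale a z)
    then obtain c where c: "\<And>n. c n \<in> word_span ?S"
        "\<And>\<xi> \<eta>. (\<lambda>n. cinner (app (\<pi> (c n)) \<xi>) \<eta>) \<longlonglongrightarrow> cinner (app (Fop * \<pi> a * Fop) \<xi>) \<eta>"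
      by metis
    have "(\<lambda>n. cinner (app (\<pi> (z *\<^sub>C c n)) \<xi>) \<eta>) \<longlonglongrightarrow> cinner (app (Fop * \<pi> (z *\<^sub>C a) * Fop) \<xi>) \<eta>" for \<xi> \<eta>
    proof -
      have "\<pi> (z *\<^sub>C c n) = z *\<^sub>C \<pi> (c n)" for n by (rule pi_scale[OF word_span_A[OF c(1)]])
      moreover have "\<pi> (z *\<^sub>C a) = z *\<^sub>C \<pi> a" using scale(1) by (intro pi_scale word_span_A)
      ultimately show ?thesis
        using tendsto_mult_left[OF c(2)[of \<xi> \<eta>], of z]
        by (simp add: scaleC_mult_left scaleC_mult_right app_scaleC cinner_scaleC_left)
    qed
    then show ?case using c(1) by (intro exI[of _ "\<lambda>n. z *\<^sub>C c n"]) (auto intro: word_span.scale)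
  qed
  then obtain c :: "nat \<Rightarrow> 'k bop" where c: "\<And>n. c n \<in> word_span ?S"
    "\<And>\<xi> \<eta>. (\<lambda>n. cinner (app (\<pi> (c n)) \<xi>) \<eta>) \<longlonglongrightarrow> cinner (app (Fop * \<pi> b * Fop) \<xi>) \<eta>" by blast
  show ?thesis
  proof (rule wot_limit_in_closed[OF closedin_closure_of])
    show "\<forall>\<^sub>F n in sequentially. \<pi> (c n) \<in> wot closure_of (\<pi> ` word_span ?S)"
      using c(1) closure_of_subset[of "\<pi> ` word_span ?S" wot] by (intro always_eventually allI) auto
  qed (use c(2) in auto)
qed

lemma continuous_map_compression: "continuous_map wot wot (\<lambda>T. Fop * T * Fop)"
proof (rule continuous_map_into_wot)
  fix \<xi> \<eta>
  have "(\<lambda>T. cinner (app (Fop * T * Fop) \<xi>) \<eta>) = (\<lambda>T. cinner (app T (F \<xi>)) (F \<eta>))"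
    by (simp add: app_times app_Fop F_symmetric)
  then show "continuous_map wot euclidean (\<lambda>T. cinner (app (Fop * T * Fop) \<xi>) \<eta>)"
    by (simp only: continuous_map_wot_cinner)
qed

lemma tail_in_closure:
  assumes s: "s \<in> {1, - 1 :: int}" and s': "s' \<in> {1, - 1 :: int}"
    and a: "\<And>k. 0 < s * k \<Longrightarrow> \<pi> a \<in> wot closure_of (\<pi> ` word_span {i. s * k \<le> s * i})"
  shows "\<pi> a \<in> wot closure_of (\<pi> ` word_span {i. s' * k' \<le> s' * i})"
proof -
  let ?f = "\<lambda>T. Fop * T * Fop"
  have sub: "word_span S \<subseteq> word_span UNIV" for S
  proof
    show "a \<in> word_span UNIV" if "a \<in> word_span S" for a
      using that by induction (auto intro: word_span.intros)
  qed
  have "0 < s * s" using s by auto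
  from a[OF this] have "\<pi> a \<in> wot closure_of (\<pi> ` word_span UNIV)"
    by (rule subsetD[OF closure_of_mono[OF image_mono[OF sub]]])
  then have "?f (\<pi> a) \<in> wot closure_of (?f ` \<pi> ` word_span UNIV)"
    by (intro subsetD[OF continuous_map_image_closure_subset[OF continuous_map_compression]] imageI)
  also have "?f ` \<pi> ` word_span UNIV \<subseteq> wot closure_of (\<pi> ` word_span {i. s' * k' \<le> s' * i})"
    using compression_in_closure[OF s'] by auto
  then have "wot closure_of (?f ` \<pi> ` word_span UNIV) \<subseteq> wot closure_of (\<pi> ` word_span {i. s' * k' \<le> s' * i})"
    by (rule closure_of_minimal) (rule closedin_closure_of)
  finally show ?thesis using tail_compressed[OF s a] by simp
qed

theorem tail_plus_eq_tail_minus: "tail_plus A \<pi> x = tail_minus A \<pi> x"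
proof -
  define tail where "tail s = {a \<in> A. \<forall>k. 0 < s * k \<longrightarrow> \<pi> a \<in> wot closure_of (\<pi> ` word_span {i. s * k \<le> s * i})}"
    for s :: int
  have "tail s \<subseteq> tail s'" if "s \<in> {1, - 1}" "s' \<in> {1, - 1}" for s s'
    using tail_in_closure[OF that] by (auto simp: tail_def)
  then have "tail 1 = tail (- 1)" by blast
  moreover have "tail_plus A \<pi> x = tail 1"
  proof (intro set_eqI iffI)
    fix a assume a: "a \<in> tail_plus A \<pi> x"
    \<comment> \<open>One member of the intersection is singled out to obtain
      \<open>a \<in> A\<close>.\<close>
    then have "a \<in> gns_wot_closure A \<pi> (nonunital_alg (x ` {1..}))"
      unfolding tail_plus_def by (rule INT_D) simp
    with a show "a \<in> tail 1"
      by (auto simp: tail_def tail_plus_def gns_wot_closure_def nonunital_alg_word_span atLeast_def)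
  qed (auto simp: tail_def tail_plus_def gns_wot_closure_def nonunital_alg_word_span atLeast_def)
  moreover have "tail_minus A \<pi> x = tail (- 1)"
  proof (intro set_eqI iffI)
    fix a assume a: "a \<in> tail_minus A \<pi> x"
    then have "a \<in> gns_wot_closure A \<pi> (nonunital_alg (x ` {..- 1}))"
      unfolding tail_minus_def by (rule INT_D) simp
    with a show "a \<in> tail (- 1)"
      by (auto simp: tail_def tail_minus_def gns_wot_closure_def nonunital_alg_word_span atMost_def)
  qed (auto simp: tail_def tail_minus_def gns_wot_closure_def nonunital_alg_word_span atMost_def)
  ultimately show ?thesis by simp
qed

end

theorem corollary9p3:
  fixes A :: "'k :: chilbert_space bop set"
    and \<phi> :: "'k bop \<Rightarrow> complex"
    and \<pi> :: "'k bop \<Rightarrow> 'h :: chilbert_space bop"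
    and \<Omega> :: 'h
    and x :: "int \<Rightarrow> 'k bop"
  assumes "von_neumann_algebra A"
    and "state_on A \<phi>" and "normal_on A \<phi>" and "nondegenerate_on A \<phi>"
    and "gns_representation A \<phi> \<pi> \<Omega>"
    and "\<And>i. selfadjoint (x i)"
    and "A = vn_generated (range x)"
    and "1 \<in> gns_wot_closure A \<pi> (nonunital_alg (range x))"
    and "boolean_spreadable_seq \<phi> x"
  shows "tail_plus A \<pi> x = tail_minus A \<pi> x"
proof -
  interpret boolean_tail A \<phi> \<pi> \<Omega> x
    using assms by unfold_locales auto
  show ?thesis by (rule tail_plus_eq_tail_minus)
qed

end
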